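(* Let $D$ be a digraph and $\omega$ an end of $D$. (a) If $\omega$ contains infinitely many pairwise edge-disjoint rays, then there exists a weak immersion of the bidirected quarter-grid in $D$ with all its rays in $\omega$. (b) If $\omega$ contains infinitely many pairwise edge-disjoint anti-rays, then there exists a weak immersion of the reversed bidirected quarter-grid in $D$ with all its anti-rays in $\omega$.
   Context: A ray is an orientation of a one-way infinite path with every edge oriented towards infinity; an anti-ray one with every edge oriented away from infinity; dipath = directed path. For rays or anti-rays $Q,R$ write $Q\le R$ if there are infinitely many pairwise disjoint $Q$--$R$ dipaths and $Q\sim R$ if $Q\le R$ and $R\le Q$; ends are the $\sim$-classes. Bidirected quarter-grid: take pairwise disjoint rays $R_i=x^i_1x^i_2\ldots$ ($i\ge1$), add edges $x^i_{4j+7}x^{i+1}_{4j+1}$ and $x^{i+1}_{4j+2}x^i_{4j+8}$ for all $j\ge0$, $i\ge1$, then suppress every $v\in V(R_i)$ with $d^-(v)=d^+(v)=1$ all of whose neighbours lie on $R_i$. The reversed bidirected quarter-grid is obtained by reversing all edge orientations. A weak immersion of a digraph $H$ in $D$ is a map $\varphi$ on $V(H)\cup E(H)$ such that $\varphi|_{V(H)}$ is injective into $V(D)$ and each edge $uv\in E(H)$ is mapped to a $\varphi(u)$--$\varphi(v)$ dipath in $D$, with $\varphi(e),\varphi(f)$ edge-disjoint for distinct edges $e,f$. "With all its (anti-)rays in $\omega$" means the images of the (anti-)rays of $H$ yield (anti-)rays of $D$ belonging to $\omega$. *)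

theory Defs
  imports Main "Graph_Theory.Digraph" "Graph_Theory.Arc_Walk"
begin

type_synonym ('a,'b) iray = "(nat \<Rightarrow> 'a) \<times> (nat \<Rightarrow> 'b)"

definition ray_verts :: "('a,'b) iray \<Rightarrow> 'a set" where
  "ray_verts R = range (fst R)"

definition ray_arcs :: "('a,'b) iray \<Rightarrow> 'b set" where
  "ray_arcs R = range (snd R)"

definition is_ray :: "('a,'b) pre_digraph \<Rightarrow> ('a,'b) iray \<Rightarrow> bool" where
  "is_ray G R \<longleftrightarrow> inj (fst R) \<and>
     (\<forall>n. fst R n \<in> verts G \<and> snd R n \<in> arcs G \<and>
          tail G (snd R n) = fst R n \<and> head G (snd R n) = fst R (Suc n))"

definition is_antiray :: "('a,'b) pre_digraph \<Rightarrow> ('a,'b) iray \<Rightarrow> bool" where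
  "is_antiray G R \<longleftrightarrow> inj (fst R) \<and>
     (\<forall>n. fst R n \<in> verts G \<and> snd R n \<in> arcs G \<and>
          head G (snd R n) = fst R n \<and> tail G (snd R n) = fst R (Suc n))"

type_synonym ('a,'b) dipath = "'a \<times> 'b list \<times> 'a"

definition dipath_verts :: "('a,'b) pre_digraph \<Rightarrow> ('a,'b) dipath \<Rightarrow> 'a set" where
  "dipath_verts G P = set (pre_digraph.awalk_verts G (fst P) (fst (snd P)))"

definition is_AB_dipath :: "('a,'b) pre_digraph \<Rightarrow> 'a set \<Rightarrow> 'a set \<Rightarrow> ('a,'b) dipath \<Rightarrow> bool" where
  "is_AB_dipath G A B P \<longleftrightarrow>
     pre_digraph.apath G (fst P) (fst (snd P)) (snd (snd P)) \<and>
     dipath_verts G P \<inter> A = {fst P} \<and> dipath_verts G P \<inter> B = {snd (snd P)}"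

definition ray_le :: "('a,'b) pre_digraph \<Rightarrow> ('a,'b) iray \<Rightarrow> ('a,'b) iray \<Rightarrow> bool" where
  "ray_le G Q R \<longleftrightarrow> (\<exists>P :: nat \<Rightarrow> ('a,'b) dipath.
      (\<forall>i. is_AB_dipath G (ray_verts Q) (ray_verts R) (P i)) \<and>
      (\<forall>i j. i \<noteq> j \<longrightarrow> dipath_verts G (P i) \<inter> dipath_verts G (P j) = {}))"

definition ray_equiv :: "('a,'b) pre_digraph \<Rightarrow> ('a,'b) iray \<Rightarrow> ('a,'b) iray \<Rightarrow> bool" where
  "ray_equiv G Q R \<longleftrightarrow> ray_le G Q R \<and> ray_le G R Q"

definition is_ray_or_antiray :: "('a,'b) pre_digraph \<Rightarrow> ('a,'b) iray \<Rightarrow> bool" where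
  "is_ray_or_antiray G R \<longleftrightarrow> is_ray G R \<or> is_antiray G R"

definition is_end :: "('a,'b) pre_digraph \<Rightarrow> ('a,'b) iray set \<Rightarrow> bool" where
  "is_end G \<omega> \<longleftrightarrow> (\<exists>R. is_ray_or_antiray G R \<and>
      \<omega> = {Q. is_ray_or_antiray G Q \<and> ray_equiv G Q R})"

definition rel_digraph :: "'a set \<Rightarrow> ('a \<times> 'a) set \<Rightarrow> ('a, 'a \<times> 'a) pre_digraph" where
  "rel_digraph V E = \<lparr>verts = V, arcs = E, tail = fst, head = snd\<rparr>"

definition suppress :: "('a,'b) pre_digraph \<Rightarrow> 'a set \<Rightarrow> ('a, 'a \<times> 'a) pre_digraph" where
  "suppress G S = rel_digraph (verts G - S)
     {(u, w). u \<in> verts G - S \<and> w \<in> verts G - S \<and>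
        (\<exists>p. p \<noteq> [] \<and> pre_digraph.awalk G u p w \<and>
             set (butlast (tl (pre_digraph.awalk_verts G u p))) \<subseteq> S)}"

text \<open>Vertex x^i_n is encoded as (i, n), with i \<ge> 1 and n \<ge> 1.\<close>
definition pregrid :: "(nat \<times> nat, (nat \<times> nat) \<times> (nat \<times> nat)) pre_digraph" where
  "pregrid = rel_digraph {(i, n). 1 \<le> i \<and> 1 \<le> n}
     ({((i, n), (i, Suc n)) | i n. 1 \<le> i \<and> 1 \<le> n}
      \<union> {((i, 4 * j + 7), (i + 1, 4 * j + 1)) | i j. 1 \<le> i}
      \<union> {((i + 1, 4 * j + 2), (i, 4 * j + 8)) | i j. 1 \<le> i})"

definition pregrid_suppressed :: "(nat \<times> nat) set" where
  "pregrid_suppressed = {v \<in> verts pregrid.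
      in_degree pregrid v = 1 \<and> out_degree pregrid v = 1 \<and>
      (\<forall>u. ((u, v) \<in> arcs pregrid \<or> (v, u) \<in> arcs pregrid) \<longrightarrow> fst u = fst v)}"

definition quarter_grid :: "(nat \<times> nat, (nat \<times> nat) \<times> (nat \<times> nat)) pre_digraph" where
  "quarter_grid = suppress pregrid pregrid_suppressed"

definition reverse_digraph :: "('a,'b) pre_digraph \<Rightarrow> ('a,'b) pre_digraph" where
  "reverse_digraph G = \<lparr>verts = verts G, arcs = arcs G, tail = head G, head = tail G\<rparr>"

definition reversed_quarter_grid :: "(nat \<times> nat, (nat \<times> nat) \<times> (nat \<times> nat)) pre_digraph" where
  "reversed_quarter_grid = reverse_digraph quarter_grid"

definition weak_immersion ::
  "('c,'d) pre_digraph \<Rightarrow> ('a,'b) pre_digraph \<Rightarrow> ('c \<Rightarrow> 'a) \<Rightarrow> ('d \<Rightarrow> 'b list) \<Rightarrow> bool" where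
  "weak_immersion H D \<phi>V \<phi>E \<longleftrightarrow>
     inj_on \<phi>V (verts H) \<and> \<phi>V ` verts H \<subseteq> verts D \<and>
     (\<forall>e \<in> arcs H. pre_digraph.apath D (\<phi>V (tail H e)) (\<phi>E e) (\<phi>V (head H e))) \<and>
     (\<forall>e \<in> arcs H. \<forall>f \<in> arcs H. e \<noteq> f \<longrightarrow> set (\<phi>E e) \<inter> set (\<phi>E f) = {})"

definition image_arcs :: "('d \<Rightarrow> 'b list) \<Rightarrow> ('c,'d) iray \<Rightarrow> 'b set" where
  "image_arcs \<phi>E R = (\<Union>n. set (\<phi>E (snd R n)))"

definition rays_in_end ::
  "('c,'d) pre_digraph \<Rightarrow> ('a,'b) pre_digraph \<Rightarrow> ('d \<Rightarrow> 'b list) \<Rightarrow> ('a,'b) iray set \<Rightarrow> bool" where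
  "rays_in_end H D \<phi>E \<omega> \<longleftrightarrow> (\<forall>R. is_ray H R \<longrightarrow>
     (\<exists>Q. is_ray D Q \<and> Q \<in> \<omega> \<and> ray_arcs Q \<subseteq> image_arcs \<phi>E R))"

definition antirays_in_end ::
  "('c,'d) pre_digraph \<Rightarrow> ('a,'b) pre_digraph \<Rightarrow> ('d \<Rightarrow> 'b list) \<Rightarrow> ('a,'b) iray set \<Rightarrow> bool" where
  "antirays_in_end H D \<phi>E \<omega> \<longleftrightarrow> (\<forall>R. is_antiray H R \<longrightarrow>
     (\<exists>Q. is_antiray D Q \<and> Q \<in> \<omega> \<and> ray_arcs Q \<subseteq> image_arcs \<phi>E R))"

end

theory Submission
  imports Defs "HOL-Library.Ramsey" "HOL-Library.Infinite_Set" "HOL-Library.Nat_Bijection"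
    "HOL-Combinatorics.Permutations"
begin

text \<open>
  Let \<open>T\<^sub>0, T\<^sub>1, \<dots>\<close> be tails of the given rays (the lines). For every \<open>k\<close>, the digraph on
  \<open>{0, \<dots>, k}\<close> with an arc from \<open>u\<close> to \<open>v\<close> whenever infinitely many disjoint \<open>T\<^sub>u\<close>--\<open>T\<^sub>v\<close> paths
  avoid the edges of \<open>T\<^sub>0, \<dots>, T\<^sub>k\<close> is strongly connected. A row of the grid is a token that travels along
  its line and may change to an unoccupied line along an arc. Going around a directed cycle permutes the
  tokens by a permutation of finite order, so each change can be undone and the orientation of the
  arcs no longer matters: two rows can exchange messages as soon as some undirected path of otherwise unused
  lines joins them, and all tokens return to their own lines afterwards. Ramsey's theorem, applied to metric
  betweenness in these digraphs, yields infinitely many lines such that consecutive ones are always joined by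
  such a path. The lines are chosen so that every vertex lies on only finitely many of them, so the image of
  every ray of the grid visits each vertex finitely often, contains a ray, and that ray lies in the end.
  The second part is the first one for the reversed digraph.
\<close>

section \<open>Disjoint walks and equivalence of rays\<close>

text \<open>Edge-disjoint rays may share vertices, so along the lines only edges can be kept apart:
  vertical paths avoid edges of lines but may run through their vertices. Branch vertices must
  nevertheless be distinct; they are therefore placed at ends of vertical paths, which are pairwise
  vertex-disjoint. Moreover, a vertical path can be kept off the edges of finitely many lines only.
  When k grows, more edges are forbidden, so the digraph for k + 1 need not extend the digraph for
  k. This is why Ramsey's theorem is applied to quadruples, whose last entry selects the digraph.
  The combinatorics is separated from the given digraph: every message is a finite program of arcs
  found before any path is known, the programs are concatenated to an infinite schedule, and only
  then is one vertical path per time step chosen, disjoint from all earlier ones. A travelling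
  message occupies a line of its own, so an arc that joins two rows directly is not enough for
  it.\<close>

lemma finite_disjoint_hits:
  fixes V :: "'i \<Rightarrow> 'x set"
  assumes "\<And>i j. i \<noteq> j \<Longrightarrow> V i \<inter> V j = {}" "finite F"
  shows "finite {i. V i \<inter> F \<noteq> {}}"
proof -
  have "finite {i. z \<in> V i}" for z
  proof (cases "\<exists>i. z \<in> V i")
    case True
    then obtain i where i: "z \<in> V i" by blast
    have "{j. z \<in> V j} \<subseteq> {i}"
    proof
      fix j assume "j \<in> {j. z \<in> V j}"
      then show "j \<in> {i}" using assms(1)[of i j] i by blast
    qed
    then show ?thesis by (rule finite_subset) simp
  qed simp
  then have "finite (\<Union>z\<in>F. {i. z \<in> V i})" using assms(2) by simp
  moreover have "{i. V i \<inter> F \<noteq> {}} \<subseteq> (\<Union>z\<in>F. {i. z \<in> V i})" by auto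
  ultimately show ?thesis by (rule finite_subset[rotated])
qed

lemma greedy_disjoint:
  fixes V :: "'p \<Rightarrow> 'x set"
  assumes "\<And>F. finite F \<Longrightarrow> \<exists>P. \<Phi> P \<and> V P \<inter> F = {}" "\<And>P. \<Phi> P \<Longrightarrow> finite (V P)"
  shows "\<exists>P :: nat \<Rightarrow> 'p. (\<forall>i. \<Phi> (P i)) \<and> (\<forall>i j. i \<noteq> j \<longrightarrow> V (P i) \<inter> V (P j) = {})"
proof -
  \<comment> \<open>The first component of the state is a finite set that contains the vertices of
    everything chosen so far; the next choice avoids it.\<close>
  have "\<exists>f. \<forall>n. (finite (fst (f n)) \<and> \<Phi> (snd (f n)) \<and> V (snd (f n)) \<subseteq> fst (f n)) \<and>
     (fst (f n) \<subseteq> fst (f (Suc n)) \<and> V (snd (f (Suc n))) \<inter> fst (f n) = {})"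
  proof (rule dependent_nat_choice)
    obtain P where P: "\<Phi> P" using assms(1)[of "{}"] by auto
    show "\<exists>x. finite (fst x) \<and> \<Phi> (snd x) \<and> V (snd x) \<subseteq> fst x"
      by (rule exI[of _ "(V P, P)"]) (simp add: P assms(2))
  next
    fix x :: "'x set \<times> 'p" and n :: nat
    assume x: "finite (fst x) \<and> \<Phi> (snd x) \<and> V (snd x) \<subseteq> fst x"
    obtain P where P: "\<Phi> P" "V P \<inter> fst x = {}" using assms(1)[of "fst x"] x by auto
    show "\<exists>y. (finite (fst y) \<and> \<Phi> (snd y) \<and> V (snd y) \<subseteq> fst y) \<and> fst x \<subseteq> fst y \<and> V (snd y) \<inter> fst x = {}"
      by (rule exI[of _ "(fst x \<union> V P, P)"]) (simp add: P assms(2) x)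
  qed
  then obtain f where ff: "\<forall>n. (finite (fst (f n)) \<and> \<Phi> (snd (f n)) \<and> V (snd (f n)) \<subseteq> fst (f n)) \<and>
     (fst (f n) \<subseteq> fst (f (Suc n)) \<and> V (snd (f (Suc n))) \<inter> fst (f n) = {})" by (elim exE)
  have f: "\<And>n. \<Phi> (snd (f n))" "\<And>n. V (snd (f n)) \<subseteq> fst (f n)"
    "\<And>n. fst (f n) \<subseteq> fst (f (Suc n))" "\<And>n. V (snd (f (Suc n))) \<inter> fst (f n) = {}"
    using ff by simp_all
  have mono: "fst (f m) \<subseteq> fst (f n)" if "m \<le> n" for m n
    using that f(3) by (rule lift_Suc_mono_le[rotated])
  have lt: "V (snd (f i)) \<inter> V (snd (f j)) = {}" if "i < j" for i j
  proof -
    obtain n where n: "j = Suc n" using \<open>i < j\<close> by (cases j) auto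
    then have "V (snd (f i)) \<subseteq> fst (f n)" using f(2)[of i] mono[of i n] that by auto
    then show ?thesis using f(4)[of n] n by blast
  qed
  have "V (snd (f i)) \<inter> V (snd (f j)) = {}" if "i \<noteq> j" for i j
    using lt[of i j] lt[of j i] that by (auto simp: neq_iff)
  then show ?thesis using f(1) by (intro exI[of _ "\<lambda>n. snd (f n)"]) simp
qed

lemma inj_avoids:
  fixes f :: "nat \<Rightarrow> 'x"
  assumes "inj f" "finite F"
  obtains N where "\<And>n. n \<ge> N \<Longrightarrow> f n \<notin> F"
proof -
  have "finite (f -` F)" using assms by (simp add: finite_vimageI)
  then obtain N where "\<forall>n\<in>f -` F. n < N" using finite_nat_set_iff_bounded by blast
  then show thesis using that[of N] by (meson leD vimageI)
qed

text \<open>Walks instead of paths, so that links can be concatenated freely. \<open>F\<close>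
  forbids vertices, \<open>Z\<close> forbids arcs.\<close>

definition (in pre_digraph) linked :: "'a set \<Rightarrow> 'b set \<Rightarrow> 'a set \<Rightarrow> 'a set \<Rightarrow> bool" where
  "linked F Z A B \<longleftrightarrow> (\<exists>u p v. awalk u p v \<and> u \<in> A \<and> v \<in> B \<and>
     set (awalk_verts u p) \<inter> F = {} \<and> set p \<inter> Z = {})"

text \<open>This is the relation \<open>ray_le\<close> in separator form: no finite vertex set cuts
  off \<open>B\<close> from \<open>A\<close>.\<close>

definition (in pre_digraph) near :: "'a set \<Rightarrow> 'a set \<Rightarrow> bool" where
  "near A B \<longleftrightarrow> (\<forall>F. finite F \<longrightarrow> linked F {} A B)"

section \<open>Finite separators in place of infinite families of disjoint paths\<close>

context wf_digraph begin

lemma last_in_awalk_verts: "awalk u p v \<Longrightarrow> v \<in> set (awalk_verts u p)"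
  using last_in_set[OF awalk_verts_non_Nil, of u p] by simp

lemma nearE:
  assumes "near A B" "finite F"
  obtains u p v where "awalk u p v" "u \<in> A" "v \<in> B" "set (awalk_verts u p) \<inter> F = {}"
  using assms(1)[unfolded near_def, rule_format, OF assms(2)] that unfolding linked_def by blast

text \<open>Take a shortest admissible walk. A repeated vertex, a later vertex in \<open>A\<close>
  or an earlier vertex in \<open>B\<close> would allow a shorter one, and a part of the walk still
  avoids \<open>F\<close>.\<close>

lemma linked_AB_dipath:
  assumes "linked F {} A B"
  shows "\<exists>P. is_AB_dipath G A B P \<and> dipath_verts G P \<inter> F = {}"
proof -
  define ok where "ok n \<longleftrightarrow> (\<exists>u p v. awalk u p v \<and> u \<in> A \<and> v \<in> B \<and> set (awalk_verts u p) \<inter> F = {} \<and> length p = n)" for n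
  have "\<exists>n. ok n" using assms unfolding linked_def ok_def by blast
  then have "ok (LEAST n. ok n)" by (rule LeastI_ex)
  then obtain u p v where p: "awalk u p v" "u \<in> A" "v \<in> B" "set (awalk_verts u p) \<inter> F = {}"
    "length p = (LEAST n. ok n)" unfolding ok_def by blast
  have least: "length p \<le> length p'" if "awalk u' p' v'" "u' \<in> A" "v' \<in> B" "set (awalk_verts u' p') \<inter> F = {}" for u' p' v'
    unfolding p(5) by (rule Least_le) (use that in \<open>auto simp: ok_def\<close>)
  have "distinct (awalk_verts u p)"
  proof (rule ccontr)
    assume "\<not> ?thesis"
    from awalk_not_distinct_decomp[OF p(1) this] obtain q r s w where d: "p = q @ r @ s" "0 < length r"
      "awalk u q w" "awalk w r w" "awalk w s v" by blast
    have "awalk u (q @ s) v" using awalk_appendI[OF d(3,5)] .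
    moreover have "set (awalk_verts u (q @ s)) \<inter> F = {}"
      using p(4) unfolding d(1) set_awalk_verts_append[OF d(3,5)]
        set_awalk_verts_append[OF d(3) awalk_appendI[OF d(4,5)]] set_awalk_verts_append[OF d(4,5)] by blast
    ultimately have "length p \<le> length (q @ s)" using least p(2,3) by blast
    then show False using d(1,2) by simp
  qed
  then have ap: "apath u p v" unfolding apath_def using p(1) by simp
  have dec: "w = u \<and> (w \<in> B \<longrightarrow> w = v) \<or> w \<notin> A \<and> (w \<in> B \<longrightarrow> w = v)" if w: "w \<in> set (awalk_verts u p)" for w
  proof -
    obtain q r where d: "p = q @ r" "awalk u q w" "awalk w r v" using awalk_decomp[OF p(1) w] by blast
    have vv: "set (awalk_verts u q) \<inter> F = {}" "set (awalk_verts w r) \<inter> F = {}"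
      using p(4) unfolding d(1) set_awalk_verts_append[OF d(2,3)] by blast+
    have "w = u" if "w \<in> A"
    proof -
      have "length p \<le> length r" using least[OF d(3) that p(3) vv(2)] .
      then have "q = []" using d(1) by simp
      then show ?thesis using d(2) by (simp add: awalk_Nil_iff)
    qed
    moreover have "w = v" if "w \<in> B"
    proof -
      have "length p \<le> length q" using least[OF d(2) p(2) that vv(1)] .
      then have "r = []" using d(1) by simp
      then show ?thesis using d(3) by (simp add: awalk_Nil_iff)
    qed
    ultimately show ?thesis by blast
  qed
  have uv: "u \<in> set (awalk_verts u p)" "v \<in> set (awalk_verts u p)"
    using hd_in_awalk_verts(1)[OF p(1)] last_in_awalk_verts[OF p(1)] .
  have "is_AB_dipath G A B (u, p, v)"
    unfolding is_AB_dipath_def dipath_verts_def fst_conv snd_conv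
    using ap dec uv p(2,3) by blast
  then show ?thesis using p(4) unfolding dipath_verts_def by (intro exI[of _ "(u, p, v)"]) simp
qed

text \<open>A finite set meets only finitely many of infinitely many disjoint paths; conversely
  disjoint paths are picked greedily, each avoiding the finitely many vertices of its
  predecessors.\<close>

lemma ray_le_near: "ray_le G Q R \<longleftrightarrow> near (ray_verts Q) (ray_verts R)"
proof
  assume "ray_le G Q R"
  then obtain P :: "nat \<Rightarrow> _" where P: "\<forall>i. is_AB_dipath G (ray_verts Q) (ray_verts R) (P i)"
    "\<forall>i j. i \<noteq> j \<longrightarrow> dipath_verts G (P i) \<inter> dipath_verts G (P j) = {}"
    unfolding ray_le_def by (elim exE conjE)
  show "near (ray_verts Q) (ray_verts R)" unfolding near_def
  proof (intro allI impI)
    fix F :: "'a set" assume F: "finite F"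
    have "finite {i. dipath_verts G (P i) \<inter> F \<noteq> {}}" using finite_disjoint_hits[OF P(2)[rule_format] F] .
    from ex_new_if_finite[OF infinite_UNIV_nat this] obtain i where i: "dipath_verts G (P i) \<inter> F = {}" by blast
    have "is_AB_dipath G (ray_verts Q) (ray_verts R) (P i)" using P(1) ..
    then show "linked F {} (ray_verts Q) (ray_verts R)"
      unfolding linked_def is_AB_dipath_def
      using i awalkI_apath unfolding dipath_verts_def by blast
  qed
next
  assume n: "near (ray_verts Q) (ray_verts R)"
  show "ray_le G Q R" unfolding ray_le_def
  proof (rule greedy_disjoint)
    fix F :: "'a set" assume F: "finite F"
    show "\<exists>P. is_AB_dipath G (ray_verts Q) (ray_verts R) P \<and> dipath_verts G P \<inter> F = {}"
      using linked_AB_dipath n[unfolded near_def, rule_format, OF F] .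
  qed (simp add: dipath_verts_def)
qed

lemma ray_segment:
  assumes "\<And>n. g n \<in> arcs G \<and> tail G (g n) = f n \<and> head G (g n) = f (Suc n)" "m \<le> n"
  shows "awalk (f m) (map g [m..<n]) (f n)" "set (awalk_verts (f m) (map g [m..<n])) = f ` {m..n}"
proof -
  have "awalk (f m) (map g [m..<n]) (f n) \<and> set (awalk_verts (f m) (map g [m..<n])) = f ` {m..n}"
    using assms(2)
  proof (induction n rule: dec_induct)
    case base
    have "f m \<in> verts G" using assms(1)[of m] wellformed(1)[of "g m"] by metis
    then show ?case by (simp add: awalk_Nil_iff)
  next
    case (step n)
    have e: "awalk (f n) [g n] (f (Suc n))" using arc_implies_awalk[of "g n"] assms(1)[of n] by simp
    have "awalk (f m) (map g [m..<n] @ [g n]) (f (Suc n))" using awalk_appendI[OF conjunct1[OF step.IH] e] .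
    moreover have "set (awalk_verts (f m) (map g [m..<n] @ [g n])) = f ` {m..n} \<union> {f n, f (Suc n)}"
      using set_awalk_verts_append[OF conjunct1[OF step.IH] e] step.IH assms(1)[of n] by simp
    moreover have "{m..Suc n} = {m..n} \<union> {n, Suc n}" using step.hyps by auto
    ultimately show ?case using step.hyps by auto
  qed
  then show "awalk (f m) (map g [m..<n]) (f n)" "set (awalk_verts (f m) (map g [m..<n])) = f ` {m..n}" by auto
qed

lemma antiray_segment:
  assumes "\<And>n. g n \<in> arcs G \<and> head G (g n) = f n \<and> tail G (g n) = f (Suc n)" "m \<le> n"
  shows "\<exists>p. awalk (f n) p (f m) \<and> set (awalk_verts (f n) p) = f ` {m..n}"
  using assms(2)
proof (induction n rule: dec_induct)
  case base
  have "f m \<in> verts G" using assms(1)[of m] wellformed(2)[of "g m"] by metis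
  then show ?case by (intro exI[of _ "[]"]) (simp add: awalk_Nil_iff)
next
  case (step n)
  then obtain p where p: "awalk (f n) p (f m)" "set (awalk_verts (f n) p) = f ` {m..n}" by blast
  have "awalk (f (Suc n)) (g n # p) (f m)" using p(1) assms(1)[of n] by (simp add: awalk_Cons_iff)
  moreover have "set (awalk_verts (f (Suc n)) (g n # p)) = f ` {m..Suc n}"
    using p(2) assms(1)[of n] step.hyps by (auto simp: atLeastAtMostSuc_conv)
  ultimately show ?case by blast
qed

lemma linked_append:
  assumes "linked F {} A {x}" "awalk x p y" "set (awalk_verts x p) \<inter> F = {}" "y \<in> B"
  shows "linked F {} A B"
proof -
  obtain u q where q: "awalk u q x" "u \<in> A" "set (awalk_verts u q) \<inter> F = {}"
    using assms(1) unfolding linked_def by blast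
  have "set (awalk_verts u (q @ p)) \<inter> F = {}"
    using set_awalk_verts_append[OF q(1) assms(2)] q(3) assms(3) by blast
  then show ?thesis unfolding linked_def using awalk_appendI[OF q(1) assms(2)] q(2) assms(4) by blast
qed

text \<open>The two walks are joined by a piece of \<open>R\<close> beyond \<open>F\<close>. It has
  to be traversed forwards, so the walk chosen second must meet \<open>R\<close> further out: on a
  ray the walk from \<open>A\<close> is chosen first, on an anti-ray the walk to
  \<open>B\<close>.\<close>

lemma near_trans:
  assumes "near A (ray_verts R)" "near (ray_verts R) B" "is_ray_or_antiray G R"
  shows "near A B"
  unfolding near_def
proof (intro allI impI)
  fix F :: "'a set" assume F: "finite F"
  define f where "f = fst R"
  have inj: "inj f" using assms(3) unfolding is_ray_or_antiray_def is_ray_def is_antiray_def f_def by blast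
  have rv: "ray_verts R = range f" unfolding ray_verts_def f_def ..
  obtain N where N: "\<And>n. n \<ge> N \<Longrightarrow> f n \<notin> F" using inj_avoids[OF inj F] by blast
  have seg: "(\<exists>p. awalk (f m) p (f n) \<and> set (awalk_verts (f m) p) = f ` {m..n}) \<or>
    (\<exists>p. awalk (f n) p (f m) \<and> set (awalk_verts (f n) p) = f ` {m..n}) \<and> is_antiray G R" if "m \<le> n" for m n
  proof (cases "is_ray G R")
    case True
    then show ?thesis using ray_segment[of "snd R" f m n] that unfolding is_ray_def f_def by blast
  next
    case False
    then have "is_antiray G R" using assms(3) unfolding is_ray_or_antiray_def by blast
    then show ?thesis using antiray_segment[of "snd R" f m n] that unfolding is_antiray_def f_def by blast
  qed
  have late: "\<exists>n>M. f n = v" if "v \<in> range f" "v \<notin> f ` {..M}" for v and M :: nat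
  proof -
    obtain n where n: "v = f n" using \<open>v \<in> range f\<close> by (rule rangeE)
    then have "\<not> n \<le> M" using \<open>v \<notin> f ` {..M}\<close> by auto
    then show ?thesis using n by (intro exI[of _ n]) simp
  qed
  have fin: "finite (F \<union> f ` {..M})" for M using F by simp
  show "linked F {} A B"
  proof (cases "is_ray G R")
    case True
    obtain u p v where p: "awalk u p v" "u \<in> A" "v \<in> range f" "set (awalk_verts u p) \<inter> (F \<union> f ` {..N}) = {}"
      by (rule nearE[OF assms(1)[unfolded rv] fin])
    have "v \<in> set (awalk_verts u p)" using last_in_awalk_verts[OF p(1)] .
    then obtain m where m: "m > N" "f m = v" using late[of v N] p(3,4) by blast
    obtain u' p' v' where p': "awalk u' p' v'" "u' \<in> range f" "v' \<in> B" "set (awalk_verts u' p') \<inter> (F \<union> f ` {..m}) = {}"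
      by (rule nearE[OF assms(2)[unfolded rv] fin])
    have "u' \<in> set (awalk_verts u' p')" using hd_in_awalk_verts(1)[OF p'(1)] .
    then obtain n where n: "n > m" "f n = u'" using late[of u' m] p'(2,4) by blast
    have s: "awalk (f m) (map (snd R) [m..<n]) (f n)" "set (awalk_verts (f m) (map (snd R) [m..<n])) = f ` {m..n}"
      using ray_segment[of "snd R" f m n] n(1) True unfolding is_ray_def f_def by simp_all
    have a: "awalk (f m) (map (snd R) [m..<n] @ p') v'" using awalk_appendI[OF s(1)] p'(1) n(2) by simp
    have "set (awalk_verts (f m) (map (snd R) [m..<n] @ p')) = f ` {m..n} \<union> set (awalk_verts u' p')"
      using set_awalk_verts_append[OF s(1)] p'(1) n(2) s(2) by simp
    moreover have "f ` {m..n} \<inter> F = {}" using N m(1) by auto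
    ultimately have b: "set (awalk_verts (f m) (map (snd R) [m..<n] @ p')) \<inter> F = {}" using p'(4) by blast
    have "linked F {} A {f m}"
      unfolding linked_def by (intro exI[of _ u] exI[of _ p] exI[of _ v]) (use p m(2) in auto)
    then show ?thesis using linked_append[OF _ a b p'(3)] by blast
  next
    case False
    then have ar: "is_antiray G R" using assms(3) unfolding is_ray_or_antiray_def by blast
    obtain u' p' v' where p': "awalk u' p' v'" "u' \<in> range f" "v' \<in> B" "set (awalk_verts u' p') \<inter> (F \<union> f ` {..N}) = {}"
      by (rule nearE[OF assms(2)[unfolded rv] fin])
    have "u' \<in> set (awalk_verts u' p')" using hd_in_awalk_verts(1)[OF p'(1)] .
    then obtain m where m: "m > N" "f m = u'" using late[of u' N] p'(2,4) by blast
    obtain u p v where p: "awalk u p v" "u \<in> A" "v \<in> range f" "set (awalk_verts u p) \<inter> (F \<union> f ` {..m}) = {}"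
      by (rule nearE[OF assms(1)[unfolded rv] fin])
    have "v \<in> set (awalk_verts u p)" using last_in_awalk_verts[OF p(1)] .
    then obtain n where n: "n > m" "f n = v" using late[of v m] p(3,4) by blast
    obtain s where s: "awalk (f n) s (f m)" "set (awalk_verts (f n) s) = f ` {m..n}"
      using antiray_segment[of "snd R" f m n] n(1) ar unfolding is_antiray_def f_def by auto
    have a: "awalk (f n) (s @ p') v'" using awalk_appendI[OF s(1)] p'(1) m(2) by simp
    have "set (awalk_verts (f n) (s @ p')) = f ` {m..n} \<union> set (awalk_verts u' p')"
      using set_awalk_verts_append[OF s(1)] p'(1) m(2) s(2) by simp
    moreover have "f ` {m..n} \<inter> F = {}" using N m(1) by auto
    ultimately have b: "set (awalk_verts (f n) (s @ p')) \<inter> F = {}" using p'(4) by blast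
    have "linked F {} A {f n}"
      unfolding linked_def by (intro exI[of _ u] exI[of _ p] exI[of _ v]) (use p n(2) in auto)
    then show ?thesis using linked_append[OF _ a b p'(3)] by blast
  qed
qed

end

section \<open>Moving tokens along a strongly connected digraph\<close>

text \<open>A schedule \<open>s\<close> activates at each time \<open>n\<close> one arc between two lines. \<open>Hor i n\<close> stands for the
  segment of line \<open>i\<close> from time \<open>n\<close> to time \<open>n + 1\<close>, and \<open>Ver n\<close> for the path from line \<open>fst (s n)\<close> to
  line \<open>snd (s n)\<close> that is available at time \<open>n\<close>.\<close>

datatype tarc = Hor nat nat | Ver nat

primrec arc_time :: "tarc \<Rightarrow> nat" where
  "arc_time (Hor i n) = n"
| "arc_time (Ver n) = n"

fun twalk :: "(nat \<Rightarrow> nat \<times> nat) \<Rightarrow> nat \<times> nat \<Rightarrow> tarc list \<Rightarrow> nat \<times> nat \<Rightarrow> bool" where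
  "twalk s x [] y \<longleftrightarrow> x = y"
| "twalk s x (Hor i n # p) y \<longleftrightarrow> x = (i, n) \<and> twalk s (i, Suc n) p y"
| "twalk s x (Ver n # p) y \<longleftrightarrow> x = (fst (s n), n) \<and> twalk s (snd (s n), n) p y"

lemma twalk_append: "twalk s x p y \<Longrightarrow> twalk s y q z \<Longrightarrow> twalk s x (p @ q) z"
  by (induction s x p y rule: twalk.induct) auto

text \<open>The time stamps make walks of consecutive periods disjoint without further argument, so
  windows can be concatenated. The bound \<open>L\<close> on the lines is what later lets vertical
  paths avoid the horizontal segments in use.\<close>

definition window :: "nat set \<Rightarrow> nat \<Rightarrow> nat \<Rightarrow> ('k \<Rightarrow> tarc list) \<Rightarrow> bool" where
  "window L n n' w \<longleftrightarrow>
     (\<forall>k. \<forall>e\<in>set (w k). n \<le> arc_time e \<and> arc_time e < n' \<and> (\<forall>i t. e = Hor i t \<longrightarrow> i \<in> L)) \<and>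
     (\<forall>k k'. k \<noteq> k' \<longrightarrow> set (w k) \<inter> set (w k') = {})"

lemma windowI:
  assumes "\<And>k e. e \<in> set (w k) \<Longrightarrow> n \<le> arc_time e \<and> arc_time e < n'"
    and "\<And>k i t. Hor i t \<in> set (w k) \<Longrightarrow> i \<in> L"
    and "\<And>k k' e. e \<in> set (w k) \<Longrightarrow> e \<in> set (w k') \<Longrightarrow> k = k'"
  shows "window L n n' w"
  unfolding window_def
proof (intro conjI allI impI ballI)
  fix k e assume e: "e \<in> set (w k)"
  show "n \<le> arc_time e" "arc_time e < n'" using assms(1)[OF e] by simp_all
  show "i \<in> L" if "e = Hor i t" for i t using assms(2) e that by simp
next
  fix k k' :: 'a assume "k \<noteq> k'"
  then show "set (w k) \<inter> set (w k') = {}" using assms(3)[of _ k k'] by blast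
qed

lemma
  assumes "window L n n' w" "e \<in> set (w k)"
  shows window_le: "n \<le> arc_time e" and window_less: "arc_time e < n'"
    and window_line: "e = Hor i t \<Longrightarrow> i \<in> L" and window_unique: "e \<in> set (w k') \<Longrightarrow> k = k'"
proof -
  have 1: "\<forall>k. \<forall>e\<in>set (w k). n \<le> arc_time e \<and> arc_time e < n' \<and> (\<forall>i t. e = Hor i t \<longrightarrow> i \<in> L)"
    and 2: "\<forall>k k'. k \<noteq> k' \<longrightarrow> set (w k) \<inter> set (w k') = {}"
    using assms(1) unfolding window_def by simp_all
  note 1 = 1[rule_format, OF assms(2)]
  show "n \<le> arc_time e" "arc_time e < n'" "e = Hor i t \<Longrightarrow> i \<in> L" using 1 by simp_all
  assume "e \<in> set (w k')"
  then show "k = k'" using 2[rule_format, of k k'] assms(2) by blast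
qed

lemma window_append:
  assumes "window L n m w" "window L m n' w'" "n \<le> m" "m \<le> n'"
  shows "window L n n' (\<lambda>k. w k @ w' k)"
proof (rule windowI)
  fix k e assume "e \<in> set (w k @ w' k)"
  then consider "e \<in> set (w k)" | "e \<in> set (w' k)" by auto
  then show "n \<le> arc_time e \<and> arc_time e < n'"
  proof cases
    case 1
    show ?thesis using window_le[OF assms(1) 1] window_less[OF assms(1) 1] assms(4) by linarith
  next
    case 2
    show ?thesis using window_le[OF assms(2) 2] window_less[OF assms(2) 2] assms(3) by linarith
  qed
next
  fix k i t assume "Hor i t \<in> set (w k @ w' k)"
  then consider "Hor i t \<in> set (w k)" | "Hor i t \<in> set (w' k)" by auto
  then show "i \<in> L" using window_line[OF assms(1) _ refl] window_line[OF assms(2) _ refl] by cases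
next
  fix k k' e assume "e \<in> set (w k @ w' k)" "e \<in> set (w k' @ w' k')"
  moreover have False if "e \<in> set (w i)" "e \<in> set (w' j)" for i j
    using window_less[OF assms(1) that(1)] window_le[OF assms(2) that(2)] by linarith
  ultimately have "e \<in> set (w k) \<and> e \<in> set (w k') \<or> e \<in> set (w' k) \<and> e \<in> set (w' k')"
    by auto
  then show "k = k'"
    using window_unique[OF assms(1), of e k k'] window_unique[OF assms(2), of e k k'] by blast
qed

text \<open>Walks indexed by tokens become walks indexed by keys; a key without a token gets the
  empty walk.\<close>

lemma window_reindex:
  assumes "window L n n' w" "\<And>k k' r. h k = Some r \<Longrightarrow> h k' = Some r \<Longrightarrow> k = k'"
  shows "window L n n' (\<lambda>k. case h k of None \<Rightarrow> [] | Some r \<Rightarrow> w r)"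
proof -
  have *: "\<exists>r. h k = Some r \<and> e \<in> set (w r)"
    if "e \<in> set (case h k of None \<Rightarrow> [] | Some r \<Rightarrow> w r)" for e k
    using that by (cases "h k") auto
  show ?thesis
  proof (rule windowI)
    fix k e assume "e \<in> set (case h k of None \<Rightarrow> [] | Some r \<Rightarrow> w r)"
    from *[OF this] obtain r where "e \<in> set (w r)" by blast
    from window_le[OF assms(1) this] window_less[OF assms(1) this]
    show "n \<le> arc_time e \<and> arc_time e < n'" by simp
  next
    fix k i t assume "Hor i t \<in> set (case h k of None \<Rightarrow> [] | Some r \<Rightarrow> w r)"
    from *[OF this] obtain r where "Hor i t \<in> set (w r)" by blast
    from window_line[OF assms(1) this refl] show "i \<in> L" .
  next
    fix k k' e assume "e \<in> set (case h k of None \<Rightarrow> [] | Some r \<Rightarrow> w r)"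
      "e \<in> set (case h k' of None \<Rightarrow> [] | Some r \<Rightarrow> w r)"
    from *[OF this(1)] *[OF this(2)] obtain r r'
      where r: "h k = Some r" "e \<in> set (w r)" "h k' = Some r'" "e \<in> set (w r')" by blast
    have "r = r'" using window_unique[OF assms(1) r(2,4)] .
    then show "k = k'" using assms(2) r(1,3) by simp
  qed
qed

definition occurs :: "(nat \<times> nat) list \<Rightarrow> (nat \<Rightarrow> nat \<times> nat) \<Rightarrow> nat \<Rightarrow> bool" where
  "occurs l s n \<longleftrightarrow> (\<forall>i<length l. s (n + i) = l ! i)"

lemma occurs_append [simp]:
  "occurs (l1 @ l2) s n \<longleftrightarrow> occurs l1 s n \<and> occurs l2 s (n + length l1)"
proof -
  have "occurs l2 s (n + length l1)" if a: "\<forall>i<length (l1@l2). s (n + i) = (l1 @ l2) ! i"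
    unfolding occurs_def
  proof (intro allI impI)
    fix i assume "i < length l2"
    then show "s (n + length l1 + i) = l2 ! i" using a[rule_format, of "length l1 + i"] by (simp add: add.assoc)
  qed
  moreover have "occurs l1 s n" if a: "\<forall>i<length (l1@l2). s (n + i) = (l1 @ l2) ! i"
    unfolding occurs_def
  proof (intro allI impI)
    fix i assume "i < length l1"
    then show "s (n + i) = l1 ! i" using a[rule_format, of "i"] by (simp add: nth_append)
  qed
  moreover have "s (n + i) = (l1 @ l2) ! i" if "occurs l1 s n" "occurs l2 s (n + length l1)"
    "i < length (l1 @ l2)" for i
  proof (cases "i < length l1")
    case True then show ?thesis using that unfolding occurs_def by (simp add: nth_append)
  next
    case False
    then have "i - length l1 < length l2" using that by simp
    then have "s (n + length l1 + (i - length l1)) = l2 ! (i - length l1)"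
      using that(2) unfolding occurs_def by blast
    then show ?thesis using False by (simp add: nth_append)
  qed
  ultimately show ?thesis unfolding occurs_def by blast
qed

lemma occurs_Cons: "occurs (a # l) s n \<longleftrightarrow> s n = a \<and> occurs l s (Suc n)"
  using occurs_append[of "[a]" l s n] by (simp add: occurs_def)

text \<open>During the passage of one message, \<open>Fore r\<close> and \<open>Aft r\<close> label the parts of row \<open>r\<close> before and after
  its branch vertex, and \<open>Msg\<close> labels the path of the message.\<close>

datatype key = Fore nat | Aft nat | Msg

locale pebbles =
  fixes E :: "(nat \<times> nat) set" and L :: "nat set"
  assumes fin: "finite L" and sub: "E \<subseteq> L \<times> L" and irr: "(x, x) \<notin> E"
    and strong: "x \<in> L \<Longrightarrow> y \<in> L \<Longrightarrow> (x, y) \<in> E\<^sup>*"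
begin

text \<open>A configuration \<open>c\<close> places token \<open>r\<close> on line
  \<open>c r\<close>. The program \<open>l\<close> is fixed before the schedule \<open>s\<close> and
  the starting time \<open>n\<close>: the schedule is assembled from such programs
  afterwards.\<close>

definition carries :: "nat set \<Rightarrow> (nat \<Rightarrow> nat) \<Rightarrow> (nat \<Rightarrow> nat) \<Rightarrow> bool" where
  "carries I c c' \<longleftrightarrow> (\<exists>l. set l \<subseteq> E \<and> (\<forall>s n. occurs l s n \<longrightarrow>
     (\<exists>w. window L n (n + length l) w \<and>
       (\<forall>r\<in>I. twalk s (c r, n) (w r) (c' r, n + length l)) \<and> (\<forall>r. r \<notin> I \<longrightarrow> w r = []))))"

lemma carries_refl: "carries I c c"
  unfolding carries_def by (rule exI[of _ "[]"]) (auto simp: window_def intro!: exI[of _ "\<lambda>_. []"])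

lemma carries_trans:
  assumes "carries I c c'" "carries I c' c''"
  shows "carries I c c''"
proof -
  obtain l1 where l1: "set l1 \<subseteq> E" "\<And>s n. occurs l1 s n \<Longrightarrow>
     \<exists>w. window L n (n + length l1) w \<and>
       (\<forall>r\<in>I. twalk s (c r, n) (w r) (c' r, n + length l1)) \<and> (\<forall>r. r \<notin> I \<longrightarrow> w r = [])"
    using assms(1) unfolding carries_def by blast
  obtain l2 where l2: "set l2 \<subseteq> E" "\<And>s n. occurs l2 s n \<Longrightarrow>
     \<exists>w. window L n (n + length l2) w \<and>
       (\<forall>r\<in>I. twalk s (c' r, n) (w r) (c'' r, n + length l2)) \<and> (\<forall>r. r \<notin> I \<longrightarrow> w r = [])"
    using assms(2) unfolding carries_def by blast
  show ?thesis unfolding carries_def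
  proof (intro exI[of _ "l1 @ l2"] conjI allI impI)
    show "set (l1 @ l2) \<subseteq> E" using l1 l2 by simp
    fix s n assume o: "occurs (l1 @ l2) s n"
    obtain w1 where w1: "window L n (n + length l1) w1"
       "\<forall>r\<in>I. twalk s (c r, n) (w1 r) (c' r, n + length l1)" "\<forall>r. r \<notin> I \<longrightarrow> w1 r = []"
      using l1(2)[of s n] o by auto
    obtain w2 where w2: "window L (n + length l1) (n + length l1 + length l2) w2"
       "\<forall>r\<in>I. twalk s (c' r, n + length l1) (w2 r) (c'' r, n + length l1 + length l2)" "\<forall>r. r \<notin> I \<longrightarrow> w2 r = []"
      using l2(2)[of s "n + length l1"] o by auto
    show "\<exists>w. window L n (n + length (l1 @ l2)) w \<and>
       (\<forall>r\<in>I. twalk s (c r, n) (w r) (c'' r, n + length (l1 @ l2))) \<and> (\<forall>r. r \<notin> I \<longrightarrow> w r = [])"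
    proof (intro exI[of _ "\<lambda>r. w1 r @ w2 r"] conjI ballI allI impI)
      show "window L n (n + length (l1 @ l2)) (\<lambda>r. w1 r @ w2 r)"
        using window_append[OF w1(1) w2(1)] by (simp add: add.assoc)
      show "twalk s (c r, n) (w1 r @ w2 r) (c'' r, n + length (l1 @ l2))" if "r \<in> I" for r
        using twalk_append[OF w1(2)[rule_format, OF that] w2(2)[rule_format, OF that]]
        by (simp add: add.assoc)
      show "w1 r @ w2 r = []" if "r \<notin> I" for r using w1(3) w2(3) that by simp
    qed
  qed
qed

lemma carries_cong:
  assumes "carries I c c'" "\<And>r. r \<in> I \<Longrightarrow> c r = d r" "\<And>r. r \<in> I \<Longrightarrow> c' r = d' r"
  shows "carries I d d'"
  using assms unfolding carries_def by simp

text \<open>Line \<open>v\<close> is empty, so a token on \<open>u\<close> can cross and use the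
  segment of \<open>v\<close> in the same time step, while all others advance on their lines.
  Writing the move as a transposition, which agrees with it because no token is on \<open>v\<close>,
  turns sequences of moves into permutations of the lines.\<close>

lemma carries_step:
  assumes "(u, v) \<in> E" "inj_on c I" "c ` I \<subseteq> L" "v \<notin> c ` I"
  shows "carries I c (transpose u v \<circ> c)"
  unfolding carries_def
proof (intro exI[of _ "[(u, v)]"] conjI allI impI)
  show "set [(u, v)] \<subseteq> E" using assms by simp
  fix s n assume o: "occurs [(u, v)] s n"
  then have s: "s n = (u, v)" by (simp add: occurs_Cons)
  define w where "w r = (if r \<in> I then if c r = u then [Ver n, Hor v n] else [Hor (c r) n] else [])" for r
  have uv: "v \<in> L" using assms sub by auto
  have mem: "r \<in> I \<and> (c r = u \<and> (e = Ver n \<or> e = Hor v n) \<or> c r \<noteq> u \<and> e = Hor (c r) n)"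
    if "e \<in> set (w r)" for e r
    using that unfolding w_def by (cases "r \<in> I"; cases "c r = u"; simp)
  have "window L n (n + length [(u, v)]) w"
  proof (rule windowI)
    fix k e assume "e \<in> set (w k)"
    from mem[OF this] show "n \<le> arc_time e \<and> arc_time e < n + length [(u, v)]" by auto
  next
    fix k i t assume "Hor i t \<in> set (w k)"
    note m = mem[OF this]
    then have "c k \<in> L" using assms(3) by blast
    then show "i \<in> L" using m uv by auto
  next
    fix k k' e assume "e \<in> set (w k)" "e \<in> set (w k')"
    note m = mem[OF this(1)] mem[OF this(2)]
    have "c k \<noteq> v" "c k' \<noteq> v" using assms(4) m by blast+
    then have "c k = c k'" using m by auto
    then show "k = k'" using inj_onD[OF assms(2)] m by blast
  qed
  moreover have "twalk s (c r, n) (w r) ((transpose u v \<circ> c) r, n + length [(u, v)])" if "r \<in> I" for r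
  proof (cases "c r = u")
    case True then show ?thesis using that s by (simp add: w_def)
  next
    case False
    moreover have "c r \<noteq> v" using assms(4) that by blast
    ultimately show ?thesis using that by (simp add: w_def transpose_def)
  qed
  ultimately show "\<exists>w. window L n (n + length [(u, v)]) w \<and>
       (\<forall>r\<in>I. twalk s (c r, n) (w r) ((transpose u v \<circ> c) r, n + length [(u, v)])) \<and> (\<forall>r. r \<notin> I \<longrightarrow> w r = [])"
    by (intro exI[of _ w] conjI ballI) (simp_all add: w_def)
qed

text \<open>Moving the empty line along a path that ends in it permutes the lines by a permutation
  that does not depend on the configuration.\<close>

lemma carries_path:
  assumes "(x, h) \<in> E\<^sup>*" "h \<in> L"
  shows "\<exists>\<tau>. \<tau> permutes L \<and> \<tau> h = x \<and>
    (\<forall>I c. inj_on c I \<longrightarrow> c ` I \<subseteq> L \<longrightarrow> h \<notin> c ` I \<longrightarrow> carries I c (\<tau> \<circ> c))"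
  using assms(1)
proof (induction rule: converse_rtrancl_induct)
  case base
  show ?case
  proof (intro exI[of _ id] conjI allI impI)
    show "id permutes L" by (simp add: permutes_def)
    show "id h = h" by simp
    show "carries I c (id \<circ> c)" for I c unfolding id_comp by (rule carries_refl)
  qed
next
  case (step x y)
  from step.IH obtain \<tau> where t: "\<tau> permutes L" "\<tau> h = y"
    and t3: "\<forall>I c. inj_on c I \<longrightarrow> c ` I \<subseteq> L \<longrightarrow> h \<notin> c ` I \<longrightarrow> carries I c (\<tau> \<circ> c)"
    by (elim exE conjE)
  have xy: "x \<in> L" "y \<in> L" using step.hyps sub by auto
  have i: "inj \<tau>" using t(1) permutes_inj by blast
  show ?case
  \<comment> \<open>By induction the empty line has moved from \<open>h\<close> to \<open>y\<close>.
    A token on \<open>x\<close> may now cross to \<open>y\<close>, which leaves \<open>x\<close>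
    empty.\<close>
  proof (intro exI[of _ "transpose x y \<circ> \<tau>"] conjI allI impI)
    show "transpose x y \<circ> \<tau> permutes L" using permutes_compose[OF t(1) permutes_swap_id[OF xy]] .
    show "(transpose x y \<circ> \<tau>) h = x" using t(2) by simp
    fix I :: "nat set" and c :: "nat \<Rightarrow> nat" assume c: "inj_on c I" "c ` I \<subseteq> L" "h \<notin> c ` I"
    have "carries I (\<tau> \<circ> c) (transpose x y \<circ> (\<tau> \<circ> c))"
    proof (rule carries_step[OF step.hyps(1)])
      show "inj_on (\<tau> \<circ> c) I" using comp_inj_on[OF c(1) inj_on_subset[OF i subset_UNIV]] .
      show "(\<tau> \<circ> c) ` I \<subseteq> L"
        using image_mono[OF c(2), of \<tau>] unfolding permutes_image[OF t(1)] image_comp .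
      show "y \<notin> (\<tau> \<circ> c) ` I"
      proof
        assume "y \<in> (\<tau> \<circ> c) ` I"
        then obtain r where "r \<in> I" "\<tau> (c r) = y" by auto
        then have r: "r \<in> I" "\<tau> (c r) = \<tau> h" unfolding t(2) by blast+
        then have "c r = h" using injD[OF i] by blast
        then show False using r c(3) by blast
      qed
    qed
    then show "carries I c (transpose x y \<circ> \<tau> \<circ> c)"
      using carries_trans[OF t3[rule_format, OF c]] by (simp only: comp_assoc)
  qed
qed

text \<open>Running the empty line around a directed cycle through the arc is a permutation of finite
  order, so every move can be undone.\<close>

lemma carries_back:
  assumes uv: "(u, v) \<in> E" and c: "inj_on c I" "c ` I \<subseteq> L" "v \<notin> c ` I"
  shows "carries I (transpose u v \<circ> c) c"
proof -
  have L: "u \<in> L" "v \<in> L" using uv sub by auto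
  from carries_path[OF strong[OF L(2,1)] L(1)]
  obtain \<tau> where t: "\<tau> permutes L" "\<tau> u = v"
    and t3: "\<forall>I c. inj_on c I \<longrightarrow> c ` I \<subseteq> L \<longrightarrow> u \<notin> c ` I \<longrightarrow> carries I c (\<tau> \<circ> c)"
    by (elim exE conjE)
  \<comment> \<open>One full round: the move from \<open>u\<close> to \<open>v\<close> empties
    \<open>u\<close>, and \<open>\<tau>\<close> brings the empty line back to \<open>v\<close>.
    Hence \<open>\<sigma>\<close> fixes \<open>v\<close> and the round can be repeated.\<close>
  define \<sigma> where "\<sigma> = \<tau> \<circ> transpose u v"
  have sp: "\<sigma> permutes L"
    unfolding \<sigma>_def using permutes_compose[OF permutes_swap_id[OF L] t(1)] .
  have sv: "\<sigma> v = v" unfolding \<sigma>_def using t(2) by simp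
  have pn: "(\<sigma> ^^ m) permutes L" for m
  proof (induction m)
    case 0 then show ?case by (simp add: permutes_def)
  next
    case (Suc m) then show ?case using permutes_compose[OF Suc sp] by (simp only: funpow.simps)
  qed
  have vn: "(\<sigma> ^^ m) v = v" for m using sv by (induction m) auto
  have g: "inj_on ((\<sigma> ^^ m) \<circ> c) I \<and> ((\<sigma> ^^ m) \<circ> c) ` I \<subseteq> L \<and> v \<notin> ((\<sigma> ^^ m) \<circ> c) ` I" for m
  proof -
    have i: "inj (\<sigma> ^^ m)" using pn permutes_inj by blast
    have "v \<notin> ((\<sigma> ^^ m) \<circ> c) ` I"
    proof
      assume "v \<in> ((\<sigma> ^^ m) \<circ> c) ` I"
      then obtain r where "r \<in> I" "(\<sigma> ^^ m) (c r) = v" by auto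
      then have r: "r \<in> I" "(\<sigma> ^^ m) (c r) = (\<sigma> ^^ m) v" unfolding vn by blast+
      then have "c r = v" using injD[OF i] by blast
      then show False using r c(3) by blast
    qed
    moreover have "inj_on ((\<sigma> ^^ m) \<circ> c) I"
      using comp_inj_on[OF c(1) inj_on_subset[OF i subset_UNIV]] .
    moreover have "((\<sigma> ^^ m) \<circ> c) ` I \<subseteq> L"
      using image_mono[OF c(2), of "\<sigma> ^^ m"] unfolding permutes_image[OF pn] image_comp .
    ultimately show ?thesis by blast
  qed
  have half: "carries I (transpose u v \<circ> d) (\<sigma> \<circ> d)" if d: "inj_on d I" "d ` I \<subseteq> L" "v \<notin> d ` I" for d
  proof -
    have "carries I (transpose u v \<circ> d) (\<tau> \<circ> (transpose u v \<circ> d))"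
    proof (rule t3[rule_format])
      show "inj_on (transpose u v \<circ> d) I"
        using comp_inj_on[OF d(1) inj_on_subset[OF inj_transpose subset_UNIV]] .
      show "(transpose u v \<circ> d) ` I \<subseteq> L" using d(2) L by (auto simp: transpose_def)
      show "u \<notin> (transpose u v \<circ> d) ` I" using d(3) by (auto simp: transpose_def)
    qed
    then show ?thesis unfolding \<sigma>_def by (simp only: comp_assoc)
  qed
  have full: "carries I d (\<sigma> \<circ> d)" if d: "inj_on d I" "d ` I \<subseteq> L" "v \<notin> d ` I" for d
    using carries_trans[OF carries_step[OF uv d] half[OF d]] .
  have many: "carries I (\<sigma> \<circ> c) ((\<sigma> ^^ Suc m) \<circ> c)" for m
  proof (induction m)
    case 0
    have "\<sigma> ^^ Suc 0 = \<sigma>" by simp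
    then show ?case by (simp only: carries_refl)
  next
    case (Suc m)
    have "carries I ((\<sigma> ^^ Suc m) \<circ> c) (\<sigma> \<circ> ((\<sigma> ^^ Suc m) \<circ> c))" using g[of "Suc m"] by (intro full) blast+
    then show ?case using carries_trans[OF Suc] by (simp only: comp_assoc funpow.simps)
  qed
  have "\<exists>m>0. \<sigma> ^^ m = id"
  proof -
    have *: "((\<lambda>f. \<sigma> \<circ> f) ^^ m) id = \<sigma> ^^ m" for m
      by (induction m) (simp_all only: funpow.simps o_apply id_apply)
    have "inj ((\<lambda>f. \<sigma> \<circ> f) :: (nat \<Rightarrow> nat) \<Rightarrow> _)"
      using fun.inj_map[OF permutes_inj[OF sp]] .
    moreover have "{y. \<exists>m. y = ((\<lambda>f. \<sigma> \<circ> f) ^^ m) id} \<subseteq> {p. p permutes L}"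
      unfolding * using pn by blast
    then have "finite {y. \<exists>m. y = ((\<lambda>f. \<sigma> \<circ> f) ^^ m) id}"
      using finite_permutations[OF fin] finite_subset by blast
    ultimately obtain m where "m > 0" "((\<lambda>f. \<sigma> \<circ> f) ^^ m) id = id" by (rule funpow_inj_finite)
    then show ?thesis unfolding * by blast
  qed
  then obtain m where m: "\<sigma> ^^ Suc m = id" using gr0_implies_Suc by blast
  \<comment> \<open>The configuration after the move is one from the interior of the first round:
    \<open>half\<close> completes that round, and \<open>m\<close> more rounds restore
    \<open>c\<close>.\<close>
  have "carries I (\<sigma> \<circ> c) c" using many[of m] unfolding m id_comp .
  then show ?thesis by (rule carries_trans[OF half[OF c]])
qed

text \<open>If only the reverse arc is present, the desired move is the undoing of a move along that
  arc: \<open>carries_back\<close> is applied to the target configuration.\<close>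

lemma carries_sym_step:
  assumes "(u, v) \<in> E \<union> E\<inverse>" "inj_on c I" "c ` I \<subseteq> L" "v \<notin> c ` I"
  shows "carries I c (transpose u v \<circ> c)"
proof (cases "(u, v) \<in> E")
  case True then show ?thesis using carries_step assms by blast
next
  case False
  then have vu: "(v, u) \<in> E" using assms(1) by simp
  then have L: "u \<in> L" "v \<in> L" using sub by auto
  have "carries I (transpose v u \<circ> (transpose u v \<circ> c)) (transpose u v \<circ> c)"
  proof (rule carries_back[OF vu])
    show "inj_on (transpose u v \<circ> c) I"
      using comp_inj_on[OF assms(2) inj_on_subset[OF inj_transpose subset_UNIV]] .
    show "(transpose u v \<circ> c) ` I \<subseteq> L" using assms(3) L by (auto simp: transpose_def)
    show "u \<notin> (transpose u v \<circ> c) ` I" using assms(4) by (auto simp: transpose_def)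
  qed
  moreover have "transpose v u \<circ> (transpose u v \<circ> c) = c" by (rule ext) (simp add: transpose_def)
  ultimately show ?thesis by (simp only:)
qed

end

section \<open>One message between two rows\<close>

context pebbles begin

text \<open>The message is an additional token, for which any name \<open>m\<close> outside
  \<open>I\<close> will do; the token of a row \<open>r\<close> rests on line
  \<open>r\<close>.\<close>

lemma carries_message:
  assumes "(y, z) \<in> {(x, x'). (x, x') \<in> E \<union> E\<inverse> \<and> x \<notin> I \<and> x' \<notin> I}\<^sup>*"
    and "I \<subseteq> L" "y \<in> L" "y \<notin> I" "m \<notin> I"
  shows "carries (insert m I) (id(m := y)) (id(m := z))"
  using assms(1)
proof (induction rule: rtrancl_induct)
  case base
  show ?case by (rule carries_refl)
next
  case (step x x')
  then have x: "x \<notin> I" "x' \<notin> I" "(x, x') \<in> E \<union> E\<inverse>" by auto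
  then have xL: "x \<in> L" "x \<noteq> x'" using sub irr by auto
  have "carries (insert m I) (id(m := x)) (transpose x x' \<circ> id(m := x))"
  proof (rule carries_sym_step[OF x(3)])
    show "inj_on (id(m := x)) (insert m I)" using x assms(5) by (auto simp: inj_on_def)
    show "id(m := x) ` insert m I \<subseteq> L" using xL assms(2) by auto
    show "x' \<notin> id(m := x) ` insert m I" using x xL by auto
  qed
  then have "carries (insert m I) (id(m := x)) (id(m := x'))"
    by (rule carries_cong) (use x in \<open>auto simp: transpose_def\<close>)
  then show ?case by (rule carries_trans[OF step.IH])
qed

text \<open>A token that is to be passed along the pair between \<open>p\<close> and \<open>y\<close> in a split, or between \<open>z\<close> and
  \<open>q\<close> in a merge, uses the vertical arc exactly if the arc of the pair points the right way; otherwise the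
  token of the row itself takes it and is moved back afterwards.\<close>

lemma split_prepare:
  assumes "(p, y) \<in> E \<union> E\<inverse>" "I \<subseteq> L" "y \<notin> I" "p \<in> I"
  obtains u v c where "(u, v) \<in> E" "{u, v} = {p, y}" "carries I id c" "c p = u"
    "\<And>r. r \<noteq> p \<Longrightarrow> r \<in> I \<Longrightarrow> c r = r"
proof (cases "(p, y) \<in> E")
  case True
  then show ?thesis using that[of p y id] carries_refl by simp
next
  case False
  then have "(y, p) \<in> E" using assms by simp
  moreover have "carries I id (transpose p y \<circ> id)"
    using assms by (intro carries_sym_step) auto
  moreover have "transpose p y r = r" if "r \<noteq> p" "r \<in> I" for r
    using that assms by (auto simp: transpose_def)
  ultimately show ?thesis using that[of y p "transpose p y \<circ> id"] by auto
qed

lemma merge_finish: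
  assumes "(z, q) \<in> E \<union> E\<inverse>" "I \<subseteq> L" "z \<notin> I" "q \<in> I"
  obtains u v where "(u, v) \<in> E" "{u, v} = {z, q}" "carries I (id(q := v)) id"
proof (cases "(z, q) \<in> E")
  case True
  have "carries I (id(q := q)) id" using carries_refl[of I id] by (simp only: id_apply fun_upd_idem)
  then show ?thesis using that[of z q] True by blast
next
  case False
  then have qz: "(q, z) \<in> E" using assms by simp
  \<comment> \<open>The arc points away from \<open>q\<close>: at the merge the token of the row
    crosses to \<open>z\<close>, where the message waits, and afterwards it returns to
    \<open>q\<close>.\<close>
  have "carries I (id(q := z)) (transpose z q \<circ> id(q := z))"
    using assms qz sub irr by (intro carries_sym_step) (auto simp: inj_on_def)
  then have "carries I (id(q := z)) id"
    by (rule carries_cong) (use assms in \<open>auto simp: transpose_def\<close>)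
  then show ?thesis using that[of q z] qz by auto
qed

end

text \<open>\<open>X r\<close> is the point at which row \<open>r\<close> is cut. The last clause
  puts the cuts of \<open>p\<close> and \<open>q\<close> at the start and the end of two different
  vertical arcs; since vertical paths will be vertex-disjoint, this makes branch vertices
  distinct.\<close>

definition passes :: "(nat \<Rightarrow> nat \<times> nat) \<Rightarrow> nat set \<Rightarrow> nat set \<Rightarrow> nat \<Rightarrow> nat \<Rightarrow> nat \<Rightarrow> nat \<Rightarrow>
    (nat \<Rightarrow> nat \<times> nat) \<Rightarrow> (key \<Rightarrow> tarc list) \<Rightarrow> bool" where
  "passes s L I p q n n' X w \<longleftrightarrow> window L n n' w \<and>
     (\<forall>r\<in>I. twalk s (r, n) (w (Fore r)) (X r) \<and> twalk s (X r) (w (Aft r)) (r, n')) \<and>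
     twalk s (X p) (w Msg) (X q) \<and>
     (\<exists>n1 n2. n \<le> n1 \<and> n1 < n2 \<and> n2 < n' \<and> X p = (fst (s n1), n1) \<and> X q = (snd (s n2), n2))"

context pebbles begin

lemma message:
  assumes I: "I \<subseteq> L" and pq: "p \<in> I" "q \<in> I" "p \<noteq> q"
    and py: "(p, y) \<in> E \<union> E\<inverse>" and yz: "y \<notin> I" "z \<notin> I"
    and path: "(y, z) \<in> {(x, x'). (x, x') \<in> E \<union> E\<inverse> \<and> x \<notin> I \<and> x' \<notin> I}\<^sup>*"
    and zq: "(z, q) \<in> E \<union> E\<inverse>"
  shows "\<exists>l. set l \<subseteq> E \<and> (\<forall>s n. occurs l s n \<longrightarrow> (\<exists>X w. passes s L I p q n (n + length l) X w))"
proof -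
  have finI: "finite I" using I fin finite_subset by blast
  obtain m where m: "m \<notin> I" using ex_new_if_finite[OF _ finI] by auto
  have yzL: "y \<in> L" "z \<in> L" using py zq sub by auto
  obtain u v c1 where uv: "(u, v) \<in> E" "{u, v} = {p, y}" and c1: "carries I id c1" "c1 p = u"
    "\<And>r. r \<noteq> p \<Longrightarrow> r \<in> I \<Longrightarrow> c1 r = r"
    using split_prepare[OF py I yz(1) pq(1)] by metis
  obtain u' v' where uv': "(u', v') \<in> E" "{u', v'} = {z, q}" and c5: "carries I (id(q := v')) id"
    using merge_finish[OF zq I yz(2) pq(2)] by metis
  have c3: "carries (insert m I) (id(m := y)) (id(m := z))"
    using carries_message[OF path I yzL(1) yz(1) m] .
  obtain l1 where l1: "set l1 \<subseteq> E" "\<forall>s n. occurs l1 s n \<longrightarrow>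
     (\<exists>w. window L n (n + length l1) w \<and>
       (\<forall>r\<in>I. twalk s (id r, n) (w r) (c1 r, n + length l1)) \<and> (\<forall>r. r \<notin> I \<longrightarrow> w r = []))"
    using c1(1) unfolding carries_def by (elim exE conjE)
  obtain l3 where l3: "set l3 \<subseteq> E" "\<forall>s n. occurs l3 s n \<longrightarrow>
     (\<exists>w. window L n (n + length l3) w \<and>
       (\<forall>r\<in>insert m I. twalk s ((id(m := y)) r, n) (w r) ((id(m := z)) r, n + length l3)) \<and> (\<forall>r. r \<notin> insert m I \<longrightarrow> w r = []))"
    using c3 unfolding carries_def by (elim exE conjE)
  obtain l5 where l5: "set l5 \<subseteq> E" "\<forall>s n. occurs l5 s n \<longrightarrow>
     (\<exists>w. window L n (n + length l5) w \<and>
       (\<forall>r\<in>I. twalk s ((id(q := v')) r, n) (w r) (id r, n + length l5)) \<and> (\<forall>r. r \<notin> I \<longrightarrow> w r = []))"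
    using c5 unfolding carries_def by (elim exE conjE)
  \<comment> \<open>Five phases: preparation, split at time \<open>n1\<close>, travel of the
    message, merge at time \<open>n2\<close>, return of the token of row \<open>q\<close>. The
    pieces \<open>F1\<close> to \<open>F5\<close> below correspond to them.\<close>
  define l where "l = l1 @ [(u, v)] @ l3 @ [(u', v')] @ l5"
  show ?thesis
  proof (intro exI[of _ l] conjI allI impI)
    show "set l \<subseteq> E" using l1 l3 l5 uv uv' unfolding l_def by simp
    fix s n assume o: "occurs l s n"
    define n1 where "n1 = n + length l1"
    define n2 where "n2 = Suc n1 + length l3"
    define n' where "n' = Suc n2 + length l5"
    have n': "n' = n + length l" unfolding n'_def n2_def n1_def l_def by simp
    have o1: "occurs l1 s n" "s n1 = (u, v)" "occurs l3 s (Suc n1)" "s n2 = (u', v')" "occurs l5 s (Suc n2)"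
      using o unfolding l_def n1_def n2_def by (simp_all add: occurs_Cons)
    obtain w1 where f1: "window L n n1 w1" and w1: "\<forall>r\<in>I. twalk s (id r, n) (w1 r) (c1 r, n1)"
      "\<forall>r. r \<notin> I \<longrightarrow> w1 r = []"
      using l1(2)[rule_format, OF o1(1)] unfolding n1_def by (elim exE conjE)
    obtain w3 where f3: "window L (Suc n1) n2 w3"
      and w3: "\<forall>r\<in>insert m I. twalk s ((id(m := y)) r, Suc n1) (w3 r) ((id(m := z)) r, n2)"
      "\<forall>r. r \<notin> insert m I \<longrightarrow> w3 r = []"
      using l3(2)[rule_format, OF o1(3)] unfolding n2_def by (elim exE conjE)
    obtain w5 where f5: "window L (Suc n2) n' w5"
      and w5: "\<forall>r\<in>I. twalk s ((id(q := v')) r, Suc n2) (w5 r) (id r, n')"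
      "\<forall>r. r \<notin> I \<longrightarrow> w5 r = []"
      using l5(2)[rule_format, OF o1(5)] unfolding n'_def by (elim exE conjE)
    \<comment> \<open>Row \<open>p\<close> and the message both start at \<open>u\<close>. As
      \<open>{u, v} = {p, y}\<close>, exactly one of the targets \<open>p\<close> and
      \<open>y\<close> needs the vertical arc.\<close>
    define st where "st t = (if t = u then [Hor u n1] else [Ver n1, Hor t n1])" for t
    define F1 where "F1 k = (case (case k of Fore r \<Rightarrow> Some r | _ \<Rightarrow> None) of None \<Rightarrow> [] | Some r \<Rightarrow> w1 r)" for k
    \<comment> \<open>Row \<open>q\<close> is cut only at time \<open>n2\<close>, so during the
      split and the travel it is still in its \<open>Fore\<close> part; every other row is cut at
      time \<open>n1\<close>.\<close>
    define F2 where "F2 k = (case k of Fore r \<Rightarrow> if r = q then [Hor q n1] else []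
       | Aft r \<Rightarrow> if r \<in> I \<and> r \<noteq> q then if r = p then st p else [Hor r n1] else [] | Msg \<Rightarrow> st y)" for k
    define F3 where "F3 k = (case (case k of Fore r \<Rightarrow> if r = q then Some q else None
       | Aft r \<Rightarrow> if r \<in> I \<and> r \<noteq> q then Some r else None | Msg \<Rightarrow> Some m) of None \<Rightarrow> [] | Some r \<Rightarrow> w3 r)" for k
    \<comment> \<open>Row \<open>q\<close> and the message meet at \<open>v'\<close> at time
      \<open>n2\<close>. Exactly one of \<open>q\<close> and \<open>z\<close> equals
      \<open>v'\<close>, so the vertical arc is used once; the segment after it belongs to the
      second part of row \<open>q\<close>.\<close>
    define F4 where "F4 k = (case k of Fore r \<Rightarrow> if r = q \<and> q \<noteq> v' then [Ver n2] else []
       | Aft r \<Rightarrow> if r \<in> I then if r = q then [Hor v' n2] else [Hor r n2] else [] 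
       | Msg \<Rightarrow> if z = v' then [] else [Ver n2])" for k
    define F5 where "F5 k = (case (case k of Aft r \<Rightarrow> Some r | _ \<Rightarrow> None) of None \<Rightarrow> [] | Some r \<Rightarrow> w5 r)" for k
    define w where "w k = F1 k @ F2 k @ F3 k @ F4 k @ F5 k" for k
    define X where "X r = (if r = q then (v', n2) else (c1 r, n1))" for r
    have uvne: "u \<noteq> v" "u' \<noteq> v'" using uv uv' irr by auto
    have ne: "p \<noteq> y" "z \<noteq> q" "q \<noteq> y" using yz pq by auto
    have F1: "window L n n1 F1" unfolding F1_def
      by (rule window_reindex[OF f1]) (auto split: key.splits)
    have F3: "window L (Suc n1) n2 F3" unfolding F3_def
      by (rule window_reindex[OF f3]) (use m pq in \<open>auto split: key.splits if_splits\<close>)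
    have F5: "window L (Suc n2) n' F5" unfolding F5_def
      by (rule window_reindex[OF f5]) (auto split: key.splits)
    have F2: "window L n1 (Suc n1) F2"
    proof (rule windowI)
      fix k e assume e: "e \<in> set (F2 k)"
      show "n1 \<le> arc_time e \<and> arc_time e < Suc n1"
        using e unfolding F2_def st_def by (auto split: key.splits if_splits)
    next
      fix k i t assume e: "Hor i t \<in> set (F2 k)"
      show "i \<in> L" using e I pq uv(1) sub yzL
        unfolding F2_def st_def by (auto split: key.splits if_splits)
    next
      fix k k' e assume e: "e \<in> set (F2 k)" "e \<in> set (F2 k')"
      have one: "p = u \<or> y = u" using uv(2) by auto
      have mem: "k = Fore q \<and> e = Hor q n1 \<or> k = Msg \<and> (e = Hor y n1 \<or> e = Ver n1 \<and> y \<noteq> u) \<or>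
        (\<exists>r. r \<in> I \<and> r \<noteq> q \<and> k = Aft r \<and> (e = Hor r n1 \<or> e = Ver n1 \<and> r = p \<and> p \<noteq> u))"
        if "e \<in> set (F2 k)" for k
        using that pq ne(1) unfolding F2_def st_def by (cases k; simp split: if_splits) fastforce+
      show "k = k'" using mem[OF e(1)] mem[OF e(2)] yz(1) pq one by (elim disjE conjE exE) simp_all
    qed
    have F4: "window L n2 (Suc n2) F4"
    proof (rule windowI)
      fix k e assume e: "e \<in> set (F4 k)"
      show "n2 \<le> arc_time e \<and> arc_time e < Suc n2"
        using e unfolding F4_def by (auto split: key.splits if_splits)
    next
      fix k i t assume e: "Hor i t \<in> set (F4 k)"
      show "i \<in> L" using e I uv'(1) sub
        unfolding F4_def by (auto split: key.splits if_splits)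
    next
      fix k k' e assume e: "e \<in> set (F4 k)" "e \<in> set (F4 k')"
      have "q \<noteq> v' \<Longrightarrow> z = v'" "v' \<in> I \<Longrightarrow> v' = q" using uv'(2) yz by auto
      then show "k = k'" using e ne unfolding F4_def by (auto split: key.splits if_splits)
    qed
    have "window L n n' w" unfolding w_def
      by (intro window_append[OF F1] window_append[OF F2] window_append[OF F3] window_append[OF F4] F5)
        (simp_all add: n1_def n2_def n'_def)
    moreover have "twalk s (r, n) (w (Fore r)) (X r)" "twalk s (X r) (w (Aft r)) (r, n')" if r: "r \<in> I" for r
    proof -
      have a1: "twalk s (r, n) (w1 r) (c1 r, n1)" using w1(1) r by simp
      have rm: "r \<noteq> m" using r m by blast
      have a3: "twalk s (r, Suc n1) (w3 r) (r, n2)" using w3(1)[rule_format, of r] r rm by simp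
      have a5: "twalk s (if r = q then v' else r, Suc n2) (w5 r) (r, n')" using w5(1) r by (auto split: if_splits)
      have qv: "q \<noteq> v' \<Longrightarrow> q = u'" using uv'(2) by auto
      show "twalk s (r, n) (w (Fore r)) (X r)"
      proof (cases "r = q")
        case True
        then have "c1 r = q" using c1(3) pq by auto
        then have "twalk s (q, n) (w1 q) (q, n1)" using a1 True by simp
        moreover have "twalk s (q, n1) [Hor q n1] (q, Suc n1)" by simp
        moreover have "twalk s (q, n2) (if q \<noteq> v' then [Ver n2] else []) (v', n2)" using qv o1(4) by auto
        ultimately have "twalk s (q, n) (w1 q @ [Hor q n1] @ w3 q @ (if q \<noteq> v' then [Ver n2] else [])) (v', n2)"
          using a3 True by (blast intro: twalk_append)
        then show ?thesis using True by (simp add: w_def F1_def F2_def F3_def F4_def F5_def X_def)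
      next
        case False
        then show ?thesis using a1 by (simp add: w_def F1_def F2_def F3_def F4_def F5_def X_def)
      qed
      show "twalk s (X r) (w (Aft r)) (r, n')"
      proof (cases "r = q")
        case True
        have "twalk s (v', n2) [Hor v' n2] (v', Suc n2)" by simp
        moreover have "twalk s (v', Suc n2) (w5 q) (q, n')" using a5 True by simp
        ultimately have "twalk s (v', n2) ([Hor v' n2] @ w5 q) (q, n')" by (rule twalk_append)
        then show ?thesis using True r by (simp add: w_def F1_def F2_def F3_def F4_def F5_def X_def)
      next
        case False
        have "twalk s (c1 r, n1) (if r = p then st p else [Hor r n1]) (r, Suc n1)"
          using c1(2,3) r uv(2) ne o1(2) unfolding st_def by (auto simp: doubleton_eq_iff)
        moreover have "twalk s (r, n2) [Hor r n2] (r, Suc n2)" by simp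
        moreover have "twalk s (r, Suc n2) (w5 r) (r, n')" using a5 False by simp
        ultimately have "twalk s (c1 r, n1) ((if r = p then st p else [Hor r n1]) @ w3 r @ [Hor r n2] @ w5 r) (r, n')"
          using a3 by (blast intro: twalk_append)
        then show ?thesis using False r by (simp add: w_def F1_def F2_def F3_def F4_def F5_def X_def)
      qed
    qed
    moreover have "twalk s (X p) (w Msg) (X q)"
    proof -
      have "twalk s (y, Suc n1) (w3 m) (z, n2)" using w3(1) by simp
      moreover have "twalk s (u, n1) (st y) (y, Suc n1)"
        using uv(2) ne o1(2) unfolding st_def by (auto simp: doubleton_eq_iff)
      moreover have "twalk s (z, n2) (if z = v' then [] else [Ver n2]) (v', n2)"
        using uv'(2) o1(4) by (auto simp: doubleton_eq_iff)
      ultimately have "twalk s (u, n1) (st y @ w3 m @ (if z = v' then [] else [Ver n2])) (v', n2)"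
        by (blast intro: twalk_append)
      then show ?thesis using pq c1(2) by (simp add: w_def F1_def F2_def F3_def F4_def F5_def X_def)
    qed
    moreover have "n \<le> n1 \<and> n1 < n2 \<and> n2 < n' \<and> X p = (fst (s n1), n1) \<and> X q = (snd (s n2), n2)"
      using o1 pq c1(2) unfolding X_def n'_def n2_def n1_def by simp
    ultimately show "\<exists>X w. passes s L I p q n (n + length l) X w"
      unfolding passes_def n'[symmetric] by blast
  qed
qed

end

section \<open>Selecting the rows\<close>

text \<open>The path must have an inner vertex, possibly \<open>y = z\<close>: that is the line on
  which the message travels while \<open>p\<close> and \<open>q\<close> stay occupied.\<close>

definition routed :: "('v \<times> 'v) set \<Rightarrow> 'v set \<Rightarrow> 'v \<Rightarrow> 'v \<Rightarrow> bool" where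
  "routed R S p q \<longleftrightarrow> (\<exists>y z. (p, y) \<in> R \<and> y \<notin> S \<and> z \<notin> S \<and>
     (y, z) \<in> {(x, x'). (x, x') \<in> R \<and> x \<notin> S \<and> x' \<notin> S}\<^sup>* \<and> (z, q) \<in> R)"

definition reldist :: "('v \<times> 'v) set \<Rightarrow> 'v \<Rightarrow> 'v \<Rightarrow> nat" where
  "reldist R x y = (LEAST n. (x, y) \<in> R ^^ n)"

lemma relpow_reldist: "(x, y) \<in> R\<^sup>* \<Longrightarrow> (x, y) \<in> R ^^ reldist R x y"
proof -
  assume "(x, y) \<in> R\<^sup>*"
  then obtain n where "(x, y) \<in> R ^^ n" unfolding rtrancl_power by (elim exE)
  then show ?thesis unfolding reldist_def by (rule LeastI)
qed

lemma reldist_le: "(x, y) \<in> R ^^ n \<Longrightarrow> reldist R x y \<le> n"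
  unfolding reldist_def by (rule Least_le)

lemma reldist_self: "reldist R x x = 0"
  using reldist_le[of x x 0 R] by simp

lemma reldist_eq_0: "(x, y) \<in> R\<^sup>* \<Longrightarrow> reldist R x y = 0 \<Longrightarrow> x = y"
  using relpow_reldist[of x y R] by simp

lemma reldist_sym:
  assumes s: "sym R"
  shows "reldist R x y = reldist R y x"
proof -
  have "(y, x) \<in> R ^^ n" if "(x, y) \<in> R ^^ n" for n x y
    using that
  proof (induction n arbitrary: y)
    case 0 then show ?case by simp
  next
    case (Suc n)
    from Suc.prems obtain z where "(x, z) \<in> R ^^ n" "(z, y) \<in> R" by (rule relpow_Suc_E)
    then have "(z, x) \<in> R ^^ n" "(y, z) \<in> R" using Suc.IH symD[OF s] by simp_all
    then show ?case using relpow_Suc_I2 by metis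
  qed
  then have "(x, y) \<in> R ^^ n \<longleftrightarrow> (y, x) \<in> R ^^ n" for n by blast
  then show ?thesis unfolding reldist_def by simp
qed

text \<open>Inner vertices of a shortest path lie metrically between its ends, hence outside
  \<open>S\<close>; since the ends are not adjacent, there is at least one.\<close>

lemma routed_geodesic:
  assumes conn: "(x, y) \<in> R\<^sup>*" and ne: "x \<noteq> y" "(x, y) \<notin> R"
    and S: "\<And>w. w \<in> S \<Longrightarrow> w \<noteq> x \<Longrightarrow> w \<noteq> y \<Longrightarrow> reldist R x y \<noteq> reldist R x w + reldist R w y"
  shows "routed R S x y"
proof -
  define n where "n = reldist R x y"
  have "(x, y) \<in> R ^^ n" unfolding n_def using relpow_reldist[OF conn] .
  then obtain f where f: "f 0 = x" "f n = y" "\<forall>i<n. (f i, f (Suc i)) \<in> R"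
    unfolding relpow_fun_conv by (elim exE conjE)
  have "n \<noteq> 0" using f(1,2) ne(1) by (cases n) auto
  moreover have "n \<noteq> Suc 0"
  proof
    assume "n = Suc 0"
    then show False using f(1,2) f(3)[rule_format, of 0] ne(2) by simp
  qed
  ultimately have n2: "2 \<le> n" by simp
  have inner: "f j \<notin> S" if j: "0 < j" "j < n" for j
  proof -
    have 1: "(x, f j) \<in> R ^^ j"
      unfolding relpow_fun_conv by (rule exI[of _ f]) (use f j in auto)
    have "(f j, y) \<in> R ^^ (n - j)"
      unfolding relpow_fun_conv by (rule exI[of _ "\<lambda>i. f (j + i)"]) (use f j in auto)
    note 2 = 1 this
    have "(x, f j) \<in> R\<^sup>*" "(f j, y) \<in> R\<^sup>*"
      using relpow_imp_rtrancl[OF 2(1)] relpow_imp_rtrancl[OF 2(2)] .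
    then have "(x, y) \<in> R ^^ (reldist R x (f j) + reldist R (f j) y)"
      unfolding relpow_add
      using relcompI[OF relpow_reldist[of x "f j" R] relpow_reldist[of "f j" y R]] by blast
    then have "n \<le> reldist R x (f j) + reldist R (f j) y" unfolding n_def by (rule reldist_le)
    moreover have "reldist R x (f j) \<le> j" "reldist R (f j) y \<le> n - j"
      using reldist_le[OF 2(1)] reldist_le[OF 2(2)] .
    ultimately have e: "n = reldist R x (f j) + reldist R (f j) y" "reldist R x (f j) = j"
      "reldist R (f j) y = n - j" using j by linarith+
    have "f j \<noteq> x" "f j \<noteq> y" using e(2,3) j reldist_self[of R x] reldist_self[of R y] by auto
    then show ?thesis using S[of "f j"] e(1) unfolding n_def by blast
  qed
  have "(f 1, f (Suc j)) \<in> {(x, x'). (x, x') \<in> R \<and> x \<notin> S \<and> x' \<notin> S}\<^sup>*" if "Suc j < n" for j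
    using that
  proof (induction j)
    case 0 then show ?case by simp
  next
    case (Suc j)
    have "(f (Suc j), f (Suc (Suc j))) \<in> {(x, x'). (x, x') \<in> R \<and> x \<notin> S \<and> x' \<notin> S}"
      using Suc.prems f(3) inner by simp
    moreover have "(f 1, f (Suc j)) \<in> {(x, x'). (x, x') \<in> R \<and> x \<notin> S \<and> x' \<notin> S}\<^sup>*"
      using Suc by simp
    ultimately show ?case by (rule rtrancl_into_rtrancl[rotated])
  qed
  from this[of "n - 2"] have "(f 1, f (n - 1)) \<in> {(x, x'). (x, x') \<in> R \<and> x \<notin> S \<and> x' \<notin> S}\<^sup>*"
    using n2 by (simp add: numeral_2_eq_2 Suc_diff_Suc)
  moreover have "(x, f 1) \<in> R" "(f (n - 1), y) \<in> R"
    using f(3)[rule_format, of 0] f(3)[rule_format, of "n - 1"] f(1,2) n2 by simp_all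
  moreover have "f 1 \<notin> S" "f (n - 1) \<notin> S" using inner n2 by simp_all
  ultimately show ?thesis unfolding routed_def by (intro exI[of _ "f 1"] exI[of _ "f (n - 1)"] conjI)
qed

lemma ramsey_four:
  fixes c :: "nat \<Rightarrow> nat \<Rightarrow> nat \<Rightarrow> nat \<Rightarrow> nat"
  assumes "\<And>i j l k. c i j l k < s"
  obtains y :: "nat \<Rightarrow> nat" and t where "strict_mono y"
    "\<And>i j l k. i < j \<Longrightarrow> j < l \<Longrightarrow> l < k \<Longrightarrow> c (y i) (y j) (y l) (y k) = t"
proof -
  define f where "f X = (let xs = sorted_list_of_set X in c (xs ! 0) (xs ! 1) (xs ! 2) (xs ! 3))" for X
  have "\<forall>X. X \<subseteq> UNIV \<and> finite X \<and> card X = 4 \<longrightarrow> f X < s" using assms by (simp add: f_def Let_def)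
  from Ramsey[OF infinite_UNIV_nat this] obtain Y t where
    Y: "infinite Y" "\<forall>X. X \<subseteq> Y \<and> finite X \<and> card X = 4 \<longrightarrow> f X = t" by (elim exE conjE)
  define y where "y = enumerate Y"
  have sm: "strict_mono y" unfolding y_def using Y(1) by (rule strict_mono_enumerate)
  have "c (y i) (y j) (y l) (y k) = t" if ij: "i < j" "j < l" "l < k" for i j l k
  proof -
    have o: "y i < y j" "y j < y l" "y l < y k" using sm ij by (auto simp: strict_mono_def)
    define xs where "xs = [y i, y j, y l, y k]"
    have "sorted xs" "distinct xs" unfolding xs_def using o by auto
    then have "sorted_list_of_set (set xs) = xs" by (rule sorted_list_of_set.idem_if_sorted_distinct)
    moreover have "card (set xs) = 4" using distinct_card[OF \<open>distinct xs\<close>] by (simp add: xs_def)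
    moreover have "set xs \<subseteq> Y" unfolding xs_def y_def using Y(1) by (auto intro: enumerate_in_set)
    ultimately show ?thesis using Y(2)[rule_format, of "set xs"] by (simp add: f_def xs_def)
  qed
  then show ?thesis by (rule that[OF sm])
qed

text \<open>The colour of a quadruple \<open>i < j < l < k\<close> records the metric betweenness relations of \<open>i, j, l\<close> in the
  \<open>k\<close>-th graph; only the middle index can be between the other two on a homogeneous set, so geodesics between
  consecutive elements avoid the other elements.\<close>

lemma row_selection:
  fixes E :: "nat \<Rightarrow> (nat \<times> nat) set"
  assumes sym: "\<And>k. sym (E k)"
    and conn: "\<And>k x y. x \<le> k \<Longrightarrow> y \<le> k \<Longrightarrow> (x, y) \<in> (E k)\<^sup>*"
  obtains a \<kappa> where "strict_mono a" "mono \<kappa>" "\<And>m. a (Suc m) \<le> \<kappa> m"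
    "\<And>m i. i \<le> m \<Longrightarrow> routed (E (\<kappa> m)) (a ` {..Suc m}) (a i) (a (Suc i))"
proof -
  define d where "d k = reldist (E k)" for k
  define b1 where "b1 i j l k \<longleftrightarrow> d k j l = d k j i + d k i l" for i j l k
  define b3 where "b3 i j l k \<longleftrightarrow> d k i j = d k i l + d k l j" for i j l k
  \<comment> \<open>Three bits, hence the bound 8: the lowest index lies between the other two, the
    highest does, the two lowest are adjacent.\<close>
  define c where "c i j l k = of_bool (b1 i j l k) + 2 * of_bool (b3 i j l k) + 4 * (of_bool ((i, j) \<in> E k) :: nat)"
    for i j l k
  have "c i j l k < 8" for i j l k unfolding c_def by (auto simp: of_bool_def)
  then obtain y :: "nat \<Rightarrow> nat" and t where y: "strict_mono y"
    "\<And>i j l k. i < j \<Longrightarrow> j < l \<Longrightarrow> l < k \<Longrightarrow> c (y i) (y j) (y l) (y k) = t"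
    using ramsey_four[of c 8] by metis
  have dec: "(b1 i j l k \<longleftrightarrow> odd (c i j l k)) \<and> (b3 i j l k \<longleftrightarrow> odd (c i j l k div 2)) \<and>
    ((i, j) \<in> E k \<longleftrightarrow> odd (c i j l k div 4))" for i j l k
    unfolding c_def of_bool_def by (auto split: if_splits)
  have hom1: "b1 (y i) (y j) (y l) (y k) \<longleftrightarrow> odd t" if "i < j" "j < l" "l < k" for i j l k
    using dec[of "y i" "y j" "y l" "y k"] unfolding y(2)[OF that] by simp
  have hom3: "b3 (y i) (y j) (y l) (y k) \<longleftrightarrow> odd (t div 2)" if "i < j" "j < l" "l < k" for i j l k
    using dec[of "y i" "y j" "y l" "y k"] unfolding y(2)[OF that] by simp
  have hom4: "(y i, y j) \<in> E (y k) \<longleftrightarrow> odd (t div 4)" if "i < j" "j < l" "l < k" for i j l k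
    using dec[of "y i" "y j" "y l" "y k"] unfolding y(2)[OF that] by simp
  have dsym: "d k u v = d k v u" for k u v unfolding d_def using reldist_sym[OF sym] .
  have ylt: "y i < y j \<longleftrightarrow> i < j" for i j using y(1) by (simp add: strict_mono_less)
  have yeq: "y i = y j \<longleftrightarrow> i = j" for i j using y(1) by (simp add: strict_mono_eq)
  have dpos: "d (y k) (y i) (y j) \<noteq> 0" if "i \<noteq> j" "i \<le> k" "j \<le> k" for i j k
  proof -
    have "y i \<le> y k" "y j \<le> y k" using y(1) that by (simp_all add: strict_mono_less_eq)
    then show ?thesis using reldist_eq_0[OF conn[of "y i" "y k" "y j"]] that(1) yeq
      unfolding d_def by blast
  qed
  have "even t"
  proof (rule ccontr)
    assume "odd t"
    \<comment> \<open>Writing d23 for the distance of \<open>y 2\<close> and \<open>y 3\<close>: d23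
      = d21 + d13 = (d10 + d02) + (d10 + d03) = d23 + 2 d10. Index 4 only selects the graph.\<close>
    then have "b1 (y 0) (y 2) (y 3) (y 4)" "b1 (y 1) (y 2) (y 3) (y 4)" "b1 (y 0) (y 1) (y 2) (y 4)"
      "b1 (y 0) (y 1) (y 3) (y 4)" using hom1 by simp_all
    then have "d (y 4) (y 1) (y 0) = 0"
      unfolding b1_def using dsym[of "y 4" "y 2" "y 1"] dsym[of "y 4" "y 2" "y 0"] by linarith
    then show False using dpos[of 1 0 4] by simp
  qed
  have "even (t div 2)"
  proof (rule ccontr)
    assume "odd (t div 2)"
    \<comment> \<open>Likewise d01 = d02 + d21 = (d03 + d32) + (d13 + d32) = d01 + 2 d32.\<close>
    then have "b3 (y 0) (y 1) (y 2) (y 4)" "b3 (y 0) (y 1) (y 3) (y 4)" "b3 (y 0) (y 2) (y 3) (y 4)"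
      "b3 (y 1) (y 2) (y 3) (y 4)" using hom3 by simp_all
    then have "d (y 4) (y 3) (y 2) = 0"
      unfolding b3_def using dsym[of "y 4" "y 2" "y 1"] dsym[of "y 4" "y 3" "y 1"] by linarith
    then show False using dpos[of 3 2 4] by simp
  qed
  show thesis
  proof (cases "odd (t div 4)")
    case True
    \<comment> \<open>All pairs are adjacent, so geodesics have no inner vertex. Every second
      element becomes a row, and the element skipped between two rows carries their messages. The
      offset 4 in \<open>\<kappa>\<close> leaves room for a third index beyond
      \<open>2 * m + 2\<close>.\<close>
    define a where "a i = y (2 * i)" for i
    define \<kappa> where "\<kappa> m = y (2 * m + 4)" for m
    show thesis
    proof (rule that[of a \<kappa>])
      show "strict_mono a" using y(1) unfolding a_def strict_mono_def by simp
      show "mono \<kappa>" using y(1) unfolding \<kappa>_def mono_def by (simp add: strict_mono_less_eq)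
      show "a (Suc m) \<le> \<kappa> m" for m using y(1) unfolding a_def \<kappa>_def by (simp add: strict_mono_less_eq)
      fix m i :: nat assume im: "i \<le> m"
      have "(a i, y (2 * i + 1)) \<in> E (\<kappa> m)" "(y (2 * i + 1), a (Suc i)) \<in> E (\<kappa> m)"
        unfolding a_def \<kappa>_def using True im
        by (simp_all add: hom4[where l = "2 * m + 3"])
      moreover have "y (2 * i + 1) \<notin> a ` {..Suc m}"
      proof
        assume "y (2 * i + 1) \<in> a ` {..Suc m}"
        then obtain j where "2 * i + 1 = 2 * j" unfolding a_def using yeq by blast
        then show False by presburger
      qed
      ultimately show "routed (E (\<kappa> m)) (a ` {..Suc m}) (a i) (a (Suc i))"
        unfolding routed_def
        by (intro exI[of _ "y (2 * i + 1)"] conjI rtrancl.rtrancl_refl)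
    qed
  next
    case False
    define \<kappa> where "\<kappa> m = y (m + 3)" for m
    show thesis
    proof (rule that[of y \<kappa>])
      show "strict_mono y" by (rule y(1))
      show "mono \<kappa>" using y(1) unfolding \<kappa>_def mono_def by (simp add: strict_mono_less_eq)
      show "y (Suc m) \<le> \<kappa> m" for m using y(1) unfolding \<kappa>_def by (simp add: strict_mono_less_eq)
      fix m i :: nat assume im: "i \<le> m"
      show "routed (E (\<kappa> m)) (y ` {..Suc m}) (y i) (y (Suc i))"
      proof (rule routed_geodesic)
        show "(y i, y (Suc i)) \<in> (E (\<kappa> m))\<^sup>*"
          using im y(1) unfolding \<kappa>_def by (intro conn) (simp_all add: strict_mono_less_eq)
        show "y i \<noteq> y (Suc i)" using yeq by simp
        show "(y i, y (Suc i)) \<notin> E (\<kappa> m)"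
          unfolding \<kappa>_def using False im by (simp add: hom4[where l = "m + 2"])
        fix w assume "w \<in> y ` {..Suc m}" "w \<noteq> y i" "w \<noteq> y (Suc i)"
        then obtain j where j: "w = y j" "j \<le> Suc m" "j \<noteq> i" "j \<noteq> Suc i" by auto
        show "reldist (E (\<kappa> m)) (y i) (y (Suc i))
            \<noteq> reldist (E (\<kappa> m)) (y i) w + reldist (E (\<kappa> m)) w (y (Suc i))"
        \<comment> \<open>Between consecutive indices there is no middle one, so \<open>w\<close> is
          the lowest or the highest of the three; neither lies between the others.\<close>
        proof (cases "j < i")
          case True
          then have "\<not> b1 (y j) (y i) (y (Suc i)) (y (m + 3))" using hom1 \<open>even t\<close> im by simp
          then show ?thesis unfolding b1_def d_def \<kappa>_def j(1) .
        next
          case False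
          then have "\<not> b3 (y i) (y (Suc i)) (y j) (y (m + 3))" using hom3 \<open>even (t div 2)\<close> j False by simp
          then show ?thesis unfolding b3_def d_def \<kappa>_def j(1) .
        qed
      qed
    qed
  qed
qed

section \<open>Systems of edge-disjoint lines\<close>

text \<open>\<open>H\<close> is the vertex set of one ray of the end, with which the rays of the immersed grid are compared.\<close>

locale line_system = wf_digraph G for G :: "('a, 'b) pre_digraph" +
  fixes T :: "nat \<Rightarrow> nat \<Rightarrow> 'a" and Te :: "nat \<Rightarrow> nat \<Rightarrow> 'b" and H :: "'a set"
  assumes arc: "Te i n \<in> arcs G \<and> tail G (Te i n) = T i n \<and> head G (Te i n) = T i (Suc n)"
    and inj_T: "inj (T i)"
    and Te_eq: "Te i n = Te j m \<Longrightarrow> i = j \<and> n = m"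
    and few_lines: "finite {i. z \<in> range (T i)}"
    and near_lines: "near (range (T i)) (range (T j))"
    and near_hub: "near (range (T i)) H" "near H (range (T i))"
    and hub_start: "finite F \<Longrightarrow>
      finite {i. \<not> (\<exists>u p. awalk u p (T i 0) \<and> u \<in> H \<and> set (awalk_verts u p) \<inter> F = {})}"
begin

definition linearcs :: "nat \<Rightarrow> 'b set" where
  "linearcs k = (\<Union>i\<le>k. range (Te i))"

text \<open>Only the arcs of the lines up to \<open>k\<close> are forbidden; their vertices may be
  crossed, and arcs of later lines may be used.\<close>

definition reach :: "nat \<Rightarrow> (nat \<times> nat) set" where
  "reach k = {(u, v). u \<le> k \<and> v \<le> k \<and> u \<noteq> v \<and>
     (\<forall>F. finite F \<longrightarrow> linked F (linearcs k) (range (T u)) (range (T v)))}"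

lemma reach_subset: "reach k \<subseteq> {..k} \<times> {..k}" and reach_irrefl: "(x, x) \<notin> reach k"
  unfolding reach_def by auto

lemma line_segment:
  assumes "m \<le> n"
  shows "awalk (T i m) (map (Te i) [m..<n]) (T i n)"
    "set (awalk_verts (T i m) (map (Te i) [m..<n])) = T i ` {m..n}"
  using ray_segment[of "Te i" "T i" m n] arc assms by simp_all

text \<open>The second alternative is what the induction from the end of the walk needs: an arc whose tail is outside
  \<open>B\<close> and whose head is outside \<open>A\<close> cannot lie on a line, provided every line lies in \<open>A\<close> or in \<open>B\<close>.\<close>

lemma crossing_walk:
  assumes "awalk x p y" "y \<in> B"
    and lines: "\<And>e. e \<in> Z \<Longrightarrow> tail G e \<in> B \<or> head G e \<in> A"
  shows "(\<exists>x' q y'. awalk x' q y' \<and> x' \<in> A \<and> y' \<in> B \<and> set (awalk_verts x' q) \<subseteq> set (awalk_verts x p)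
      \<and> set q \<inter> Z = {})
    \<or> (\<exists>q y'. awalk x q y' \<and> y' \<in> B \<and> set (awalk_verts x q) \<subseteq> set (awalk_verts x p) \<and> set q \<inter> Z = {})"
  using assms(1)
proof (induction p arbitrary: x)
  case Nil
  then show ?case using assms(2) by (intro disjI2 exI[of _ "[]"] exI[of _ y]) (auto simp: awalk_Nil_iff)
next
  case (Cons e p)
  define c where "c = head G e"
  have e: "e \<in> arcs G" "x = tail G e" "awalk c p y" using Cons.prems by (simp_all add: awalk_Cons_iff c_def)
  have vs: "set (awalk_verts x (e # p)) = insert x (set (awalk_verts c p))" using e(2) by (simp add: c_def)
  consider (a) x' q y' where "awalk x' q y'" "x' \<in> A" "y' \<in> B" "set (awalk_verts x' q) \<subseteq> set (awalk_verts c p)"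
      "set q \<inter> Z = {}"
    | (b) q y' where "awalk c q y'" "y' \<in> B" "set (awalk_verts c q) \<subseteq> set (awalk_verts c p)" "set q \<inter> Z = {}"
    using Cons.IH[OF e(3)] by (elim disjE exE conjE)
  then show ?case
  proof cases
    case a
    then show ?thesis using vs by (intro disjI1 exI[of _ x'] exI[of _ q] exI[of _ y']) auto
  next
    case b
    consider "c \<in> A" | "x \<in> B" | "c \<notin> A" "x \<notin> B" by blast
    then show ?thesis
    proof cases
      case 1
      then show ?thesis using vs b by (intro disjI1 exI[of _ c] exI[of _ q] exI[of _ y']) auto
    next
      case 2
      have "x \<in> verts G" using e wellformed by simp
      then show ?thesis using 2 by (intro disjI2 exI[of _ "[]"] exI[of _ x]) (simp add: awalk_Nil_iff e(2))
    next
      case 3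
      then have "e \<notin> Z" using lines[of e] e(2) c_def by blast
      moreover have "awalk x (e # q) y'" using b(1) e by (simp add: awalk_Cons_iff c_def)
      moreover have "set (awalk_verts x (e # q)) \<subseteq> set (awalk_verts x (e # p))" using b(3) e(2) by (auto simp: c_def)
      ultimately show ?thesis using b(2,4) by (intro disjI2 exI[of _ "e # q"] exI[of _ y']) auto
    qed
  qed
qed

text \<open>Otherwise each line reachable from \<open>u\<close> is separated from each other line up
  to \<open>k\<close> by a finite set, up to walks that use line arcs. A walk from
  \<open>T u\<close> to \<open>T v\<close> that avoids the union of these sets yields, by
  \<open>crossing_walk\<close>, a walk between the two classes without line arcs.\<close>

lemma reach_strong:
  assumes "u \<le> k" "v \<le> k"
  shows "(u, v) \<in> (reach k)\<^sup>*"
proof (rule ccontr)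
  assume nv: "(u, v) \<notin> (reach k)\<^sup>*"
  define U where "U = {w. w \<le> k \<and> (u, w) \<in> (reach k)\<^sup>*}"
  define V where "V = {w. w \<le> k \<and> (u, w) \<notin> (reach k)\<^sup>*}"
  have fin: "finite U" "finite V" unfolding U_def V_def by simp_all
  have "\<exists>F. finite F \<and> \<not> linked F (linearcs k) (range (T x)) (range (T y))" if "x \<in> U" "y \<in> V" for x y
  proof (rule ccontr)
    assume "\<not> ?thesis"
    then have "(x, y) \<in> reach k" using that unfolding reach_def U_def V_def by auto
    then have "(u, y) \<in> (reach k)\<^sup>*" using that(1) unfolding U_def by (auto intro: rtrancl_into_rtrancl)
    then show False using that(2) unfolding V_def by blast
  qed
  then obtain W where W: "\<And>x y. x \<in> U \<Longrightarrow> y \<in> V \<Longrightarrow> finite (W x y)"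
    "\<And>x y. x \<in> U \<Longrightarrow> y \<in> V \<Longrightarrow> \<not> linked (W x y) (linearcs k) (range (T x)) (range (T y))" by metis
  define F where "F = (\<Union>x\<in>U. \<Union>y\<in>V. W x y)"
  have "finite F" unfolding F_def using fin W(1) by blast
  then obtain a p b where p: "awalk a p b" "a \<in> range (T u)" "b \<in> range (T v)" "set (awalk_verts a p) \<inter> F = {}"
    by (rule nearE[OF near_lines])
  define A where "A = (\<Union>x\<in>U. range (T x))"
  define B where "B = (\<Union>y\<in>V. range (T y))"
  have uU: "u \<in> U" and vV: "v \<in> V" using assms nv unfolding U_def V_def by auto
  have aA: "a \<in> A" and bB: "b \<in> B" unfolding A_def B_def using p uU vV by blast+
  have lines: "tail G e \<in> B \<or> head G e \<in> A" if "e \<in> linearcs k" for e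
  proof -
    from that obtain i n where i: "i \<le> k" "e = Te i n" unfolding linearcs_def by blast
    then have "i \<in> U \<or> i \<in> V" unfolding U_def V_def by blast
    then show ?thesis using arc[of i n] i(2) unfolding A_def B_def by auto
  qed
  obtain x' q y' where q: "awalk x' q y'" "x' \<in> A" "y' \<in> B" "set (awalk_verts x' q) \<subseteq> set (awalk_verts a p)"
      "set q \<inter> linearcs k = {}"
    using crossing_walk[OF p(1) bB lines] aA by blast
  obtain x y where xy: "x \<in> U" "y \<in> V" "x' \<in> range (T x)" "y' \<in> range (T y)"
    using q(2,3) unfolding A_def B_def by blast
  have "W x y \<subseteq> F" unfolding F_def using xy by blast
  then have "set (awalk_verts x' q) \<inter> W x y = {}" using q(4) p(4) by blast
  then have "linked (W x y) (linearcs k) (range (T x)) (range (T y))"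
    unfolding linked_def using q xy by blast
  then show False using W(2) xy by blast
qed

text \<open>At time \<open>n\<close> a path for the arc \<open>s n\<close> is chosen so far out that
  it avoids all earlier paths. Then the positions on all lines move beyond the vertices of the
  earlier paths, with the new path attached at the positions of its two lines.\<close>

lemma realize_schedule:
  fixes s :: "nat \<Rightarrow> nat \<times> nat" and K :: "nat \<Rightarrow> nat"
  assumes s: "\<And>n. s n \<in> reach (K n)"
  obtains pos :: "nat \<Rightarrow> nat \<Rightarrow> nat" and P :: "nat \<Rightarrow> 'b list" and VP :: "nat \<Rightarrow> 'a set" where
    "\<And>n i. pos n i < pos (Suc n) i"
    "\<And>n. awalk (T (fst (s n)) (pos n (fst (s n)))) (P n) (T (snd (s n)) (pos n (snd (s n))))"
    "\<And>n. VP n = set (awalk_verts (T (fst (s n)) (pos n (fst (s n)))) (P n))"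
    "\<And>m n. m \<noteq> n \<Longrightarrow> VP m \<inter> VP n = {}"
    "\<And>n. set (P n) \<inter> linearcs (K n) = {}"
    "\<And>m n i r. m < n \<Longrightarrow> pos n i \<le> r \<Longrightarrow> T i r \<notin> VP m"
proof -
  \<comment> \<open>A state consists of the positions at time \<open>n\<close>, the path of time
    \<open>n\<close>, and a finite set containing the vertices of all paths so far.\<close>
  define ok where "ok n x \<longleftrightarrow> finite (snd (snd x)) \<and>
     awalk (T (fst (s n)) (fst x (fst (s n)))) (fst (snd x)) (T (snd (s n)) (fst x (snd (s n)))) \<and>
     set (awalk_verts (T (fst (s n)) (fst x (fst (s n)))) (fst (snd x))) \<subseteq> snd (snd x) \<and>
     set (fst (snd x)) \<inter> linearcs (K n) = {}"
    for n and x :: "(nat \<Rightarrow> nat) \<times> 'b list \<times> 'a set"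
  define nxt where "nxt n x y \<longleftrightarrow> snd (snd x) \<subseteq> snd (snd y) \<and>
     set (awalk_verts (T (fst (s (Suc n))) (fst y (fst (s (Suc n))))) (fst (snd y))) \<inter> snd (snd x) = {} \<and>
     (\<forall>i. fst x i < fst y i \<and> (\<forall>r\<ge>fst y i. T i r \<notin> snd (snd x)))"
    for n and x y :: "(nat \<Rightarrow> nat) \<times> 'b list \<times> 'a set"
  have step: "\<exists>f' p. awalk (T (fst (s n)) (f' (fst (s n)))) p (T (snd (s n)) (f' (snd (s n)))) \<and>
      set (awalk_verts (T (fst (s n)) (f' (fst (s n)))) p) \<inter> W = {} \<and> set p \<inter> linearcs (K n) = {} \<and>
      (\<forall>i. f i < f' i \<and> (\<forall>r\<ge>f' i. T i r \<notin> W))" if W: "finite W" for n and f :: "nat \<Rightarrow> nat" and W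
  proof -
    obtain u v where uv: "s n = (u, v)" by (cases "s n")
    have g: "u \<noteq> v" "\<And>F. finite F \<Longrightarrow> linked F (linearcs (K n)) (range (T u)) (range (T v))"
      using s[of n] unfolding uv reach_def by auto
    have "\<exists>N. \<forall>r\<ge>N. T i r \<notin> W" for i
    proof -
      obtain N where "\<And>r. r \<ge> N \<Longrightarrow> T i r \<notin> W" using inj_avoids[OF inj_T W] by blast
      then show ?thesis by blast
    qed
    then obtain N where N: "\<And>i r. r \<ge> N i \<Longrightarrow> T i r \<notin> W" by metis
    define g where "g i = max (N i) (Suc (f i))" for i
    have "finite (W \<union> T u ` {..g u} \<union> T v ` {..g v})" using W by simp
    from g(2)[OF this] obtain a p b where p: "awalk a p b" "a \<in> range (T u)" "b \<in> range (T v)"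
      "set (awalk_verts a p) \<inter> (W \<union> T u ` {..g u} \<union> T v ` {..g v}) = {}" "set p \<inter> linearcs (K n) = {}"
      unfolding linked_def by (elim exE conjE)
    obtain \<alpha> \<beta> where ab: "a = T u \<alpha>" "b = T v \<beta>" using p(2,3) by blast
    have "a \<notin> T u ` {..g u}" using hd_in_awalk_verts(1)[OF p(1)] p(4) by blast
    then have \<alpha>: "g u < \<alpha>" using ab(1) by (meson atMost_iff imageI leI)
    have "b \<notin> T v ` {..g v}" using last_in_awalk_verts[OF p(1)] p(4) by blast
    then have \<beta>: "g v < \<beta>" using ab(2) by (meson atMost_iff imageI leI)
    define f' where "f' = g(u := \<alpha>, v := \<beta>)"
    have ff: "f' u = \<alpha>" "f' v = \<beta>" unfolding f'_def using g(1) by simp_all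
    have ge: "g i \<le> f' i" for i unfolding f'_def using \<alpha> \<beta> by simp
    show ?thesis
    proof (intro exI[of _ f'] exI[of _ p] conjI allI impI)
      show "awalk (T (fst (s n)) (f' (fst (s n)))) p (T (snd (s n)) (f' (snd (s n))))"
        unfolding uv fst_conv snd_conv ff using p(1) ab by simp
      show "set (awalk_verts (T (fst (s n)) (f' (fst (s n)))) p) \<inter> W = {}"
        unfolding uv fst_conv snd_conv ff using p(4) ab by blast
      show "set p \<inter> linearcs (K n) = {}" by (rule p(5))
      show "f i < f' i" for i using ge[of i] unfolding g_def by simp
      show "T i r \<notin> W" if "f' i \<le> r" for i r
        using N[of i r] ge[of i] that unfolding g_def by simp
    qed
  qed
  have "\<exists>x. \<forall>n. ok n (x n) \<and> nxt n (x n) (x (Suc n))"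
  proof (rule dependent_nat_choice)
    obtain f p where "awalk (T (fst (s 0)) (f (fst (s 0)))) p (T (snd (s 0)) (f (snd (s 0))))"
      "set p \<inter> linearcs (K 0) = {}" using step[of "{}" 0 "\<lambda>_. 0"] by blast
    then show "\<exists>x. ok 0 x" unfolding ok_def
      by (intro exI[of _ "(f, p, set (awalk_verts (T (fst (s 0)) (f (fst (s 0)))) p))"]) simp
  next
    fix x n assume x: "ok n x"
    then have "finite (snd (snd x))" unfolding ok_def by simp
    from step[OF this, of "Suc n" "fst x"] obtain f' p where fp:
      "awalk (T (fst (s (Suc n))) (f' (fst (s (Suc n))))) p (T (snd (s (Suc n))) (f' (snd (s (Suc n)))))"
      "set (awalk_verts (T (fst (s (Suc n))) (f' (fst (s (Suc n))))) p) \<inter> snd (snd x) = {}"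
      "set p \<inter> linearcs (K (Suc n)) = {}" "\<forall>i. fst x i < f' i \<and> (\<forall>r\<ge>f' i. T i r \<notin> snd (snd x))"
      by (elim exE conjE)
    show "\<exists>y. ok (Suc n) y \<and> nxt n x y"
    proof (intro exI conjI)
      show "ok (Suc n) (f', p, snd (snd x) \<union> set (awalk_verts (T (fst (s (Suc n))) (f' (fst (s (Suc n))))) p))"
        unfolding ok_def using fp \<open>finite (snd (snd x))\<close> by simp
      show "nxt n x (f', p, snd (snd x) \<union> set (awalk_verts (T (fst (s (Suc n))) (f' (fst (s (Suc n))))) p))"
        unfolding nxt_def using fp by simp
    qed
  qed
  then obtain x where x: "\<forall>n. ok n (x n) \<and> nxt n (x n) (x (Suc n))" by (elim exE)
  define pos where "pos n = fst (x n)" for n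
  define P where "P n = fst (snd (x n))" for n
  define W where "W n = snd (snd (x n))" for n
  define VP where "VP n = set (awalk_verts (T (fst (s n)) (pos n (fst (s n)))) (P n))" for n
  have 1: "awalk (T (fst (s n)) (pos n (fst (s n)))) (P n) (T (snd (s n)) (pos n (snd (s n))))"
    "VP n \<subseteq> W n" "set (P n) \<inter> linearcs (K n) = {}" for n
    using x unfolding ok_def pos_def P_def W_def VP_def by simp_all
  have 2: "W n \<subseteq> W (Suc n)" "VP (Suc n) \<inter> W n = {}" "pos n i < pos (Suc n) i"
    "r \<ge> pos (Suc n) i \<Longrightarrow> T i r \<notin> W n" for n i r
    using x unfolding nxt_def pos_def P_def W_def VP_def by simp_all
  have Wm: "W m \<subseteq> W n" if "m \<le> n" for m n using lift_Suc_mono_le[of W, OF 2(1) that] .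
  have lt: "VP m \<inter> VP n = {}" if "m < n" for m n
  proof -
    from that obtain l where l: "n = Suc l" "m \<le> l" by (cases n) auto
    then show ?thesis using 1(2)[of m] Wm[of m l] 2(2)[of l] by blast
  qed
  show thesis
  proof (rule that[of pos P VP])
    show "VP m \<inter> VP n = {}" if "m \<noteq> n" for m n using lt[of m n] lt[of n m] that by (cases "m < n") auto
    show "T i r \<notin> VP m" if "m < n" "pos n i \<le> r" for m n i r
    proof -
      from that(1) obtain l where l: "n = Suc l" "m \<le> l" by (cases n) auto
      then have "T i r \<notin> W l" using 2(4)[of l i r] that(2) by simp
      then show ?thesis using 1(2)[of m] Wm[of m l] l by blast
    qed
  qed (use 1 2(3) VP_def in auto)
qed

end

context wf_digraph begin

lemma linked_extend:
  assumes "awalk x p y" "set (awalk_verts x p) \<inter> F = {}" "awalk y q z" "set (awalk_verts y q) \<inter> F = {}"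
    "x \<in> A" "z \<in> B"
  shows "linked F {} A B"
  unfolding linked_def
proof (intro exI conjI)
  show "awalk x (p @ q) z" using awalk_appendI[OF assms(1,3)] .
  show "set (awalk_verts x (p @ q)) \<inter> F = {}"
    unfolding set_awalk_verts_append[OF assms(1,3)] using assms(2,4) by blast
qed (use assms in auto)

end

section \<open>From walks of a schedule to walks of the digraph\<close>

locale realization = line_system +
  fixes s :: "nat \<Rightarrow> nat \<times> nat" and K :: "nat \<Rightarrow> nat" and pos :: "nat \<Rightarrow> nat \<Rightarrow> nat"
    and P :: "nat \<Rightarrow> 'b list" and VP :: "nat \<Rightarrow> 'a set"
  assumes K_mono: "mono K"
    and pos_less: "pos n i < pos (Suc n) i"
    and P_walk: "awalk (T (fst (s n)) (pos n (fst (s n)))) (P n) (T (snd (s n)) (pos n (snd (s n))))"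
    and VP: "VP n = set (awalk_verts (T (fst (s n)) (pos n (fst (s n)))) (P n))"
    and VP_disjoint: "m \<noteq> n \<Longrightarrow> VP m \<inter> VP n = {}"
    and P_lines: "set (P n) \<inter> linearcs (K n) = {}"
    and lines_VP: "m < n \<Longrightarrow> pos n i \<le> r \<Longrightarrow> T i r \<notin> VP m"
begin

fun point :: "nat \<times> nat \<Rightarrow> 'a" where
  "point (i, n) = T i (pos n i)"

fun seg :: "tarc \<Rightarrow> 'b list" where
  "seg (Hor i n) = map (Te i) [pos n i..<pos (Suc n) i]"
| "seg (Ver n) = P n"

text \<open>A line beyond \<open>K n\<close> must not be used at time \<open>n\<close>: vertical
  paths of that time or later may contain arcs of its segment.\<close>

fun valid :: "tarc \<Rightarrow> bool" where
  "valid (Hor i n) \<longleftrightarrow> i \<le> K n"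
| "valid (Ver n) \<longleftrightarrow> True"

definition used :: "'b set" where
  "used = (\<Union>e\<in>{e. valid e}. set (seg e))"

lemma pos_mono: "m \<le> n \<Longrightarrow> pos m i \<le> pos n i"
  using lift_Suc_mono_le[of "\<lambda>n. pos n i" m n] pos_less[of _ i] less_imp_le by blast

lemma T_in_verts: "T i n \<in> verts G"
  using arc[of i n] wellformed(1)[of "Te i n"] by simp

lemma seg_walk: "twalk s x p y \<Longrightarrow> awalk (point x) (concat (map seg p)) (point y)"
proof (induction p arbitrary: x)
  case Nil
  then show ?case using T_in_verts by (cases y) (simp add: awalk_Nil_iff)
next
  case (Cons e p)
  show ?case
  proof (cases e)
    case (Hor i n)
    then have "x = (i, n)" "awalk (point (i, Suc n)) (concat (map seg p)) (point y)"
      using Cons.IH[of "(i, Suc n)"] Cons.prems Hor by simp_all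
    then show ?thesis
      using Hor awalk_appendI[OF line_segment(1)[OF less_imp_le[OF pos_less[of n i]], of i]] by simp
  next
    case (Ver n)
    then have x: "x = (fst (s n), n)" and w: "awalk (point (snd (s n), n)) (concat (map seg p)) (point y)"
      using Cons.IH[of "(snd (s n), n)"] Cons.prems Ver by simp_all
    have "awalk (point x) (P n) (point (snd (s n), n))" using P_walk[of n] x by simp
    from awalk_appendI[OF this w] show ?thesis using Ver by simp
  qed
qed

lemma P_verts: "c \<in> set (P n) \<Longrightarrow> tail G c \<in> VP n" "c \<in> set (P n) \<Longrightarrow> head G c \<in> VP n"
  unfolding VP using awalk_verts_arc1 awalk_verts_arc2[OF P_walk] by blast+

text \<open>The critical pair is a segment of line \<open>i\<close> at time \<open>n\<close> and a
  vertical path of time \<open>m\<close>. For \<open>n \<le> m\<close> the path avoids the line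
  because \<open>i \<le> K n \<le> K m\<close>; for \<open>m < n\<close> the segment starts beyond
  all vertices of the path.\<close>

lemma seg_disjoint:
  assumes "valid e" "valid e'" "c \<in> set (seg e)" "c \<in> set (seg e')"
  shows "e = e'"
proof -
  have hv: False if "i \<le> K n" "c \<in> set (seg (Hor i n))" "c \<in> set (P m)" for i n m
  proof -
    from that(2) obtain r where r: "c = Te i r" "pos n i \<le> r" by auto
    show False
    proof (cases "n \<le> m")
      case True
      then have "i \<le> K m" using that(1) monoD[OF K_mono True] by simp
      then have "c \<in> linearcs (K m)" unfolding linearcs_def r(1) by blast
      then show False using P_lines[of m] that(3) by blast
    next
      case False
      then have "T i r \<notin> VP m" using lines_VP[of m n i r] r(2) by simp
      then show False using P_verts(1)[OF that(3)] r(1) arc[of i r] by simp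
    qed
  qed
  have hh: "n = m" if rr: "pos n i \<le> r" "r < pos (Suc n) i" "pos m i \<le> r" "r < pos (Suc m) i" for n m i r
  proof (rule ccontr)
    assume "n \<noteq> m"
    then consider "Suc n \<le> m" | "Suc m \<le> n" by linarith
    then show False using pos_mono[of "Suc n" m i] pos_mono[of "Suc m" n i] rr by cases linarith+
  qed
  show ?thesis
  proof (cases e)
    case e: (Hor i n)
    show ?thesis
    proof (cases e')
      case (Hor j m)
      obtain r where r: "c = Te i r" "pos n i \<le> r" "r < pos (Suc n) i" using assms(3) e by auto
      obtain r' where r': "c = Te j r'" "pos m j \<le> r'" "r' < pos (Suc m) j" using assms(4) Hor by auto
      have "i = j" "r = r'" using Te_eq[of i r j r'] r r' by auto
      then show ?thesis using hh[of n i r m] r r' e Hor by simp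
    next
      case (Ver m)
      then show ?thesis using hv[of i n m] assms e by simp
    qed
  next
    case e: (Ver n)
    show ?thesis
    proof (cases e')
      case (Hor j m)
      then show ?thesis using hv[of j m n] assms e by simp
    next
      case (Ver m)
      have "tail G c \<in> VP n \<inter> VP m" using P_verts(1) assms(3,4) e Ver by simp
      then show ?thesis using VP_disjoint[of n m] e Ver by blast
    qed
  qed
qed

lemma used_cases:
  assumes "c \<in> used"
  obtains i r where "c = Te i r" | n where "c \<in> set (P n)"
proof -
  obtain e where e: "c \<in> set (seg e)" using assms unfolding used_def by blast
  then show thesis
  proof (cases e)
    case (Hor i n)
    then show thesis using e that(1) by auto
  next
    case (Ver n)
    then show thesis using e that(2) by simp
  qed
qed

text \<open>A vertex lies on finitely many lines, once on each, and on at most one vertical path.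
  This is what makes the image of a grid ray leave every finite set.\<close>

lemma used_locally_finite: "finite {c \<in> used. tail G c = z}"
proof (rule finite_subset)
  show "{c \<in> used. tail G c = z} \<subseteq>
    (\<Union>i\<in>{i. z \<in> range (T i)}. Te i ` (T i -` {z})) \<union> (\<Union>n\<in>{n. VP n \<inter> {z} \<noteq> {}}. set (P n))"
  proof
    fix c assume c: "c \<in> {c \<in> used. tail G c = z}"
    then have "c \<in> used" by simp
    then show "c \<in> (\<Union>i\<in>{i. z \<in> range (T i)}. Te i ` (T i -` {z})) \<union> (\<Union>n\<in>{n. VP n \<inter> {z} \<noteq> {}}. set (P n))"
    proof (cases rule: used_cases)
      case (1 i r)
      then have "T i r = z" using c arc[of i r] by simp
      then show ?thesis using 1 by auto
    next
      case (2 n)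
      then have "z \<in> VP n" using P_verts(1)[OF 2] c by simp
      then show ?thesis using 2 by blast
    qed
  qed
  have "finite (T i -` {z})" for i using inj_T by (simp add: finite_vimageI)
  moreover have "finite {n. VP n \<inter> {z} \<noteq> {}}" by (rule finite_disjoint_hits[OF VP_disjoint]) simp_all
  ultimately show "finite ((\<Union>i\<in>{i. z \<in> range (T i)}. Te i ` (T i -` {z})) \<union> (\<Union>n\<in>{n. VP n \<inter> {z} \<noteq> {}}. set (P n)))"
    using few_lines by simp
qed

text \<open>Consecutive arcs on vertical paths share a vertex and hence lie on the same finite path,
  so \<open>Q\<close> uses infinitely many line arcs. From such an arc the line leads on to
  \<open>H\<close>; conversely \<open>H\<close> reaches a line and follows it up to such an
  arc.\<close>

lemma ray_in_used:
  assumes Q: "is_ray G Q" "ray_arcs Q \<subseteq> used"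
  shows "near (ray_verts Q) H" "near H (ray_verts Q)"
proof -
  define f where "f = fst Q"
  define g where "g = snd Q"
  have fg: "inj f" "\<And>n. tail G (g n) = f n" "\<And>n. head G (g n) = f (Suc n)"
    using Q(1) unfolding is_ray_def f_def g_def by auto
  have rv: "ray_verts Q = range f" unfolding ray_verts_def f_def ..
  have gU: "g n \<in> used" for n using Q(2) unfolding ray_arcs_def g_def by blast
  have inj_g: "inj g" using fg(1,2) by (metis injD injI)
  define J where "J = {n. \<exists>i r. g n = Te i r}"
  have "infinite J"
  proof
    assume "finite J"
    then obtain N where N: "\<forall>n\<in>J. n < N" using finite_nat_set_iff_bounded by blast
    have ex: "\<exists>m. g n \<in> set (P m)" if "n \<ge> N" for n
    proof -
      have "n \<notin> J" using N that by auto
      then show ?thesis using used_cases[OF gU[of n]] unfolding J_def by blast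
    qed
    obtain m where m: "g N \<in> set (P m)" using ex by blast
    have "g (N + k) \<in> set (P m)" for k
    proof (induction k)
      case 0 then show ?case using m by simp
    next
      case (Suc k)
      obtain m' where m': "g (N + Suc k) \<in> set (P m')" using ex[of "N + Suc k"] by auto
      have "f (N + Suc k) \<in> VP m'" using P_verts(1)[OF m'] fg(2) by simp
      moreover have "f (N + Suc k) \<in> VP m" using P_verts(2)[OF Suc] fg(3) by simp
      ultimately have "m' = m" using VP_disjoint[of m' m] by blast
      then show ?case using m' by simp
    qed
    then have "range (\<lambda>k. g (N + k)) \<subseteq> set (P m)" by blast
    then have "finite (range (\<lambda>k. g (N + k)))" using finite_subset by blast
    moreover have "inj (\<lambda>k. g (N + k))" using injD[OF inj_g] by (intro injI) force
    ultimately show False using finite_imageD infinite_UNIV_nat by blast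
  qed
  have "\<forall>n\<in>J. \<exists>x. g n = Te (fst x) (snd x)" unfolding J_def by simp
  then obtain x where x: "\<And>n. n \<in> J \<Longrightarrow> g n = Te (fst (x n)) (snd (x n))" by metis
  have fx: "f n = T (fst (x n)) (snd (x n))" if "n \<in> J" for n
    using x[OF that] fg(2)[of n] arc by metis
  have inj_x: "inj_on x J"
  proof (rule inj_onI)
    fix n m assume nm: "n \<in> J" "m \<in> J" "x n = x m"
    then have "g n = g m" using x by metis
    then show "n = m" using inj_g by (simp add: inj_eq)
  qed
  have finJ: "finite {n \<in> J. x n \<in> S}" if "finite S" for S
  proof (rule finite_imageD)
    show "inj_on x {n \<in> J. x n \<in> S}" using inj_x by (rule inj_on_subset) simp
    show "finite (x ` {n \<in> J. x n \<in> S})" by (rule finite_subset[OF _ that]) auto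
  qed
  have touched: "finite {i. range (T i) \<inter> F \<noteq> {}}" if "finite F" for F
  proof -
    have "{i. range (T i) \<inter> F \<noteq> {}} = (\<Union>z\<in>F. {i. z \<in> range (T i)})" by auto
    then show ?thesis using few_lines that by simp
  qed
  have line_late: "\<exists>N. \<forall>r\<ge>N. T i r \<notin> F" if F: "finite F" for i F
  proof -
    obtain N where "\<And>r. r \<ge> N \<Longrightarrow> T i r \<notin> F" using inj_avoids[OF inj_T F] by blast
    then show ?thesis by blast
  qed
  show "near (ray_verts Q) H" unfolding near_def rv
  proof (intro allI impI)
    fix F :: "'a set" assume F: "finite F"
    obtain N where N: "\<And>i r. r \<ge> N i \<Longrightarrow> T i r \<notin> F" using line_late[OF F] by metis
    \<comment> \<open>The finitely many points of lines from which the line may still run into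
      \<open>F\<close>.\<close>
    define S where "S = (SIGMA i:{i. range (T i) \<inter> F \<noteq> {}}. {..N i})"
    have "finite S" unfolding S_def using touched[OF F] by (intro finite_SigmaI) simp_all
    then have "infinite (J - {n \<in> J. x n \<in> S})" using finJ \<open>infinite J\<close> by simp
    then obtain n where n: "n \<in> J" "x n \<notin> S" using infinite_imp_nonempty by blast
    define i where "i = fst (x n)"
    define r where "r = snd (x n)"
    have free: "T i q \<notin> F" if "r \<le> q" for q
    proof (cases "range (T i) \<inter> F = {}")
      case False
      then have "N i < r" using n(2) unfolding S_def i_def r_def by (cases "x n") auto
      then show ?thesis using N[of i q] that by simp
    qed auto
    have fin: "finite (F \<union> T i ` {..r})" using F by simp
    obtain u p v where p: "awalk u p v" "u \<in> range (T i)" "v \<in> H" "set (awalk_verts u p) \<inter> (F \<union> T i ` {..r}) = {}"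
      by (rule nearE[OF near_hub(1) fin])
    obtain r' where r': "u = T i r'" using p(2) by blast
    have "u \<notin> T i ` {..r}" using hd_in_awalk_verts(1)[OF p(1)] p(4) by blast
    then have "r \<le> r'" using r' by (meson atMost_iff imageI linear)
    note sg = line_segment[OF this, of i]
    show "linked F {} (range f) H"
    proof (rule linked_extend[OF sg(1)])
      show "set (awalk_verts (T i r) (map (Te i) [r..<r'])) \<inter> F = {}" unfolding sg(2) using free by auto
      show "awalk (T i r') p v" using p(1) r' by simp
      show "set (awalk_verts (T i r') p) \<inter> F = {}" using p(4) r' by blast
      show "T i r \<in> range f" using fx[OF n(1)] unfolding i_def r_def by (metis rangeI)
      show "v \<in> H" by (rule p(3))
    qed
  qed
  show "near H (ray_verts Q)" unfolding near_def rv
  proof (intro allI impI)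
    fix F :: "'a set" assume F: "finite F"
    show "linked F {} H (range f)"
    proof (cases "\<exists>i. infinite {n \<in> J. fst (x n) = i}")
      case True
      then obtain i where i: "infinite {n \<in> J. fst (x n) = i}" by blast
      obtain N where N: "\<And>r. r \<ge> N \<Longrightarrow> T i r \<notin> F" using inj_avoids[OF inj_T F] by blast
      have fin: "finite (F \<union> T i ` {..N})" using F by simp
      obtain u p v where p: "awalk u p v" "u \<in> H" "v \<in> range (T i)" "set (awalk_verts u p) \<inter> (F \<union> T i ` {..N}) = {}"
        by (rule nearE[OF near_hub(2) fin])
      obtain r where r: "v = T i r" using p(3) by blast
      have "v \<notin> T i ` {..N}" using last_in_awalk_verts[OF p(1)] p(4) by blast
      then have rN: "N \<le> r" using r by (meson atMost_iff imageI linear)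
      have "finite {n \<in> J. x n \<in> {i} \<times> {..r}}" by (rule finJ) simp
      then have "infinite ({n \<in> J. fst (x n) = i} - {n \<in> J. x n \<in> {i} \<times> {..r}})" using i by simp
      then obtain n where n: "n \<in> J" "fst (x n) = i" "x n \<notin> {i} \<times> {..r}" using infinite_imp_nonempty by blast
      have rn: "r \<le> snd (x n)" using n(2,3) by (cases "x n") auto
      note sg = line_segment[OF this, of i]
      show ?thesis
      proof (rule linked_extend[OF p(1)])
        show "set (awalk_verts u p) \<inter> F = {}" using p(4) by blast
        show "awalk v (map (Te i) [r..<snd (x n)]) (T i (snd (x n)))" using sg(1) r by simp
        show "set (awalk_verts v (map (Te i) [r..<snd (x n)])) \<inter> F = {}" unfolding r sg(2) using N rN by auto
        show "T i (snd (x n)) \<in> range f" using fx[OF n(1)] n(2) by (metis rangeI)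
      qed (rule p(2))
    next
      case False
      \<comment> \<open>Here \<open>Q\<close> meets each line in finitely many arcs, and a walk from
        \<open>H\<close> might join the line only behind them. So a line is needed whose very start
        is accessible from \<open>H\<close>; all but finitely many are suitable by
        \<open>hub_start\<close>.\<close>
      define I0 where "I0 = {i. \<not> (\<exists>u p. awalk u p (T i 0) \<and> u \<in> H \<and> set (awalk_verts u p) \<inter> F = {})}
        \<union> {i. range (T i) \<inter> F \<noteq> {}}"
      have "finite I0" unfolding I0_def using hub_start[OF F] touched[OF F] by simp
      then have "finite (\<Union>i\<in>I0. {n \<in> J. fst (x n) = i})" using False by simp
      then have "infinite (J - (\<Union>i\<in>I0. {n \<in> J. fst (x n) = i}))" using \<open>infinite J\<close> by simp
      then obtain n where n: "n \<in> J" "fst (x n) \<notin> I0" using infinite_imp_nonempty by blast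
      define i where "i = fst (x n)"
      have i: "range (T i) \<inter> F = {}" "\<exists>u p. awalk u p (T i 0) \<and> u \<in> H \<and> set (awalk_verts u p) \<inter> F = {}"
        using n(2) unfolding I0_def i_def by blast+
      obtain u p where p: "awalk u p (T i 0)" "u \<in> H" "set (awalk_verts u p) \<inter> F = {}" using i(2) by blast
      note sg = line_segment[OF le0, of i "snd (x n)"]
      show ?thesis
      proof (rule linked_extend[OF p(1,3) sg(1)])
        show "set (awalk_verts (T i 0) (map (Te i) [0..<snd (x n)])) \<inter> F = {}" unfolding sg(2) using i(1) by blast
        show "T i (snd (x n)) \<in> range f" using fx[OF n(1)] unfolding i_def by (metis rangeI)
      qed (rule p(2))
    qed
  qed
qed

end

text \<open>Line \<open>n\<close> is the tail of \<open>R n\<close> from position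
  \<open>\<sigma> n\<close> on. Its start is reached from \<open>R 0\<close> by a walk with vertex
  set \<open>V n\<close>; these walks are disjoint, whence \<open>hub_start\<close>. Tails are
  needed because infinitely many of the given rays may share a vertex.\<close>

lemma (in wf_digraph) obtain_line_system:
  fixes R :: "nat \<Rightarrow> ('a, 'b) iray"
  assumes rays: "\<And>i. is_ray G (R i)"
    and disj: "\<And>i j. i \<noteq> j \<Longrightarrow> ray_arcs (R i) \<inter> ray_arcs (R j) = {}"
    and nr: "\<And>i j. near (ray_verts (R i)) (ray_verts (R j))"
  obtains T Te where "line_system G T Te (ray_verts (R 0))"
proof -
  define f where "f i = fst (R i)" for i
  define g where "g i = snd (R i)" for i
  have R: "inj (f i)" "g i n \<in> arcs G" "tail G (g i n) = f i n" "head G (g i n) = f i (Suc n)" for i n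
    using rays[of i] unfolding is_ray_def f_def g_def by auto
  have rv: "ray_verts (R i) = range (f i)" for i unfolding ray_verts_def f_def ..
  define ok where "ok n x \<longleftrightarrow> finite (fst x) \<and> (\<exists>u p. awalk u p (f n (snd (snd x))) \<and> u \<in> range (f 0) \<and>
      set (awalk_verts u p) = fst (snd x)) \<and> fst (snd x) \<subseteq> fst x \<and> (\<forall>j\<le>n. f j ` {..n} \<subseteq> fst x)"
    for n and x :: "'a set \<times> 'a set \<times> nat"
  define nxt where "nxt n x y \<longleftrightarrow> fst x \<subseteq> fst y \<and> fst (snd y) \<inter> fst x = {} \<and>
      (\<forall>q\<ge>snd (snd y). f (Suc n) q \<notin> fst x)"
    for n and x y :: "'a set \<times> 'a set \<times> nat"
  have "\<exists>x. \<forall>n. ok n (x n) \<and> nxt n (x n) (x (Suc n))"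
  proof (rule dependent_nat_choice)
    have "awalk (f 0 0) [] (f 0 0)" using R(2)[of 0 0] R(3)[of 0 0] wellformed(1)[of "g 0 0"] by (simp add: awalk_Nil_iff)
    then show "\<exists>x. ok 0 x" unfolding ok_def
      by (intro exI[of _ "({f 0 0}, {f 0 0}, 0)"]) (auto intro!: exI[of _ "f 0 0"] exI[of _ "[]"])
  next
    fix x n assume x: "ok n x"
    define W where "W = fst x"
    have W: "finite W" using x unfolding ok_def W_def by simp
    obtain N where N: "\<And>q. q \<ge> N \<Longrightarrow> f (Suc n) q \<notin> W" using inj_avoids[OF R(1) W] by blast
    have fin: "finite (W \<union> f (Suc n) ` {..N})" using W by simp
    obtain u p v where p: "awalk u p v" "u \<in> range (f 0)" "v \<in> range (f (Suc n))"
      "set (awalk_verts u p) \<inter> (W \<union> f (Suc n) ` {..N}) = {}"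
      by (rule nearE[OF nr[of 0 "Suc n", unfolded rv] fin])
    obtain c where c: "v = f (Suc n) c" using p(3) by blast
    have "v \<notin> f (Suc n) ` {..N}" using last_in_awalk_verts[OF p(1)] p(4) by blast
    then have cN: "N \<le> c" using c by (meson atMost_iff imageI linear)
    define y where "y = (W \<union> set (awalk_verts u p) \<union> (\<Union>j\<le>Suc n. f j ` {..Suc n}), set (awalk_verts u p), c)"
    have "ok (Suc n) y" unfolding ok_def y_def using W p c by auto
    moreover have "nxt n x y" unfolding nxt_def y_def using p(4) N cN W_def by auto
    ultimately show "\<exists>y. ok (Suc n) y \<and> nxt n x y" by blast
  qed
  then obtain x where x: "\<forall>n. ok n (x n) \<and> nxt n (x n) (x (Suc n))" by (elim exE)
  define W where "W n = fst (x n)" for n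
  define V where "V n = fst (snd (x n))" for n
  define \<sigma> where "\<sigma> n = snd (snd (x n))" for n
  have 1: "\<exists>u p. awalk u p (f n (\<sigma> n)) \<and> u \<in> range (f 0) \<and> set (awalk_verts u p) = V n"
    "V n \<subseteq> W n" "j \<le> n \<Longrightarrow> f j ` {..n} \<subseteq> W n" for n j
    using x unfolding ok_def W_def V_def \<sigma>_def by simp_all
  have 2: "W n \<subseteq> W (Suc n)" "V (Suc n) \<inter> W n = {}" "q \<ge> \<sigma> (Suc n) \<Longrightarrow> f (Suc n) q \<notin> W n" for n q
    using x unfolding nxt_def W_def V_def \<sigma>_def by simp_all
  have Wm: "W m \<subseteq> W n" if "m \<le> n" for m n using lift_Suc_mono_le[of W, OF 2(1) that] .
  have Vlt: "V m \<inter> V n = {}" if "m < n" for m n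
  proof -
    from that obtain l where l: "n = Suc l" "m \<le> l" by (cases n) auto
    then show ?thesis using 1(2)[of m] Wm[of m l] 2(2)[of l] by blast
  qed
  have Vd: "V m \<inter> V n = {}" if "m \<noteq> n" for m n using Vlt[of m n] Vlt[of n m] that by (cases "m < n") auto
  define T where "T i n = f i (n + \<sigma> i)" for i n
  define Te where "Te i n = g i (n + \<sigma> i)" for i n
  have inT: "v \<in> range (T i)" if "v \<in> range (f i)" "v \<notin> f i ` {..\<sigma> i}" for v i
  proof -
    from that(1) obtain q where q: "v = f i q" by blast
    then have "\<sigma> i \<le> q" using that(2) by (meson atMost_iff imageI linear)
    then have "v = T i (q - \<sigma> i)" unfolding T_def q by simp
    then show ?thesis by blast
  qed
  have Tsub: "range (T i) \<subseteq> range (f i)" for i unfolding T_def by blast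
  have nearT: "near A (range (T i))" if A: "near A (range (f i))" for A i
    unfolding near_def
  proof (intro allI impI)
    fix F :: "'a set" assume "finite F"
    then have fin: "finite (F \<union> f i ` {..\<sigma> i})" by simp
    obtain u p v where p: "awalk u p v" "u \<in> A" "v \<in> range (f i)" "set (awalk_verts u p) \<inter> (F \<union> f i ` {..\<sigma> i}) = {}"
      by (rule nearE[OF A fin])
    have "v \<in> range (T i)" using inT p(3,4) last_in_awalk_verts[OF p(1)] by blast
    then show "linked F {} A (range (T i))" unfolding linked_def using p by blast
  qed
  have nearT': "near (range (T i)) A" if A: "near (range (f i)) A" for A i
    unfolding near_def
  proof (intro allI impI)
    fix F :: "'a set" assume "finite F"
    then have fin: "finite (F \<union> f i ` {..\<sigma> i})" by simp
    obtain u p v where p: "awalk u p v" "u \<in> range (f i)" "v \<in> A" "set (awalk_verts u p) \<inter> (F \<union> f i ` {..\<sigma> i}) = {}"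
      by (rule nearE[OF A fin])
    have "u \<in> range (T i)" using inT p(2,4) hd_in_awalk_verts(1)[OF p(1)] by blast
    then show "linked F {} (range (T i)) A" unfolding linked_def using p by blast
  qed
  have "line_system G T Te (ray_verts (R 0))"
  proof unfold_locales
    show "Te i n \<in> arcs G \<and> tail G (Te i n) = T i n \<and> head G (Te i n) = T i (Suc n)" for i n
      unfolding T_def Te_def using R by simp
    show inj: "inj (T i)" for i
    proof (rule injI)
      fix m n assume "T i m = T i n"
      then have "m + \<sigma> i = n + \<sigma> i" unfolding T_def by (rule injD[OF R(1)])
      then show "m = n" by simp
    qed
    show "i = j \<and> n = m" if e: "Te i n = Te j m" for i n j m
    proof -
      have "Te i n \<in> ray_arcs (R i)" "Te j m \<in> ray_arcs (R j)" unfolding Te_def g_def ray_arcs_def by simp_all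
      then have "i = j" using disj[of i j] e by auto
      moreover have "f i (n + \<sigma> i) = f i (m + \<sigma> i)" using e \<open>i = j\<close> R(3) unfolding Te_def by metis
      ultimately show ?thesis using injD[OF R(1)[of i]] by fastforce
    qed
    show "finite {i. z \<in> range (T i)}" for z
    proof (cases "\<exists>j. z \<in> range (T j)")
      case True
      then obtain j where "z \<in> range (T j)" by blast
      then have "z \<in> range (f j)" using Tsub by blast
      then obtain q where q: "z = f j q" by blast
      \<comment> \<open>The set \<open>W l\<close> contains the first vertices of the first rays, in
        particular \<open>f j q\<close> once \<open>l\<close> is at least \<open>j\<close> and
        \<open>q\<close>; line \<open>l + 1\<close> avoids \<open>W l\<close>.\<close>
      have "i \<le> max j q" if "z \<in> range (T i)" for i
      proof (rule ccontr)
        assume "\<not> i \<le> max j q"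
        then obtain l where l: "i = Suc l" "j \<le> l" "q \<le> l" by (cases i) auto
        have "z \<in> W l" using 1(3)[of j l] l q by auto
        moreover from that l(1) obtain r where "z = f (Suc l) (r + \<sigma> (Suc l))" unfolding T_def by blast
        ultimately show False using 2(3)[of l "r + \<sigma> (Suc l)"] by simp
      qed
      then have "{i. z \<in> range (T i)} \<subseteq> {..max j q}" by blast
      then show ?thesis by (rule finite_subset) simp
    qed simp
    have nrf: "near (range (f i)) (range (f j))" for i j using nr[of i j] unfolding rv .
    show "near (range (T i)) (range (T j))" for i j using nearT[OF nearT'[OF nrf]] .
    show "near (range (T i)) (ray_verts (R 0))" for i unfolding rv using nearT'[OF nrf] .
    show "near (ray_verts (R 0)) (range (T i))" for i unfolding rv using nearT[OF nrf] .
    show "finite {i. \<not> (\<exists>u p. awalk u p (T i 0) \<and> u \<in> ray_verts (R 0) \<and> set (awalk_verts u p) \<inter> F = {})}"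
      if F: "finite F" for F
    proof (rule finite_subset)
      show "finite {i. V i \<inter> F \<noteq> {}}" by (rule finite_disjoint_hits[OF Vd F])
      show "{i. \<not> (\<exists>u p. awalk u p (T i 0) \<and> u \<in> ray_verts (R 0) \<and> set (awalk_verts u p) \<inter> F = {})}
        \<subseteq> {i. V i \<inter> F \<noteq> {}}"
      proof
        fix i assume i: "i \<in> {i. \<not> (\<exists>u p. awalk u p (T i 0) \<and> u \<in> ray_verts (R 0) \<and> set (awalk_verts u p) \<inter> F = {})}"
        obtain u p where p: "awalk u p (f i (\<sigma> i))" "u \<in> range (f 0)" "set (awalk_verts u p) = V i"
          using 1(1)[of i] by blast
        have "T i 0 = f i (\<sigma> i)" unfolding T_def by simp
        then show "i \<in> {i. V i \<inter> F \<noteq> {}}" using i p unfolding rv mem_Collect_eq by metis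
      qed
    qed
  qed
  then show thesis by (rule that)
qed

lemma concat_schedule:
  fixes l :: "nat \<Rightarrow> 'x list"
  assumes ne: "\<And>m. l m \<noteq> []"
  obtains s :: "nat \<Rightarrow> 'x" and st idx :: "nat \<Rightarrow> nat" where
    "\<And>m. st (Suc m) = st m + length (l m)" "\<And>m i. i < length (l m) \<Longrightarrow> s (st m + i) = l m ! i"
    "\<And>m n. st m \<le> n \<Longrightarrow> n < st (Suc m) \<Longrightarrow> idx n = m" "\<And>n. st (idx n) \<le> n" "\<And>n. n < st (Suc (idx n))"
    "mono idx"
proof -
  define st where "st m = (\<Sum>j<m. length (l j))" for m
  have S: "st (Suc m) = st m + length (l m)" for m unfolding st_def by simp
  have lt: "st m < st (Suc m)" for m using ne[of m] unfolding S by simp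
  have mono: "m \<le> n \<Longrightarrow> st m \<le> st n" for m n using lift_Suc_mono_le[of st m n] lt less_imp_le by blast
  have ge: "m \<le> st m" for m
  proof (induction m)
    case (Suc m) then show ?case using lt[of m] by simp
  qed simp
  define idx where "idx n = (LEAST m. n < st (Suc m))" for n
  have i1: "n < st (Suc (idx n))" for n unfolding idx_def
    by (rule LeastI[of _ n]) (use ge[of "Suc n"] in simp)
  have i2: "st (idx n) \<le> n" for n
  proof (cases "idx n")
    case 0 then show ?thesis by (simp add: st_def)
  next
    case (Suc m)
    then have "\<not> n < st (Suc m)" using not_less_Least[of m "\<lambda>m. n < st (Suc m)"] unfolding idx_def by simp
    then show ?thesis using Suc by simp
  qed
  have i3: "idx n = m" if "st m \<le> n" "n < st (Suc m)" for m n
  proof (rule ccontr)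
    assume "idx n \<noteq> m"
    then consider "Suc (idx n) \<le> m" | "Suc m \<le> idx n" by linarith
    then show False using mono[of "Suc (idx n)" m] mono[of "Suc m" "idx n"] i1[of n] i2[of n] that
      by cases linarith+
  qed
  have mi: "mono idx"
  proof (rule monoI)
    fix m n :: nat assume "m \<le> n"
    show "idx m \<le> idx n"
    proof (rule ccontr)
      assume "\<not> idx m \<le> idx n"
      then show False using mono[of "Suc (idx n)" "idx m"] i1[of n] i2[of m] \<open>m \<le> n\<close> by linarith
    qed
  qed
  define s where "s n = l (idx n) ! (n - st (idx n))" for n
  have "s (st m + i) = l m ! i" if "i < length (l m)" for m i
  proof -
    have "idx (st m + i) = m" using that by (intro i3) (simp_all add: S)
    then show ?thesis unfolding s_def by simp
  qed
  then show thesis using that[of st s idx] S i1 i2 i3 mi by blast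
qed

lemma routed_sym:
  assumes "sym R" "routed R S p q"
  shows "routed R S q p"
proof -
  obtain y z where yz: "(p, y) \<in> R" "y \<notin> S" "z \<notin> S"
    "(y, z) \<in> {(x, x'). (x, x') \<in> R \<and> x \<notin> S \<and> x' \<notin> S}\<^sup>*" "(z, q) \<in> R"
    using assms(2) unfolding routed_def by (elim exE conjE)
  have "sym {(x, x'). (x, x') \<in> R \<and> x \<notin> S \<and> x' \<notin> S}"
    using symD[OF assms(1)] by (intro symI) simp
  then have "(z, y) \<in> {(x, x'). (x, x') \<in> R \<and> x \<notin> S \<and> x' \<notin> S}\<^sup>*"
    using symD[OF sym_rtrancl yz(4)] by simp
  then show ?thesis
    unfolding routed_def using yz symD[OF assms(1)] by (intro exI[of _ z] exI[of _ y] conjI) simp_all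
qed

section \<open>All messages in one schedule\<close>

context line_system begin

lemma message_program:
  assumes "a (Suc m) \<le> \<kappa>" "strict_mono a"
    and "\<And>i. i \<le> m \<Longrightarrow> routed (reach \<kappa> \<union> (reach \<kappa>)\<inverse>) (a ` {..Suc m}) (a i) (a (Suc i))"
    and "\<exists>i\<le>m. p = i \<and> q = Suc i \<or> p = Suc i \<and> q = i"
  shows "\<exists>l. l \<noteq> [] \<and> set l \<subseteq> reach \<kappa> \<and> (\<forall>s n. occurs l s n \<longrightarrow>
    (\<exists>X w. passes s {..\<kappa>} (a ` {..Suc m}) (a p) (a q) n (n + length l) X w))"
proof -
  interpret pebbles "reach \<kappa>" "{..\<kappa>}"
    by unfold_locales (use reach_subset reach_irrefl reach_strong in auto)
  obtain i where i: "i \<le> m" "p = i \<and> q = Suc i \<or> p = Suc i \<and> q = i" using assms(4) by blast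
  have sy: "sym (reach \<kappa> \<union> (reach \<kappa>)\<inverse>)" by (rule symI) auto
  have "routed (reach \<kappa> \<union> (reach \<kappa>)\<inverse>) (a ` {..Suc m}) (a p) (a q)"
    using assms(3)[OF i(1)] routed_sym[OF sy assms(3)[OF i(1)]] i(2) by metis
  then obtain y z where yz: "(a p, y) \<in> reach \<kappa> \<union> (reach \<kappa>)\<inverse>" "y \<notin> a ` {..Suc m}" "z \<notin> a ` {..Suc m}"
    "(y, z) \<in> {(x, x'). (x, x') \<in> reach \<kappa> \<union> (reach \<kappa>)\<inverse> \<and> x \<notin> a ` {..Suc m} \<and> x' \<notin> a ` {..Suc m}}\<^sup>*"
    "(z, a q) \<in> reach \<kappa> \<union> (reach \<kappa>)\<inverse>"
    unfolding routed_def by (elim exE conjE)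
  have le: "a j \<le> \<kappa>" if "j \<le> Suc m" for j
    using assms(1) strict_mono_less_eq[OF assms(2), of j "Suc m"] that by simp
  have "a ` {..Suc m} \<subseteq> {..\<kappa>}" using le by auto
  moreover have "a p \<in> a ` {..Suc m}" "a q \<in> a ` {..Suc m}" using i by auto
  moreover have "a p \<noteq> a q" using i(2) strict_mono_eq[OF assms(2)] by auto
  ultimately have "\<exists>l. set l \<subseteq> reach \<kappa> \<and> (\<forall>s n. occurs l s n \<longrightarrow>
    (\<exists>X w. passes s {..\<kappa>} (a ` {..Suc m}) (a p) (a q) n (n + length l) X w))"
    by (rule message[OF _ _ _ _ yz])
  then obtain l where l: "set l \<subseteq> reach \<kappa>" "\<forall>s n. occurs l s n \<longrightarrow>
    (\<exists>X w. passes s {..\<kappa>} (a ` {..Suc m}) (a p) (a q) n (n + length l) X w)"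
    by (elim exE conjE)
  \<comment> \<open>Testing the program on a schedule that begins with it: \<open>passes\<close>
    needs two different times, so the program is not empty, as the concatenation requires.\<close>
  have "occurs l (\<lambda>i. l ! i) 0" unfolding occurs_def by simp
  from l(2)[rule_format, OF this] have "l \<noteq> []" unfolding passes_def by auto
  then show ?thesis using l by blast
qed

text \<open>Operation \<open>m\<close> sends a message from row \<open>p m\<close> to row
  \<open>q m\<close>. It sees only the rows up to \<open>m + 1\<close>, whose lines lie below
  \<open>\<kappa> m\<close>; new rows join one at a time. \<open>bd m r\<close> is the place of row
  \<open>r\<close> when operation \<open>m\<close> begins.\<close>

lemma weave:
  fixes p q :: "nat \<Rightarrow> nat"
  assumes pq: "\<And>m. \<exists>i\<le>m. p m = i \<and> q m = Suc i \<or> p m = Suc i \<and> q m = i"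
  obtains bd X :: "nat \<Rightarrow> nat \<Rightarrow> 'a" and W :: "nat \<Rightarrow> key \<Rightarrow> 'b list" where
    "\<And>m r. r \<le> Suc m \<Longrightarrow> awalk (bd m r) (W m (Fore r)) (X m r)"
    "\<And>m r. r \<le> Suc m \<Longrightarrow> awalk (X m r) (W m (Aft r)) (bd (Suc m) r)"
    "\<And>m. awalk (X m (p m)) (W m Msg) (X m (q m))"
    "\<And>m m' k k' c. c \<in> set (W m k) \<Longrightarrow> c \<in> set (W m' k') \<Longrightarrow> m = m' \<and> k = k'"
    "\<And>m m' r r'. r \<in> {p m, q m} \<Longrightarrow> r' \<in> {p m', q m'} \<Longrightarrow> X m r = X m' r' \<Longrightarrow> m = m' \<and> r = r'"
    "\<And>Q. is_ray G Q \<Longrightarrow> ray_arcs Q \<subseteq> (\<Union>m k. set (W m k)) \<Longrightarrow>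
      near (ray_verts Q) H \<and> near H (ray_verts Q)"
    "\<And>z. finite {c \<in> (\<Union>m k. set (W m k)). tail G c = z}"
proof -
  have sy: "sym (reach k \<union> (reach k)\<inverse>)" for k by (rule symI) auto
  have cn: "(x, y) \<in> (reach k \<union> (reach k)\<inverse>)\<^sup>*" if "x \<le> k" "y \<le> k" for k x y
    using rtrancl_mono[of "reach k" "reach k \<union> (reach k)\<inverse>"] reach_strong[OF that] by blast
  obtain a \<kappa> where a: "strict_mono a" "mono \<kappa>" "\<And>m. a (Suc m) \<le> \<kappa> m"
    "\<And>m i. i \<le> m \<Longrightarrow> routed (reach (\<kappa> m) \<union> (reach (\<kappa> m))\<inverse>) (a ` {..Suc m}) (a i) (a (Suc i))"
    using row_selection[of "\<lambda>k. reach k \<union> (reach k)\<inverse>", OF sy cn] by blast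
  have "\<forall>m. \<exists>l. l \<noteq> [] \<and> set l \<subseteq> reach (\<kappa> m) \<and> (\<forall>s n. occurs l s n \<longrightarrow>
    (\<exists>X w. passes s {..\<kappa> m} (a ` {..Suc m}) (a (p m)) (a (q m)) n (n + length l) X w))"
    by (intro allI message_program[OF a(3) a(1) a(4) pq])
  from choice[OF this] obtain l where l: "\<forall>m. l m \<noteq> [] \<and> set (l m) \<subseteq> reach (\<kappa> m) \<and> (\<forall>s n. occurs (l m) s n \<longrightarrow>
    (\<exists>X w. passes s {..\<kappa> m} (a ` {..Suc m}) (a (p m)) (a (q m)) n (n + length (l m)) X w))"
    by (elim exE)
  then have l1: "l m \<noteq> []" for m by simp
  obtain s :: "nat \<Rightarrow> nat \<times> nat" and st idx where st: "\<And>m. st (Suc m) = st m + length (l m)"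
    "\<And>m i. i < length (l m) \<Longrightarrow> s (st m + i) = l m ! i"
    "\<And>m n. st m \<le> n \<Longrightarrow> n < st (Suc m) \<Longrightarrow> idx n = m" "\<And>n. st (idx n) \<le> n" "\<And>n. n < st (Suc (idx n))"
    "mono idx"
    by (rule concat_schedule[of l, OF l1], rule that, assumption+)
  \<comment> \<open>The bound on the lines is constant during an operation, so all segments used by
    it are \<open>valid\<close>.\<close>
  define K where "K n = \<kappa> (idx n)" for n
  have sK: "s n \<in> reach (K n)" for n
  proof -
    have i: "n - st (idx n) < length (l (idx n))" using st(1)[of "idx n"] st(4)[of n] st(5)[of n] by simp
    have "s n = l (idx n) ! (n - st (idx n))" using st(2)[OF i] st(4)[of n] by simp
    then have "s n \<in> set (l (idx n))" using i by simp
    then show ?thesis using l unfolding K_def by blast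
  qed
  obtain pos P VP where r: 
    "\<And>n i. pos n i < pos (Suc n) i"
    "\<And>n. awalk (T (fst (s n)) (pos n (fst (s n)))) (P n) (T (snd (s n)) (pos n (snd (s n))))"
    "\<And>n. VP n = set (awalk_verts (T (fst (s n)) (pos n (fst (s n)))) (P n))"
    "\<And>m n. m \<noteq> n \<Longrightarrow> VP m \<inter> VP n = {}"
    "\<And>n. set (P n) \<inter> linearcs (K n) = {}"
    "\<And>m n i r. m < n \<Longrightarrow> pos n i \<le> r \<Longrightarrow> T i r \<notin> VP m"
    using realize_schedule[of s K, OF sK] by blast
  have "mono K" unfolding K_def using a(2) st(6) by (auto simp: mono_def)
  then interpret realization G T Te H s K pos P VP
    by unfold_locales (use r in auto)
  have "\<forall>m. \<exists>Xw. passes s {..\<kappa> m} (a ` {..Suc m}) (a (p m)) (a (q m)) (st m) (st (Suc m)) (fst Xw) (snd Xw)"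
  proof
    fix m
    have "occurs (l m) s (st m)" unfolding occurs_def using st(2) by simp
    then show "\<exists>Xw. passes s {..\<kappa> m} (a ` {..Suc m}) (a (p m)) (a (q m)) (st m) (st (Suc m)) (fst Xw) (snd Xw)"
      using l unfolding st(1) by simp
  qed
  from choice[OF this] obtain Xw where Xw: 
    "\<forall>m. passes s {..\<kappa> m} (a ` {..Suc m}) (a (p m)) (a (q m)) (st m) (st (Suc m)) (fst (Xw m)) (snd (Xw m))"
    by (elim exE)
  define X' where "X' m = fst (Xw m)" for m
  define w where "w m = snd (Xw m)" for m
  have ps: "passes s {..\<kappa> m} (a ` {..Suc m}) (a (p m)) (a (q m)) (st m) (st (Suc m)) (X' m) (w m)" for m
    using Xw unfolding X'_def w_def by simp
  have fm: "window {..\<kappa> m} (st m) (st (Suc m)) (w m)" for m using ps[of m] unfolding passes_def by simp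
  have wk: "twalk s (a r, st m) (w m (Fore (a r))) (X' m (a r))"
    "twalk s (X' m (a r)) (w m (Aft (a r))) (a r, st (Suc m))" if "r \<le> Suc m" for m r
    using ps[of m] that unfolding passes_def by simp_all
  have wm: "twalk s (X' m (a (p m))) (w m Msg) (X' m (a (q m)))" for m using ps[of m] unfolding passes_def by simp
  have "\<forall>m. \<exists>x. st m \<le> fst x \<and> fst x < snd x \<and> snd x < st (Suc m) \<and>
      X' m (a (p m)) = (fst (s (fst x)), fst x) \<and> X' m (a (q m)) = (snd (s (snd x)), snd x)"
    using ps unfolding passes_def by simp
  from choice[OF this] obtain t where t: "\<forall>m. st m \<le> fst (t m) \<and> fst (t m) < snd (t m) \<and> snd (t m) < st (Suc m) \<and>
      X' m (a (p m)) = (fst (s (fst (t m))), fst (t m)) \<and> X' m (a (q m)) = (snd (s (snd (t m))), snd (t m))"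
    by (elim exE)
  define mk where "mk k = (case k of Fore r \<Rightarrow> Fore (a r) | Aft r \<Rightarrow> Aft (a r) | Msg \<Rightarrow> Msg)" for k
  have mk_inj: "k = k'" if "mk k = mk k'" for k k'
    using that strict_mono_eq[OF a(1)] unfolding mk_def by (cases k; cases k'; simp)
  define W where "W m k = concat (map seg (w m (mk k)))" for m k
  define X where "X m r = point (X' m (a r))" for m r
  define bd where "bd m r = point (a r, st m)" for m r
  have W_mem: "\<exists>e. e \<in> set (w m (mk k)) \<and> c \<in> set (seg e) \<and> valid e \<and> idx (arc_time e) = m" if "c \<in> set (W m k)" for c m k
  proof -
    from that obtain e where e: "e \<in> set (w m (mk k))" "c \<in> set (seg e)" unfolding W_def by auto
    have im: "idx (arc_time e) = m" using st(3) window_le[OF fm e(1)] window_less[OF fm e(1)] by simp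
    have "valid e"
    proof (cases e)
      case (Hor i n)
      moreover have "K n = \<kappa> m" using im Hor K_def by simp
      ultimately show ?thesis using window_line[OF fm e(1) Hor] by simp
    qed simp
    then show ?thesis using e im by blast
  qed
  have WU: "(\<Union>m k. set (W m k)) \<subseteq> used"
  proof
    fix c assume "c \<in> (\<Union>m k. set (W m k))"
    then obtain m k where "c \<in> set (W m k)" by blast
    from W_mem[OF this] show "c \<in> used" unfolding used_def by blast
  qed
  have XV: "X m (p m) \<in> VP (fst (t m))" "X m (q m) \<in> VP (snd (t m))" for m
  proof -
    have "X m (p m) = T (fst (s (fst (t m)))) (pos (fst (t m)) (fst (s (fst (t m)))))"
      using t unfolding X_def by simp
    then show "X m (p m) \<in> VP (fst (t m))" unfolding VP using hd_in_awalk_verts(1)[OF P_walk] by simp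
    have "X m (q m) = T (snd (s (snd (t m)))) (pos (snd (t m)) (snd (s (snd (t m)))))"
      using t unfolding X_def by simp
    then show "X m (q m) \<in> VP (snd (t m))" unfolding VP using last_in_awalk_verts[OF P_walk] by simp
  qed
  have tm: "idx (fst (t m)) = m" "idx (snd (t m)) = m" "fst (t m) \<noteq> snd (t m)" for m
    using st(3)[of m "fst (t m)"] st(3)[of m "snd (t m)"] t[rule_format, of m] by simp_all
  show thesis
  proof (rule that[of bd W X])
    show "awalk (bd m r) (W m (Fore r)) (X m r)" if "r \<le> Suc m" for m r
      using seg_walk[OF wk(1)[OF that]] unfolding bd_def W_def X_def mk_def by simp
    show "awalk (X m r) (W m (Aft r)) (bd (Suc m) r)" if "r \<le> Suc m" for m r
      using seg_walk[OF wk(2)[OF that]] unfolding bd_def W_def X_def mk_def by simp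
    show "awalk (X m (p m)) (W m Msg) (X m (q m))" for m
      using seg_walk[OF wm] unfolding W_def X_def mk_def by simp
    show "m = m' \<and> k = k'" if c: "c \<in> set (W m k)" "c \<in> set (W m' k')" for m m' k k' c
    proof -
      obtain e where e: "e \<in> set (w m (mk k))" "c \<in> set (seg e)" "valid e" "idx (arc_time e) = m"
        using W_mem[OF c(1)] by blast
      obtain e' where e': "e' \<in> set (w m' (mk k'))" "c \<in> set (seg e')" "valid e'" "idx (arc_time e') = m'"
        using W_mem[OF c(2)] by blast
      have "e = e'" using seg_disjoint[OF e(3) e'(3) e(2) e'(2)] .
      then have "m = m'" using e(4) e'(4) by simp
      then have "mk k = mk k'" using window_unique[OF fm e(1)] e'(1) \<open>e = e'\<close> by blast
      then show ?thesis using mk_inj \<open>m = m'\<close> by blast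
    qed
    show "m = m' \<and> r = r'" if r: "r \<in> {p m, q m}" "r' \<in> {p m', q m'}" "X m r = X m' r'" for m m' r r'
    proof -
      have *: "n = n'" if "X m r \<in> VP n" "X m r \<in> VP n'" for n n' using VP_disjoint[of n n'] that by blast
      consider "r = p m" "r' = p m'" | "r = p m" "r' = q m'" | "r = q m" "r' = p m'" | "r = q m" "r' = q m'"
        using r(1,2) by blast
      then show ?thesis
      proof cases
        case 1
        then have "fst (t m) = fst (t m')" using *[of "fst (t m)" "fst (t m')"] XV(1)[of m] XV(1)[of m'] r(3) by simp
        then have "m = m'" using tm(1) by metis
        then show ?thesis using 1 by simp
      next
        case 2
        then have "fst (t m) = snd (t m')" using *[of "fst (t m)" "snd (t m')"] XV(1)[of m] XV(2)[of m'] r(3) by simp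
        then have "m = m'" using tm(1,2) by metis
        then show ?thesis using tm(3)[of m] \<open>fst (t m) = snd (t m')\<close> by simp
      next
        case 3
        then have "snd (t m) = fst (t m')" using *[of "snd (t m)" "fst (t m')"] XV(2)[of m] XV(1)[of m'] r(3) by simp
        then have "m = m'" using tm(1,2) by metis
        then show ?thesis using tm(3)[of m] \<open>snd (t m) = fst (t m')\<close> by simp
      next
        case 4
        then have "snd (t m) = snd (t m')" using *[of "snd (t m)" "snd (t m')"] XV(2)[of m] XV(2)[of m'] r(3) by simp
        then have "m = m'" using tm(2) by metis
        then show ?thesis using 4 by simp
      qed
    qed
    show "near (ray_verts Q) H \<and> near H (ray_verts Q)" if "is_ray G Q" "ray_arcs Q \<subseteq> (\<Union>m k. set (W m k))" for Q
      using ray_in_used[OF that(1) subset_trans[OF that(2) WU]] by simp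
    show "finite {c \<in> (\<Union>m k. set (W m k)). tail G c = z}" for z
      by (rule finite_subset[OF _ used_locally_finite[of z]]) (use WU in blast)
  qed
qed

end

section \<open>The quarter-grid\<close>

text \<open>The concatenated paths may repeat vertices. As each vertex is left only finitely often,
  the ray is obtained by always continuing from the last departure from the current vertex.\<close>

lemma (in wf_digraph) ray_from_apaths:
  fixes v :: "nat \<Rightarrow> 'a" and p :: "nat \<Rightarrow> 'b list"
  assumes path: "\<And>n. apath (v n) (p n) (v (Suc n))" and v: "inj v"
    and disj: "\<And>m n. m \<noteq> n \<Longrightarrow> set (p m) \<inter> set (p n) = {}"
    and fin: "\<And>z. finite {c \<in> (\<Union>n. set (p n)). tail G c = z}"
  obtains Q where "is_ray G Q" "ray_arcs Q \<subseteq> (\<Union>n. set (p n))"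
proof -
  define Tl where "Tl n = tail G ` set (p n)" for n
  have aw: "awalk (v n) (p n) (v (Suc n))" for n using path by (rule awalkI_apath)
  have ne: "p n \<noteq> []" for n
  proof
    assume "p n = []"
    then have "v n = v (Suc n)" using aw[of n] by (simp add: awalk_Nil_iff)
    then show False using injD[OF v] by fastforce
  qed
  have first: "v n \<in> Tl n" for n using aw[of n] ne[of n] unfolding Tl_def by (cases "p n") (auto simp: awalk_Cons_iff)
  have dist: "distinct (map (tail G) (p n))" for n
    using path[of n] ne[of n] unfolding apath_def by (auto simp: awalk_verts_conv)
  have nxt: "head G (p n ! k) = (if Suc k < length (p n) then tail G (p n ! Suc k) else v (Suc n))"
    if "k < length (p n)" for n k
  proof -
    have "p n = take k (p n) @ p n ! k # drop (Suc k) (p n)" using that by (rule id_take_nth_drop)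
    moreover obtain x where "awalk x (p n ! k # drop (Suc k) (p n)) (v (Suc n))"
      using aw[of n] calculation awalk_append_iff[of "v n" "take k (p n)" "p n ! k # drop (Suc k) (p n)"] by metis
    ultimately have w: "awalk (head G (p n ! k)) (drop (Suc k) (p n)) (v (Suc n))" by (simp add: awalk_Cons_iff)
    show ?thesis
    proof (cases "Suc k < length (p n)")
      case True
      then have "drop (Suc k) (p n) = p n ! Suc k # drop (Suc (Suc k)) (p n)" by (rule Cons_nth_drop_Suc[symmetric])
      then show ?thesis using w True by (simp add: awalk_Cons_iff)
    next
      case False
      then show ?thesis using w by (simp add: awalk_Nil_iff)
    qed
  qed
  have fin_Tl: "finite {n. z \<in> Tl n}" for z
  proof -
    have "\<forall>n\<in>{n. z \<in> Tl n}. \<exists>c. c \<in> set (p n) \<and> tail G c = z" unfolding Tl_def by auto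
    then obtain c where c: "\<And>n. z \<in> Tl n \<Longrightarrow> c n \<in> set (p n) \<and> tail G (c n) = z" by (metis mem_Collect_eq)
    show ?thesis
    proof (rule finite_imageD)
      have "c ` {n. z \<in> Tl n} \<subseteq> {c \<in> (\<Union>n. set (p n)). tail G c = z}" using c by blast
      then show "finite (c ` {n. z \<in> Tl n})" using fin finite_subset by blast
      show "inj_on c {n. z \<in> Tl n}"
      proof (rule inj_onI)
        fix m n assume mn: "m \<in> {n. z \<in> Tl n}" "n \<in> {n. z \<in> Tl n}" "c m = c n"
        then have "c m \<in> set (p m) \<inter> set (p n)" using c[of m] c[of n] by simp
        then show "m = n" using disj[of m n] by blast
      qed
    qed
  qed
  have last: "\<exists>n k. m \<le> n \<and> k < length (p n) \<and> tail G (p n ! k) = z \<and> (\<forall>n'>n. z \<notin> Tl n')" if "z \<in> Tl m" for z m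
  proof -
    define n where "n = Max {n. z \<in> Tl n}"
    have "n \<in> {n. z \<in> Tl n}" unfolding n_def using fin_Tl that by (intro Max_in) auto
    then have "\<exists>k<length (p n). tail G (p n ! k) = z" unfolding Tl_def by (auto simp: in_set_conv_nth)
    moreover have "n' \<le> n" if "z \<in> Tl n'" for n' unfolding n_def using fin_Tl that by (intro Max_ge) auto
    ultimately show ?thesis using that by (metis leD)
  qed
  \<comment> \<open>The pair \<open>(n, k)\<close> stands for arc \<open>k\<close> of path
    \<open>n\<close>; it is admissible if no later path leaves its tail. Within one path the tails
    are distinct anyway.\<close>
  define ok where "ok x \<longleftrightarrow> snd x < length (p (fst x)) \<and> (\<forall>n'>fst x. tail G (p (fst x) ! snd x) \<notin> Tl n')" for x
  define lt where "lt x y \<longleftrightarrow> fst x < fst y \<or> fst x = fst y \<and> snd x < snd y" for x y :: "nat \<times> nat"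
  have "\<exists>x. \<forall>n::nat. ok (x n) \<and> (tail G (p (fst (x (Suc n))) ! snd (x (Suc n))) = head G (p (fst (x n)) ! snd (x n)) \<and> lt (x n) (x (Suc n)))"
  proof (rule dependent_nat_choice)
    obtain n k where "k < length (p n)" "tail G (p n ! k) = v 0" "\<forall>n'>n. v 0 \<notin> Tl n'" using last[OF first[of 0]] by blast
    then show "\<exists>x. ok x" unfolding ok_def by (intro exI[of _ "(n, k)"]) simp
  next
    fix x :: "nat \<times> nat" and j :: nat assume "ok x"
    obtain n k where x: "x = (n, k)" by (cases x)
    have k: "k < length (p n)" using \<open>ok x\<close> unfolding ok_def x by simp
    define z where "z = head G (p n ! k)"
    define m where "m = (if Suc k < length (p n) then n else Suc n)"
    have "z \<in> Tl m"
    proof (cases "Suc k < length (p n)")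
      case True
      then show ?thesis using nxt[OF k] unfolding z_def m_def Tl_def by simp
    next
      case False
      then show ?thesis using nxt[OF k] first[of "Suc n"] unfolding z_def m_def by simp
    qed
    from last[OF this] obtain n' k' where n': "m \<le> n'" "k' < length (p n')" "tail G (p n' ! k') = z" "\<forall>i>n'. z \<notin> Tl i"
      by blast
    have "lt x (n', k')"
    proof (cases "n < n'")
      case True
      then show ?thesis unfolding lt_def x by simp
    next
      case False
      then have eq: "n' = n" "Suc k < length (p n)" using n'(1) unfolding m_def by (auto split: if_splits)
      then have "map (tail G) (p n) ! k' = map (tail G) (p n) ! Suc k" using n'(2,3) nxt[OF k] unfolding z_def by simp
      then have "k' = Suc k" using nth_eq_iff_index_eq[OF dist, of k' n "Suc k"] n'(2) eq by simp
      then show ?thesis unfolding lt_def x using eq by simp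
    qed
    then show "\<exists>y. ok y \<and> tail G (p (fst y) ! snd y) = head G (p (fst x) ! snd x) \<and> lt x y"
      unfolding ok_def using n' by (intro exI[of _ "(n', k')"]) (simp add: x z_def)
  qed
  then obtain x where x: "\<forall>n. ok (x n) \<and> (tail G (p (fst (x (Suc n))) ! snd (x (Suc n))) = head G (p (fst (x n)) ! snd (x n)) \<and> lt (x n) (x (Suc n)))"
    by (elim exE)
  define e where "e n = p (fst (x n)) ! snd (x n)" for n
  have ltm: "lt (x i) (x j)" if "i < j" for i j
    using that
  proof (induction j)
    case (Suc j)
    have "lt (x j) (x (Suc j))" using x by simp
    then show ?case using Suc by (cases "i = j") (auto simp: lt_def)
  qed simp
  have em: "e n \<in> set (p (fst (x n)))" for n using x unfolding e_def ok_def by simp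
  have nle: "tail G (e i) \<noteq> tail G (e j)" if "i < j" for i j
  proof
    assume eq: "tail G (e i) = tail G (e j)"
    have "tail G (e i) \<in> Tl (fst (x j))" unfolding eq Tl_def using em by simp
    then have "\<not> fst (x i) < fst (x j)" using x unfolding ok_def e_def by blast
    then have f: "fst (x i) = fst (x j)" "snd (x i) < snd (x j)" using ltm[OF that] unfolding lt_def by simp_all
    have l: "snd (x i) < length (p (fst (x i)))" "snd (x j) < length (p (fst (x i)))"
      using x[rule_format, of i] x[rule_format, of j] f(1) unfolding ok_def by auto
    then have "map (tail G) (p (fst (x i))) ! snd (x i) = map (tail G) (p (fst (x i))) ! snd (x j)"
      using eq f(1) unfolding e_def by simp
    then show False using nth_eq_iff_index_eq[OF dist] l f(2) by simp
  qed
  define Q where "Q = ((\<lambda>n. tail G (e n)), e)"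
  have "inj (\<lambda>n. tail G (e n))"
  proof (rule injI)
    fix i j assume "tail G (e i) = tail G (e j)"
    then show "i = j" using nle[of i j] nle[of j i] by (cases i j rule: linorder_cases) simp_all
  qed
  moreover have "e n \<in> arcs G" for n using em[of n] aw[of "fst (x n)"] by blast
  moreover have "tail G (e (Suc n)) = head G (e n)" for n using x unfolding e_def by simp
  ultimately have "is_ray G Q" unfolding is_ray_def Q_def by (simp add: wellformed)
  moreover have "ray_arcs Q \<subseteq> (\<Union>n. set (p n))" unfolding ray_arcs_def Q_def using em by auto
  ultimately show thesis by (rule that)
qed

section \<open>Vertices and arcs that remain after suppression\<close>

lemma pregrid_simps: "verts pregrid = {(i, n). 1 \<le> i \<and> 1 \<le> n}" "tail pregrid = fst" "head pregrid = snd"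
  unfolding pregrid_def rel_digraph_def by simp_all

lemma pregrid_arcE:
  assumes "(u, v) \<in> arcs pregrid"
  obtains i n where "1 \<le> i" "1 \<le> n" "u = (i, n)" "v = (i, Suc n)"
    | i j where "1 \<le> i" "u = (i, 4 * j + 7)" "v = (i + 1, 4 * j + 1)"
    | i j where "1 \<le> i" "u = (i + 1, 4 * j + 2)" "v = (i, 4 * j + 8)"
  using assms unfolding pregrid_def rel_digraph_def by auto

lemma pregrid_row_arc: "1 \<le> i \<Longrightarrow> 1 \<le> n \<Longrightarrow> ((i, n), (i, Suc n)) \<in> arcs pregrid"
  unfolding pregrid_def rel_digraph_def by simp

text \<open>The ends of cross edges, and \<open>(1, 1)\<close>, which has no incoming edge. Row 1
  has no lower neighbour, so the residues 1 and 2 count from row 2 on.\<close>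

definition active :: "nat \<Rightarrow> nat \<Rightarrow> bool" where
  "active i n \<longleftrightarrow> (i = 1 \<and> n = 1) \<or> (\<exists>j. n = 4 * j + 7) \<or> (\<exists>j. n = 4 * j + 8) \<or>
     (2 \<le> i \<and> ((\<exists>j. n = 4 * j + 1) \<or> (\<exists>j. n = 4 * j + 2)))"

lemma inactive_suppressed:
  assumes "1 \<le> i" "1 \<le> n" "\<not> active i n"
  shows "(i, n) \<in> pregrid_suppressed"
proof -
  have n: "2 \<le> n"
  proof (rule ccontr)
    assume "\<not> 2 \<le> n"
    then have "n = 1" using assms(2) by simp
    then have "active i n" using assms(1) unfolding active_def by (cases "i = 1") (auto intro: exI[of _ 0])
    then show False using assms(3) by simp
  qed
  have into: "u = (i, n - 1)" if "(u, (i, n)) \<in> arcs pregrid" for u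
    using that
  proof (cases rule: pregrid_arcE)
    case (1 i' n') then show ?thesis by simp
  next
    case (2 i' j) then show ?thesis using assms(3) unfolding active_def by auto
  next
    case (3 i' j) then show ?thesis using assms(3) unfolding active_def by auto
  qed
  have out: "u = (i, Suc n)" if "((i, n), u) \<in> arcs pregrid" for u
    using that
  proof (cases rule: pregrid_arcE)
    case (1 i' n') then show ?thesis by simp
  next
    case (2 i' j) then show ?thesis using assms(3) unfolding active_def by auto
  next
    case (3 i' j) then show ?thesis using assms(3) unfolding active_def by auto
  qed
  have "in_arcs pregrid (i, n) = {((i, n - 1), (i, n))}"
  proof
    show "in_arcs pregrid (i, n) \<subseteq> {((i, n - 1), (i, n))}"
      unfolding in_arcs_def pregrid_simps using into by auto
    show "{((i, n - 1), (i, n))} \<subseteq> in_arcs pregrid (i, n)"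
      unfolding in_arcs_def pregrid_simps using pregrid_row_arc[of i "n - 1"] n assms(1) by simp
  qed
  moreover have "out_arcs pregrid (i, n) = {((i, n), (i, Suc n))}"
  proof
    show "out_arcs pregrid (i, n) \<subseteq> {((i, n), (i, Suc n))}"
      unfolding out_arcs_def pregrid_simps using out by auto
    show "{((i, n), (i, Suc n))} \<subseteq> out_arcs pregrid (i, n)"
      unfolding out_arcs_def pregrid_simps using pregrid_row_arc[of i n] assms by simp
  qed
  ultimately show ?thesis
    unfolding pregrid_suppressed_def in_degree_def out_degree_def pregrid_simps
    using assms into out by auto
qed

lemma suppressed_row: "v \<in> pregrid_suppressed \<Longrightarrow> (u, v) \<in> arcs pregrid \<or> (v, u) \<in> arcs pregrid \<Longrightarrow> fst u = fst v"
  unfolding pregrid_suppressed_def by blast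

lemma pregrid_same_row: "(u, v) \<in> arcs pregrid \<Longrightarrow> fst u = fst v \<Longrightarrow> v = (fst u, Suc (snd u))"
  by (erule pregrid_arcE) simp_all

text \<open>A suppressed vertex has all its neighbours in its own row, and within a row arcs go one
  step to the right. So a walk with suppressed inner vertices can change the row only if it is a
  single arc.\<close>

lemma suppressed_walk:
  assumes "pre_digraph.cas pregrid u p w" "set p \<subseteq> arcs pregrid" "p \<noteq> []"
    "set (butlast (tl (pre_digraph.awalk_verts pregrid u p))) \<subseteq> pregrid_suppressed"
  shows "(p = [(u, w)] \<and> (u, w) \<in> arcs pregrid) \<or>
    (fst u = fst w \<and> snd u < snd w \<and> (\<forall>m. snd u < m \<and> m < snd w \<longrightarrow> (fst u, m) \<in> pregrid_suppressed))"
  using assms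
proof (induction p arbitrary: u)
  case Nil then show ?case by simp
next
  case (Cons e p)
  define c where "c = snd e"
  have e: "fst e = u" "e = (u, c)" "e \<in> arcs pregrid" and cas: "pre_digraph.cas pregrid c p w"
    using Cons.prems(1,2) by (auto simp: pre_digraph.cas.simps pregrid_simps c_def)
  show ?case
  proof (cases "p = []")
    case True
    then show ?thesis using cas e by (simp add: pre_digraph.cas.simps)
  next
    case False
    then obtain e' p' where p: "p = e' # p'" by (cases p) auto
    have e': "fst e' = c" using cas p by (simp add: pre_digraph.cas.simps pregrid_simps)
    have nn: "pre_digraph.awalk_verts pregrid (snd e') p' \<noteq> []" by (rule pre_digraph.awalk_verts_non_Nil)
    have "butlast (tl (pre_digraph.awalk_verts pregrid u (e # p))) =
        c # butlast (tl (pre_digraph.awalk_verts pregrid c p))"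
      using nn e' by (simp add: p pre_digraph.awalk_verts.simps pregrid_simps)
    then have cS: "c \<in> pregrid_suppressed"
      and int: "set (butlast (tl (pre_digraph.awalk_verts pregrid c p))) \<subseteq> pregrid_suppressed"
      using Cons.prems(4) by simp_all
    have uc: "c = (fst u, Suc (snd u))" using suppressed_row[OF cS, of u] pregrid_same_row[of u c] e(2,3) by simp
    from Cons.IH[OF cas _ False int] Cons.prems(2)
    consider "p = [(c, w)]" "(c, w) \<in> arcs pregrid"
      | "fst c = fst w" "snd c < snd w" "\<forall>m. snd c < m \<and> m < snd w \<longrightarrow> (fst c, m) \<in> pregrid_suppressed" by auto
    then show ?thesis
    proof cases
      case 1
      have "fst w = fst c" using suppressed_row[OF cS] 1(2) by blast
      then have w: "w = (fst c, Suc (snd c))" using pregrid_same_row[OF 1(2)] by simp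
      show ?thesis
      proof (intro disjI2 conjI allI impI)
        fix m assume "snd u < m \<and> m < snd w"
        then have "m = snd c" using w uc by simp
        then show "(fst u, m) \<in> pregrid_suppressed" using cS uc by simp
      qed (use w uc in simp_all)
    next
      case 2
      show ?thesis
      proof (intro disjI2 conjI allI impI)
        fix m assume m: "snd u < m \<and> m < snd w"
        show "(fst u, m) \<in> pregrid_suppressed"
        proof (cases "m = snd c")
          case True then show ?thesis using cS uc by simp
        next
          case False then show ?thesis using 2(3) m uc by simp
        qed
      qed (use 2 uc in simp_all)
    qed
  qed
qed

lemma quarter_grid_simps: "verts quarter_grid = verts pregrid - pregrid_suppressed"
  "tail quarter_grid = fst" "head quarter_grid = snd"
  unfolding quarter_grid_def suppress_def rel_digraph_def by simp_all

lemma quarter_grid_vert: "(i, n) \<in> verts quarter_grid \<Longrightarrow> 1 \<le> i \<and> active i n"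
  using inactive_suppressed[of i n] unfolding quarter_grid_simps pregrid_simps by auto

lemma quarter_grid_arcE:
  assumes "(u, w) \<in> arcs quarter_grid"
  obtains i n n' where "u = (i, n)" "w = (i, n')" "n < n'" "(i, n) \<in> verts quarter_grid" "(i, n') \<in> verts quarter_grid"
      "\<And>m. n < m \<Longrightarrow> m < n' \<Longrightarrow> (i, m) \<notin> verts quarter_grid"
    | i j where "1 \<le> i" "u = (i, 4 * j + 7)" "w = (i + 1, 4 * j + 1)"
    | i j where "1 \<le> i" "u = (i + 1, 4 * j + 2)" "w = (i, 4 * j + 8)"
proof -
  obtain p where p: "u \<in> verts quarter_grid" "w \<in> verts quarter_grid" "p \<noteq> []" "pre_digraph.awalk pregrid u p w"
    "set (butlast (tl (pre_digraph.awalk_verts pregrid u p))) \<subseteq> pregrid_suppressed"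
    using assms unfolding quarter_grid_simps unfolding quarter_grid_def suppress_def rel_digraph_def by auto
  have "pre_digraph.cas pregrid u p w" "set p \<subseteq> arcs pregrid"
    using p(4) by (simp_all add: pre_digraph.awalk_def)
  from suppressed_walk[OF this p(3,5)] consider
    "(u, w) \<in> arcs pregrid" "fst u \<noteq> fst w"
    | "fst u = fst w" "snd u < snd w" "\<forall>m. snd u < m \<and> m < snd w \<longrightarrow> (fst u, m) \<in> pregrid_suppressed"
    using pregrid_same_row[of u w] by fastforce
  then show thesis
  proof cases
    case 1
    then show thesis using that(2,3) by (elim pregrid_arcE) simp_all
  next
    case 2
    obtain i n where u: "u = (i, n)" by (cases u)
    obtain n' where w: "w = (i, n')" using 2(1) u by (cases w) simp
    show thesis
    proof (rule that(1)[OF u w])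
      show "n < n'" "(i, n) \<in> verts quarter_grid" "(i, n') \<in> verts quarter_grid" using 2 p(1,2) u w by simp_all
      show "(i, m) \<notin> verts quarter_grid" if "n < m" "m < n'" for m
        using 2(3) that u w unfolding quarter_grid_simps by simp
    qed
  qed
qed

section \<open>An order of the operations that agrees with the order in every row\<close>

lemma prod_encode_mono: "b < b' \<Longrightarrow> prod_encode (a, b) < prod_encode (a, b')"
proof -
  assume "b < b'"
  have "triangle m < triangle n" if "m < n" for m n
    using that by (induction n) (auto simp: less_Suc_eq intro: less_trans)
  from this[of "a + b" "a + b'"] show ?thesis using \<open>b < b'\<close> by (simp add: prod_encode_def)
qed

text \<open>In row \<open>a + 2\<close> of the grid this mirrors 4b + 5 < 4b + 7 < 4b + 9: cross
  edges to the row below and to the row above alternate as the diagonal enumeration does.\<close>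

lemma prod_encode_interleave:
  "prod_encode (a, Suc b) < prod_encode (Suc a, b)" "prod_encode (Suc a, b) < prod_encode (a, Suc (Suc b))"
  by (simp_all add: prod_encode_def)

text \<open>Operation \<open>0\<close> is only used to get a vertex for \<open>(1, 1)\<close>. Along every row, the operations come in the same
  order as the vertices of the row.\<close>

definition grid_op :: "nat \<times> nat \<Rightarrow> nat" where
  "grid_op v = (let i = fst v; n = snd v in
     if n mod 4 = 3 then 1 + 2 * prod_encode (i - 1, (n - 7) div 4)
     else if n mod 4 = 0 then 2 + 2 * prod_encode (i - 1, (n - 8) div 4)
     else if i = 1 then 0
     else if n mod 4 = 1 then 1 + 2 * prod_encode (i - 2, (n - 1) div 4)
     else 2 + 2 * prod_encode (i - 2, (n - 2) div 4))"

text \<open>Rows are counted from 0 here, so grid row \<open>i\<close> is row \<open>i - 1\<close>.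
  An odd operation realizes a cross edge to the next row, the even one after it the edge
  back.\<close>

definition op_src :: "nat \<Rightarrow> nat" where
  "op_src m = (if m = 0 then 0 else if odd m then fst (prod_decode ((m - 1) div 2))
     else Suc (fst (prod_decode ((m - 1) div 2))))"

definition op_dst :: "nat \<Rightarrow> nat" where
  "op_dst m = (if m = 0 then 1 else if odd m then Suc (fst (prod_decode ((m - 1) div 2)))
     else fst (prod_decode ((m - 1) div 2)))"

lemma grid_op_simps:
  "grid_op (i, 4 * j + 7) = 1 + 2 * prod_encode (i - 1, j)"
  "grid_op (i, 4 * j + 8) = 2 + 2 * prod_encode (i - 1, j)"
  "2 \<le> i \<Longrightarrow> grid_op (i, 4 * j + 1) = 1 + 2 * prod_encode (i - 2, j)"
  "2 \<le> i \<Longrightarrow> grid_op (i, 4 * j + 2) = 2 + 2 * prod_encode (i - 2, j)"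
  "grid_op (1, 1) = 0"
proof -
  have "(4 * j + 7) mod 4 = 3" "(4 * j + 8) mod 4 = 0" "(4 * j + 1) mod 4 = 1" "(4 * j + 2) mod 4 = 2"
    by presburger+
  then show "grid_op (i, 4 * j + 7) = 1 + 2 * prod_encode (i - 1, j)"
    "grid_op (i, 4 * j + 8) = 2 + 2 * prod_encode (i - 1, j)"
    "2 \<le> i \<Longrightarrow> grid_op (i, 4 * j + 1) = 1 + 2 * prod_encode (i - 2, j)"
    "2 \<le> i \<Longrightarrow> grid_op (i, 4 * j + 2) = 2 + 2 * prod_encode (i - 2, j)"
    "grid_op (1, 1) = 0"
    unfolding grid_op_def Let_def fst_conv snd_conv by simp_all
qed

lemma op_src_gdst_encode:
  "op_src (1 + 2 * prod_encode (a, b)) = a" "op_dst (1 + 2 * prod_encode (a, b)) = Suc a"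
  "op_src (2 + 2 * prod_encode (a, b)) = Suc a" "op_dst (2 + 2 * prod_encode (a, b)) = a"
proof -
  have "(2 + 2 * x - 1) div 2 = x" for x :: nat by presburger
  then show "op_src (1 + 2 * prod_encode (a, b)) = a" "op_dst (1 + 2 * prod_encode (a, b)) = Suc a"
    "op_src (2 + 2 * prod_encode (a, b)) = Suc a" "op_dst (2 + 2 * prod_encode (a, b)) = a"
    unfolding op_src_def op_dst_def by simp_all
qed

text \<open>Since \<open>a \<le> prod_encode (a, b)\<close>, a row is called upon only when it is
  already present in \<open>weave\<close>.\<close>

lemma op_src_gdst_adjacent: "\<exists>i\<le>m. op_src m = i \<and> op_dst m = Suc i \<or> op_src m = Suc i \<and> op_dst m = i"
proof (cases m)
  case 0
  then show ?thesis by (simp add: op_src_def op_dst_def)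
next
  case (Suc k)
  obtain a b where ab: "prod_decode (k div 2) = (a, b)" by (cases "prod_decode (k div 2)")
  have "a \<le> prod_encode (a, b)" by (rule le_prod_encode_1)
  also have "\<dots> = k div 2" using ab by (metis prod_decode_inverse)
  finally have "a \<le> m" using Suc by linarith
  then show ?thesis using ab Suc by (intro exI[of _ a]) (simp add: op_src_def op_dst_def)
qed

lemma grid_op_participant:
  assumes "1 \<le> i" "active i n"
  shows "i - 1 \<in> {op_src (grid_op (i, n)), op_dst (grid_op (i, n))}"
proof -
  have pred: "i - 1 = Suc (i - 2)" if "2 \<le> i" using that by simp
  consider "i = 1" "n = 1" | j where "n = 4 * j + 7" | j where "n = 4 * j + 8"
    | j where "2 \<le> i" "n = 4 * j + 1" | j where "2 \<le> i" "n = 4 * j + 2"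
    using assms(2) unfolding active_def by blast
  then show ?thesis
  proof cases
    case 1
    show ?thesis unfolding 1 grid_op_simps(5) by (simp add: op_src_def)
  next
    case (2 j) show ?thesis unfolding 2 grid_op_simps op_src_gdst_encode by simp
  next
    case (3 j) show ?thesis unfolding 3 grid_op_simps op_src_gdst_encode by simp
  next
    case (4 j) show ?thesis unfolding 4(2) grid_op_simps(3)[OF 4(1)] op_src_gdst_encode pred[OF 4(1)] by simp
  next
    case (5 j) show ?thesis unfolding 5(2) grid_op_simps(4)[OF 5(1)] op_src_gdst_encode pred[OF 5(1)] by simp
  qed
qed

lemma grid_op_strict:
  assumes "1 \<le> i" "active i n" "active i n'" "n < n'"
  shows "grid_op (i, n) < grid_op (i, n')"
proof (cases "i = 1")
  case True
  have m: "j < j' \<Longrightarrow> prod_encode (0, j) < prod_encode (0, j')" for j j' by (rule prod_encode_mono)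
  have a: "k = 1 \<or> (\<exists>j. k = 4 * j + 7) \<or> (\<exists>j. k = 4 * j + 8)" if "active i k" for k
    using that True unfolding active_def by auto
  from a[OF assms(2)] a[OF assms(3)] show ?thesis unfolding True
  proof (elim disjE exE)
    assume "n = 1" "n' = 1" then show "grid_op (1, n) < grid_op (1, n')" using assms(4) by simp
  next
    fix j assume "n = 1" "n' = 4 * j + 7"
    then show "grid_op (1, n) < grid_op (1, n')" by (simp only: grid_op_simps)
  next
    fix j assume "n = 1" "n' = 4 * j + 8"
    then show "grid_op (1, n) < grid_op (1, n')" by (simp only: grid_op_simps)
  next
    fix j assume "n = 4 * j + 7" "n' = 1" then show "grid_op (1, n) < grid_op (1, n')" using assms(4) by simp
  next
    fix j assume "n = 4 * j + 8" "n' = 1" then show "grid_op (1, n) < grid_op (1, n')" using assms(4) by simp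
  next
    fix j j' assume "n = 4 * j + 7" "n' = 4 * j' + 7"
    then show "grid_op (1, n) < grid_op (1, n')" using assms(4) m[of j j'] by (simp only: grid_op_simps) simp
  next
    fix j j' assume *: "n = 4 * j + 7" "n' = 4 * j' + 8"
    then have "j = j' \<or> j < j'" using assms(4) by linarith
    then show "grid_op (1, n) < grid_op (1, n')" using * m[of j j'] by (simp only: grid_op_simps) auto
  next
    fix j j' assume *: "n = 4 * j + 8" "n' = 4 * j' + 7"
    then have "j < j'" using assms(4) by linarith
    then show "grid_op (1, n) < grid_op (1, n')" using * m[of j j'] by (simp only: grid_op_simps) simp
  next
    fix j j' assume "n = 4 * j + 8" "n' = 4 * j' + 8"
    then show "grid_op (1, n) < grid_op (1, n')" using assms(4) m[of j j'] by (simp only: grid_op_simps) simp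
  qed
next
  case False
  then have i: "2 \<le> i" using assms(1) by simp
  define a where "a = i - 2"
  have ia: "i - 1 = Suc a" "i - 2 = a" using i a_def by simp_all
  define x where "x j = prod_encode (Suc a, j)" for j
  define y where "y j = prod_encode (a, j)" for j
  note g = grid_op_simps(1)[of i, unfolded ia, folded x_def] grid_op_simps(2)[of i, unfolded ia, folded x_def]
    grid_op_simps(3)[OF i, unfolded ia, folded y_def] grid_op_simps(4)[OF i, unfolded ia, folded y_def]
  have xm: "x j < x j'" if "j < j'" for j j' unfolding x_def using that by (rule prod_encode_mono)
  have ym: "y j < y j'" if "j < j'" for j j' unfolding y_def using that by (rule prod_encode_mono)
  have xm': "x j \<le> x j'" if "j \<le> j'" for j j' using xm[of j j'] that by (cases "j = j'") auto
  have ym': "y j \<le> y j'" if "j \<le> j'" for j j' using ym[of j j'] that by (cases "j = j'") auto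
  \<comment> \<open>The bounds translate the order in the row: 4j' + 1 < 4j + 7 means
    \<open>j' \<le> Suc j\<close>, and 4j + 7 < 4j' + 1 means
    \<open>Suc (Suc j) \<le> j'\<close>.\<close>
  have yx: "y j' < x j" if "j' \<le> Suc j" for j j'
    using prod_encode_interleave(1)[of a j] ym'[OF that] unfolding x_def y_def by linarith
  have xy: "x j < y j'" if "Suc (Suc j) \<le> j'" for j j'
    using prod_encode_interleave(2)[of a j] ym'[OF that] unfolding x_def y_def by linarith
  have act: "(\<exists>j. k = 4 * j + 7 \<and> grid_op (i, k) = 1 + 2 * x j) \<or> (\<exists>j. k = 4 * j + 8 \<and> grid_op (i, k) = 2 + 2 * x j) \<or>
     (\<exists>j. k = 4 * j + 1 \<and> grid_op (i, k) = 1 + 2 * y j) \<or> (\<exists>j. k = 4 * j + 2 \<and> grid_op (i, k) = 2 + 2 * y j)"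
    if "active i k" for k
    using that False g unfolding active_def by blast
  from act[OF assms(2)] act[OF assms(3)] show ?thesis
  proof (elim disjE exE conjE)
    fix j j' assume *: "n = 4 * j + 7" "grid_op (i, n) = 1 + 2 * x j" "n' = 4 * j' + 7" "grid_op (i, n') = 1 + 2 * x j'"
    then show ?thesis using assms(4) xm[of j j'] by simp
  next
    fix j j' assume *: "n = 4 * j + 7" "grid_op (i, n) = 1 + 2 * x j" "n' = 4 * j' + 8" "grid_op (i, n') = 2 + 2 * x j'"
    then show ?thesis using assms(4) xm'[of j j'] by simp
  next
    fix j j' assume *: "n = 4 * j + 7" "grid_op (i, n) = 1 + 2 * x j" "n' = 4 * j' + 1" "grid_op (i, n') = 1 + 2 * y j'"
    then show ?thesis using assms(4) xy[of j j'] by simp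
  next
    fix j j' assume *: "n = 4 * j + 7" "grid_op (i, n) = 1 + 2 * x j" "n' = 4 * j' + 2" "grid_op (i, n') = 2 + 2 * y j'"
    then show ?thesis using assms(4) xy[of j j'] by simp
  next
    fix j j' assume *: "n = 4 * j + 8" "grid_op (i, n) = 2 + 2 * x j" "n' = 4 * j' + 7" "grid_op (i, n') = 1 + 2 * x j'"
    then show ?thesis using assms(4) xm[of j j'] by simp
  next
    fix j j' assume *: "n = 4 * j + 8" "grid_op (i, n) = 2 + 2 * x j" "n' = 4 * j' + 8" "grid_op (i, n') = 2 + 2 * x j'"
    then show ?thesis using assms(4) xm[of j j'] by simp
  next
    fix j j' assume *: "n = 4 * j + 8" "grid_op (i, n) = 2 + 2 * x j" "n' = 4 * j' + 1" "grid_op (i, n') = 1 + 2 * y j'"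
    then show ?thesis using assms(4) xy[of j j'] by simp
  next
    fix j j' assume *: "n = 4 * j + 8" "grid_op (i, n) = 2 + 2 * x j" "n' = 4 * j' + 2" "grid_op (i, n') = 2 + 2 * y j'"
    then show ?thesis using assms(4) xy[of j j'] by simp
  next
    fix j j' assume *: "n = 4 * j + 1" "grid_op (i, n) = 1 + 2 * y j" "n' = 4 * j' + 7" "grid_op (i, n') = 1 + 2 * x j'"
    then show ?thesis using assms(4) yx[of j j'] by simp
  next
    fix j j' assume *: "n = 4 * j + 1" "grid_op (i, n) = 1 + 2 * y j" "n' = 4 * j' + 8" "grid_op (i, n') = 2 + 2 * x j'"
    then show ?thesis using assms(4) yx[of j j'] by simp
  next
    fix j j' assume *: "n = 4 * j + 1" "grid_op (i, n) = 1 + 2 * y j" "n' = 4 * j' + 1" "grid_op (i, n') = 1 + 2 * y j'"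
    then show ?thesis using assms(4) ym[of j j'] by simp
  next
    fix j j' assume *: "n = 4 * j + 1" "grid_op (i, n) = 1 + 2 * y j" "n' = 4 * j' + 2" "grid_op (i, n') = 2 + 2 * y j'"
    then show ?thesis using assms(4) ym'[of j j'] by simp
  next
    fix j j' assume *: "n = 4 * j + 2" "grid_op (i, n) = 2 + 2 * y j" "n' = 4 * j' + 7" "grid_op (i, n') = 1 + 2 * x j'"
    then show ?thesis using assms(4) yx[of j j'] by simp
  next
    fix j j' assume *: "n = 4 * j + 2" "grid_op (i, n) = 2 + 2 * y j" "n' = 4 * j' + 8" "grid_op (i, n') = 2 + 2 * x j'"
    then show ?thesis using assms(4) yx[of j j'] by simp
  next
    fix j j' assume *: "n = 4 * j + 2" "grid_op (i, n) = 2 + 2 * y j" "n' = 4 * j' + 1" "grid_op (i, n') = 1 + 2 * y j'"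
    then show ?thesis using assms(4) ym[of j j'] by simp
  next
    fix j j' assume *: "n = 4 * j + 2" "grid_op (i, n) = 2 + 2 * y j" "n' = 4 * j' + 2" "grid_op (i, n') = 2 + 2 * y j'"
    then show ?thesis using assms(4) ym[of j j'] by simp
  qed
qed

section \<open>The immersion\<close>

lemma (in wf_digraph) stitched_walk:
  assumes "\<And>t. m \<le> t \<Longrightarrow> awalk (bd t) (A t) (X t)" "\<And>t. m \<le> t \<Longrightarrow> awalk (X t) (B t) (bd (Suc t))" "m < m'"
  shows "awalk (X m) (B m @ concat (map (\<lambda>t. A t @ B t) [Suc m..<m']) @ A m') (X m')"
proof -
  have "awalk (X m) (B m @ concat (map (\<lambda>t. A t @ B t) [Suc m..<k])) (bd k)" if "Suc m \<le> k" for k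
    using that
  proof (induction k rule: dec_induct)
    case base
    show ?case using assms(2)[of m] by simp
  next
    case (step k)
    have "awalk (bd k) (A k @ B k) (bd (Suc k))"
      using awalk_appendI[OF assms(1)[of k] assms(2)[of k]] step.hyps by simp
    from awalk_appendI[OF step.IH this] show ?case using step.hyps by simp
  qed
  from this[of m'] have "awalk (X m) (B m @ concat (map (\<lambda>t. A t @ B t) [Suc m..<m'])) (bd m')" using assms(3) by simp
  from awalk_appendI[OF this assms(1)[of m']] show ?thesis using assms(3) by simp
qed

text \<open>A grid vertex goes to the cut of its row in its operation, and a cross edge to the
  message of the operation that its two ends share. A row edge goes to the row between two cuts:
  second part of the first operation, whole walks of those in between, first part of the
  last.\<close>

lemma (in line_system) quarter_grid_immersion:
  obtains \<phi>V \<phi>E where "weak_immersion quarter_grid G \<phi>V \<phi>E"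
    "\<And>R. is_ray quarter_grid R \<Longrightarrow> \<exists>Q. is_ray G Q \<and> near (ray_verts Q) H \<and> near H (ray_verts Q) \<and>
       ray_arcs Q \<subseteq> image_arcs \<phi>E R"
proof -
  obtain bd X :: "nat \<Rightarrow> nat \<Rightarrow> 'a" and W :: "nat \<Rightarrow> key \<Rightarrow> 'b list" where
    fore: "\<And>m r. r \<le> Suc m \<Longrightarrow> awalk (bd m r) (W m (Fore r)) (X m r)" and
    aft: "\<And>m r. r \<le> Suc m \<Longrightarrow> awalk (X m r) (W m (Aft r)) (bd (Suc m) r)" and
    msg: "\<And>m. awalk (X m (op_src m)) (W m Msg) (X m (op_dst m))" and
    disj: "\<And>m m' k k' c. c \<in> set (W m k) \<Longrightarrow> c \<in> set (W m' k') \<Longrightarrow> m = m' \<and> k = k'" and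
    inj: "\<And>m m' r r'. r \<in> {op_src m, op_dst m} \<Longrightarrow> r' \<in> {op_src m', op_dst m'} \<Longrightarrow> X m r = X m' r' \<Longrightarrow> m = m' \<and> r = r'" and
    rays: "\<And>Q. is_ray G Q \<Longrightarrow> ray_arcs Q \<subseteq> (\<Union>m k. set (W m k)) \<Longrightarrow>
      near (ray_verts Q) H \<and> near H (ray_verts Q)" and
    fin: "\<And>z. finite {c \<in> (\<Union>m k. set (W m k)). tail G c = z}"
    by (rule weave[of op_src op_dst, OF op_src_gdst_adjacent], rule that, assumption+)
  define row where "row r m m' = W m (Aft r) @ concat (map (\<lambda>t. W t (Fore r) @ W t (Aft r)) [Suc m..<m']) @ W m' (Fore r)"
    for r m m'
  define \<phi>V where "\<phi>V v = X (grid_op v) (fst v - 1)" for v :: "nat \<times> nat"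
  define walk where "walk e = (if fst (fst e) = fst (snd e) then row (fst (fst e) - 1) (grid_op (fst e)) (grid_op (snd e))
      else W (grid_op (fst e)) Msg)" for e :: "(nat \<times> nat) \<times> (nat \<times> nat)"
  \<comment> \<open>The stitched walk may revisit vertices; shortening it to a path only drops arcs,
    so disjointness survives.\<close>
  define \<phi>E where "\<phi>E e = awalk_to_apath (walk e)" for e
  \<comment> \<open>The pieces, as pairs of an operation and a key, from which the walk of
    \<open>e\<close> is assembled. Different pieces share no arc, so disjointness of edges reduces
    to disjointness of these sets.\<close>
  define ks where "ks e = (if fst (fst e) = fst (snd e)
      then {(t, k). k = Aft (fst (fst e) - 1) \<and> grid_op (fst e) \<le> t \<and> t < grid_op (snd e) \<or>
        k = Fore (fst (fst e) - 1) \<and> grid_op (fst e) < t \<and> t \<le> grid_op (snd e)}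
      else {(grid_op (fst e), Msg)})" for e :: "(nat \<times> nat) \<times> (nat \<times> nat)"
  have part: "i - 1 \<in> {op_src (grid_op (i, n)), op_dst (grid_op (i, n))}" if "(i, n) \<in> verts quarter_grid" for i n
    using grid_op_participant quarter_grid_vert[OF that] by simp
  have early: "i - 1 \<le> Suc (grid_op (i, n))" if "(i, n) \<in> verts quarter_grid" for i n
    using part[OF that] op_src_gdst_adjacent[of "grid_op (i, n)"] by auto
  have strict: "grid_op (i, n) < grid_op (i, n')" if "(i, n) \<in> verts quarter_grid" "(i, n') \<in> verts quarter_grid" "n < n'" for i n n'
    using grid_op_strict[of i n n'] quarter_grid_vert[OF that(1)] quarter_grid_vert[OF that(2)] that(3) by simp
  have \<phi>V_inj: "inj_on \<phi>V (verts quarter_grid)"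
  proof (rule inj_onI)
    fix u v assume uv: "u \<in> verts quarter_grid" "v \<in> verts quarter_grid" "\<phi>V u = \<phi>V v"
    obtain i n where u: "u = (i, n)" by (cases u)
    obtain j m where v: "v = (j, m)" by (cases v)
    have *: "grid_op (i, n) = grid_op (j, m)" "i - 1 = j - 1"
      using inj[OF part[of i n] part[of j m]] uv unfolding u v \<phi>V_def by simp_all
    then have "i = j" using quarter_grid_vert uv u v by (metis diff_diff_cancel le_add_diff_inverse)
    moreover have "\<not> n < m" "\<not> m < n" using strict uv * \<open>i = j\<close> unfolding u v by fastforce+
    ultimately show "u = v" unfolding u v by simp
  qed
  have row_ks: "\<exists>t k. (t, k) \<in> ks ((i, n), (i, n')) \<and> c \<in> set (W t k)"
    if c: "c \<in> set (row (i - 1) (grid_op (i, n)) (grid_op (i, n')))" "grid_op (i, n) < grid_op (i, n')" for c i n n'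
  proof -
    consider "c \<in> set (W (grid_op (i, n)) (Aft (i - 1)))" | "c \<in> set (W (grid_op (i, n')) (Fore (i - 1)))"
      | t where "grid_op (i, n) < t" "t < grid_op (i, n')" "c \<in> set (W t (Fore (i - 1)))"
      | t where "grid_op (i, n) < t" "t < grid_op (i, n')" "c \<in> set (W t (Aft (i - 1)))"
      using c(1) unfolding row_def by (auto simp: Suc_le_eq)
    then show ?thesis
    proof cases
      case 1
      then show ?thesis using c(2) unfolding ks_def by (intro exI[of _ "grid_op (i, n)"] exI[of _ "Aft (i - 1)"]) simp
    next
      case 2
      then show ?thesis using c(2) unfolding ks_def by (intro exI[of _ "grid_op (i, n')"] exI[of _ "Fore (i - 1)"]) simp
    next
      case (3 t)
      then show ?thesis unfolding ks_def by (intro exI[of _ t] exI[of _ "Fore (i - 1)"]) simp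
    next
      case (4 t)
      then show ?thesis unfolding ks_def by (intro exI[of _ t] exI[of _ "Aft (i - 1)"]) simp
    qed
  qed
  have arc_walk: "awalk (\<phi>V (fst e)) (walk e) (\<phi>V (snd e)) \<and> (\<forall>c\<in>set (walk e). \<exists>t k. (t, k) \<in> ks e \<and> c \<in> set (W t k))"
    if "e \<in> arcs quarter_grid" for e
  proof -
    obtain u w where e: "e = (u, w)" by (cases e)
    have "(u, w) \<in> arcs quarter_grid" using that e by simp
    then show ?thesis
    proof (cases rule: quarter_grid_arcE)
      case (1 i n n')
      have lt: "grid_op (i, n) < grid_op (i, n')" using strict 1 by blast
      have "awalk (X (grid_op (i, n)) (i - 1)) (row (i - 1) (grid_op (i, n)) (grid_op (i, n'))) (X (grid_op (i, n')) (i - 1))"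
        unfolding row_def
      proof (rule stitched_walk[where bd = "\<lambda>t. bd t (i - 1)" and X = "\<lambda>t. X t (i - 1)", OF _ _ lt])
        show "awalk (bd t (i - 1)) (W t (Fore (i - 1))) (X t (i - 1))" if "grid_op (i, n) \<le> t" for t
          using early[OF 1(4)] that by (intro fore) linarith
        show "awalk (X t (i - 1)) (W t (Aft (i - 1))) (bd (Suc t) (i - 1))" if "grid_op (i, n) \<le> t" for t
          using early[OF 1(4)] that by (intro aft) linarith
      qed
      moreover have "walk e = row (i - 1) (grid_op (i, n)) (grid_op (i, n'))" unfolding walk_def e 1 by simp
      ultimately show ?thesis using row_ks[OF _ lt] unfolding e 1 \<phi>V_def by simp
    next
      case (2 i j)
      have g: "grid_op (i + 1, 4 * j + 1) = grid_op (i, 4 * j + 7)" using grid_op_simps(3)[of "i + 1" j] 2(1) unfolding grid_op_simps(1) by simp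
      have "op_src (grid_op (i, 4 * j + 7)) = i - 1" "op_dst (grid_op (i, 4 * j + 7)) = i"
        unfolding grid_op_simps op_src_gdst_encode using 2(1) by simp_all
      then have "awalk (\<phi>V (i, 4 * j + 7)) (W (grid_op (i, 4 * j + 7)) Msg) (\<phi>V (i + 1, 4 * j + 1))"
        using msg[of "grid_op (i, 4 * j + 7)"] unfolding \<phi>V_def g by simp
      moreover have "walk e = W (grid_op (i, 4 * j + 7)) Msg" "(grid_op (i, 4 * j + 7), Msg) \<in> ks e"
        unfolding walk_def ks_def e 2 by simp_all
      ultimately show ?thesis unfolding e 2 by auto
    next
      case (3 i j)
      have g: "grid_op (i + 1, 4 * j + 2) = grid_op (i, 4 * j + 8)" using grid_op_simps(4)[of "i + 1" j] 3(1) unfolding grid_op_simps(2) by simp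
      have "op_src (grid_op (i, 4 * j + 8)) = i" "op_dst (grid_op (i, 4 * j + 8)) = i - 1"
        unfolding grid_op_simps op_src_gdst_encode using 3(1) by simp_all
      then have "awalk (\<phi>V (i + 1, 4 * j + 2)) (W (grid_op (i, 4 * j + 8)) Msg) (\<phi>V (i, 4 * j + 8))"
        using msg[of "grid_op (i, 4 * j + 8)"] unfolding \<phi>V_def g by simp
      moreover have "walk e = W (grid_op (i, 4 * j + 8)) Msg" "(grid_op (i, 4 * j + 8), Msg) \<in> ks e"
        unfolding walk_def ks_def e 3 by (simp_all add: g[simplified])
      ultimately show ?thesis unfolding e 3 by auto
    qed
  qed
  have ks_disj: "ks e \<inter> ks e' = {}" if ee: "e \<in> arcs quarter_grid" "e' \<in> arcs quarter_grid" "e \<noteq> e'" for e e'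
  proof -
    have kind: "(\<exists>i n n'. e = ((i, n), (i, n')) \<and> n < n' \<and> (i, n) \<in> verts quarter_grid \<and> (i, n') \<in> verts quarter_grid \<and>
        (\<forall>m. n < m \<longrightarrow> m < n' \<longrightarrow> (i, m) \<notin> verts quarter_grid)) \<or>
      (\<exists>i j. 1 \<le> i \<and> e = ((i, 4 * j + 7), (i + 1, 4 * j + 1)) \<and> ks e = {(1 + 2 * prod_encode (i - 1, j), Msg)}) \<or>
      (\<exists>i j. 1 \<le> i \<and> e = ((i + 1, 4 * j + 2), (i, 4 * j + 8)) \<and> ks e = {(2 + 2 * prod_encode (i - 1, j), Msg)})"
      if "e \<in> arcs quarter_grid" for e
    proof -
      obtain u w where e: "e = (u, w)" by (cases e)
      have "(u, w) \<in> arcs quarter_grid" using that e by simp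
      then show ?thesis
      proof (cases rule: quarter_grid_arcE)
        case (1 i n n')
        then show ?thesis unfolding e by (intro disjI1 exI[of _ i] exI[of _ n] exI[of _ n']) simp
      next
        case (2 i j)
        have "ks e = {(1 + 2 * prod_encode (i - 1, j), Msg)}" unfolding ks_def e 2 fst_conv snd_conv grid_op_simps by simp
        then show ?thesis unfolding e 2 using 2(1) by blast
      next
        case (3 i j)
        have "grid_op (i + 1, 4 * j + 2) = 2 + 2 * prod_encode (i - 1, j)" using grid_op_simps(4)[of "i + 1" j] 3(1) by simp
        then have "ks e = {(2 + 2 * prod_encode (i - 1, j), Msg)}" unfolding ks_def e 3 fst_conv snd_conv by simp
        then show ?thesis unfolding e 3 using 3(1) by blast
      qed
    qed
    have row_msg: "(t, Msg) \<notin> ks ((i, n), (i, n'))" for t i n n' unfolding ks_def by simp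
    have rr: "ks ((i, n), (i, n')) \<inter> ks ((j, m), (j, m')) = {}"
      if 1: "n < n'" "(i, n) \<in> verts quarter_grid" "(i, n') \<in> verts quarter_grid"
          "\<forall>l. n < l \<longrightarrow> l < n' \<longrightarrow> (i, l) \<notin> verts quarter_grid"
        and 2: "m < m'" "(j, m) \<in> verts quarter_grid" "(j, m') \<in> verts quarter_grid"
          "\<forall>l. m < l \<longrightarrow> l < m' \<longrightarrow> (j, l) \<notin> verts quarter_grid"
        and ne: "((i, n), (i, n')) \<noteq> ((j, m), (j, m'))" for i n n' j m m'
    proof (cases "i = j")
      case False
      then have "i - 1 \<noteq> j - 1" using quarter_grid_vert[OF 1(2)] quarter_grid_vert[OF 2(2)] by linarith
      then show ?thesis unfolding ks_def by auto
    next
      case True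
      \<comment> \<open>Both edges join consecutive grid vertices of one row, so their intervals
        cannot overlap.\<close>
      have "n' \<le> m \<or> m' \<le> n"
      proof (rule ccontr)
        assume "\<not> ?thesis"
        then have "m < n'" "n < m'" by simp_all
        then have "\<not> n < m" "\<not> m < n" using 1(4) 2(2) 2(4) 1(2) True by blast+
        then have "n = m" by simp
        then have "\<not> n' < m'" "\<not> m' < n'" using 1 2 True by blast+
        then show False using ne True \<open>n = m\<close> by simp
      qed
      moreover have "grid_op (i, a) \<le> grid_op (i, b)" if "(i, a) \<in> verts quarter_grid" "(i, b) \<in> verts quarter_grid" "a \<le> b" for a b
        using strict[OF that(1,2)] that(3) by (cases "a = b") auto
      ultimately have "grid_op (i, n') \<le> grid_op (i, m) \<or> grid_op (i, m') \<le> grid_op (i, n)" using 1 2 True by blast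
      then show ?thesis using True unfolding ks_def by auto
    qed
    have par: "1 + 2 * x \<noteq> 2 + 2 * y" for x y :: nat by presburger
    have i1: "i - 1 = j - 1 \<Longrightarrow> 1 \<le> i \<Longrightarrow> 1 \<le> j \<Longrightarrow> i = j" for i j :: nat by linarith
    from kind[OF ee(1)] kind[OF ee(2)] show ?thesis
    proof (elim disjE exE conjE)
      fix i n n' j m m'
      assume "e = ((i, n), (i, n'))" "n < n'" "(i, n) \<in> verts quarter_grid" "(i, n') \<in> verts quarter_grid"
          "\<forall>l. n < l \<longrightarrow> l < n' \<longrightarrow> (i, l) \<notin> verts quarter_grid"
        and "e' = ((j, m), (j, m'))" "m < m'" "(j, m) \<in> verts quarter_grid" "(j, m') \<in> verts quarter_grid"
          "\<forall>l. m < l \<longrightarrow> l < m' \<longrightarrow> (j, l) \<notin> verts quarter_grid"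
      then show "ks e \<inter> ks e' = {}" using rr ee(3) by simp
    next
      fix i j k l assume *: "1 \<le> i" "e = ((i, 4 * j + 7), (i + 1, 4 * j + 1))" "ks e = {(1 + 2 * prod_encode (i - 1, j), Msg)}"
        "1 \<le> k" "e' = ((k, 4 * l + 7), (k + 1, 4 * l + 1))" "ks e' = {(1 + 2 * prod_encode (k - 1, l), Msg)}"
      then have "(i - 1, j) \<noteq> (k - 1, l)" using i1[of i k] ee(3) by auto
      then have "prod_encode (i - 1, j) \<noteq> prod_encode (k - 1, l)" by (simp add: prod_encode_eq)
      then show "ks e \<inter> ks e' = {}" using * by simp
    next
      fix i j k l assume *: "1 \<le> i" "e = ((i + 1, 4 * j + 2), (i, 4 * j + 8))" "ks e = {(2 + 2 * prod_encode (i - 1, j), Msg)}"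
        "1 \<le> k" "e' = ((k + 1, 4 * l + 2), (k, 4 * l + 8))" "ks e' = {(2 + 2 * prod_encode (k - 1, l), Msg)}"
      then have "(i - 1, j) \<noteq> (k - 1, l)" using i1[of i k] ee(3) by auto
      then have "prod_encode (i - 1, j) \<noteq> prod_encode (k - 1, l)" by (simp add: prod_encode_eq)
      then show "ks e \<inter> ks e' = {}" using * by simp
    qed (use row_msg par par[symmetric] in simp_all)
  qed
  have \<phi>E: "apath (\<phi>V (fst e)) (\<phi>E e) (\<phi>V (snd e))" "\<And>c. c \<in> set (\<phi>E e) \<Longrightarrow> \<exists>t k. (t, k) \<in> ks e \<and> c \<in> set (W t k)"
    if e: "e \<in> arcs quarter_grid" for e
  proof -
    show "apath (\<phi>V (fst e)) (\<phi>E e) (\<phi>V (snd e))"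
      unfolding \<phi>E_def using arc_walk[OF e] by (intro apath_awalk_to_apath) simp
    show "\<exists>t k. (t, k) \<in> ks e \<and> c \<in> set (W t k)" if "c \<in> set (\<phi>E e)" for c
      using arc_walk[OF e] awalk_to_apath_subset[of "\<phi>V (fst e)" "walk e" "\<phi>V (snd e)"] that unfolding \<phi>E_def by blast
  qed
  have \<phi>E_disj: "set (\<phi>E e) \<inter> set (\<phi>E e') = {}" if ee: "e \<in> arcs quarter_grid" "e' \<in> arcs quarter_grid" "e \<noteq> e'" for e e'
  proof (rule ccontr)
    assume "\<not> ?thesis"
    then obtain c where c: "c \<in> set (\<phi>E e)" "c \<in> set (\<phi>E e')" by blast
    obtain t k where tk: "(t, k) \<in> ks e" "c \<in> set (W t k)" using \<phi>E(2)[OF ee(1) c(1)] by blast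
    obtain t' k' where tk': "(t', k') \<in> ks e'" "c \<in> set (W t' k')" using \<phi>E(2)[OF ee(2) c(2)] by blast
    have "t = t' \<and> k = k'" using disj[OF tk(2) tk'(2)] .
    then show False using ks_disj[OF ee] tk tk' by blast
  qed
  have "\<phi>V v \<in> verts G" if "v \<in> verts quarter_grid" for v
  proof -
    obtain i n where v: "v = (i, n)" by (cases v)
    then show ?thesis using awalk_last_in_verts[OF fore[OF early[of i n]]] that unfolding \<phi>V_def by simp
  qed
  then have wi: "weak_immersion quarter_grid G \<phi>V \<phi>E"
    unfolding weak_immersion_def quarter_grid_simps(2,3) using \<phi>V_inj \<phi>E(1) \<phi>E_disj by blast
  show thesis
  proof (rule that[OF wi])
    fix R assume R: "is_ray quarter_grid R"
    define f where "f = fst R"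
    define g where "g = snd R"
    have fg: "inj f" "\<And>n. f n \<in> verts quarter_grid" "\<And>n. g n \<in> arcs quarter_grid" "\<And>n. fst (g n) = f n"
      "\<And>n. snd (g n) = f (Suc n)"
      using R unfolding is_ray_def f_def g_def quarter_grid_simps(2,3) by auto
    have inj_g: "m = n" if "g m = g n" for m n using that fg(1,4) by (metis injD)
    have sub: "(\<Union>n. set (\<phi>E (g n))) \<subseteq> (\<Union>m k. set (W m k))"
    proof
      fix c assume "c \<in> (\<Union>n. set (\<phi>E (g n)))"
      then obtain n where "c \<in> set (\<phi>E (g n))" by blast
      from \<phi>E(2)[OF fg(3) this] show "c \<in> (\<Union>m k. set (W m k))" by blast
    qed
    obtain Q where Q: "is_ray G Q" "ray_arcs Q \<subseteq> (\<Union>n. set (\<phi>E (g n)))"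
    proof (rule ray_from_apaths[of "\<lambda>n. \<phi>V (f n)" "\<lambda>n. \<phi>E (g n)"])
      show "apath (\<phi>V (f n)) (\<phi>E (g n)) (\<phi>V (f (Suc n)))" for n using \<phi>E(1)[OF fg(3)[of n]] fg(4,5) by simp
      show "inj (\<lambda>n. \<phi>V (f n))"
      proof (rule injI)
        fix m n assume "\<phi>V (f m) = \<phi>V (f n)"
        then have "f m = f n" using inj_onD[OF \<phi>V_inj _ fg(2,2)] by blast
        then show "m = n" by (rule injD[OF fg(1)])
      qed
      show "set (\<phi>E (g m)) \<inter> set (\<phi>E (g n)) = {}" if "m \<noteq> n" for m n
        using \<phi>E_disj[OF fg(3,3)] inj_g[of m n] that by blast
      show "finite {c \<in> (\<Union>n. set (\<phi>E (g n))). tail G c = z}" for z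
        by (rule finite_subset[OF _ fin[of z]]) (use sub in blast)
    qed blast
    have "near (ray_verts Q) H \<and> near H (ray_verts Q)" using rays[OF Q(1)] Q(2) sub by blast
    then show "\<exists>Q. is_ray G Q \<and> near (ray_verts Q) H \<and> near H (ray_verts Q) \<and> ray_arcs Q \<subseteq> image_arcs \<phi>E R"
      using Q unfolding image_arcs_def g_def by blast
  qed
qed

text \<open>The representative \<open>S\<close> of the end may be an anti-ray, but
  \<open>near_trans\<close> passes through either kind. So \<open>R 0\<close> can replace
  \<open>S\<close> as the hub, and its relation to a ray of the image carries over to
  \<open>S\<close>.\<close>

lemma (in wf_digraph) rays_immersion:
  assumes \<omega>: "is_end G \<omega>" and R: "\<And>i::nat. is_ray G (R i) \<and> R i \<in> \<omega>"
    and disj: "\<And>i j. i \<noteq> j \<Longrightarrow> ray_arcs (R i) \<inter> ray_arcs (R j) = {}"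
  shows "\<exists>\<phi>V \<phi>E. weak_immersion quarter_grid G \<phi>V \<phi>E \<and> rays_in_end quarter_grid G \<phi>E \<omega>"
proof -
  obtain S where S: "is_ray_or_antiray G S" "\<omega> = {Q. is_ray_or_antiray G Q \<and> ray_equiv G Q S}"
    using \<omega> unfolding is_end_def by blast
  have RS: "near (ray_verts (R i)) (ray_verts S)" "near (ray_verts S) (ray_verts (R i))" for i
    using R[of i] unfolding S(2) ray_equiv_def ray_le_near by simp_all
  have RR: "near (ray_verts (R i)) (ray_verts (R j))" for i j using near_trans[OF RS(1) RS(2) S(1)] .
  obtain T Te where "line_system G T Te (ray_verts (R 0))"
    by (rule obtain_line_system[of R, OF conjunct1[OF R] disj RR])
  then interpret line_system G T Te "ray_verts (R 0)" .
  have R0: "is_ray_or_antiray G (R 0)" using R unfolding is_ray_or_antiray_def by blast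
  obtain \<phi>V \<phi>E where \<phi>: "weak_immersion quarter_grid G \<phi>V \<phi>E"
    "\<And>P. is_ray quarter_grid P \<Longrightarrow> \<exists>Q. is_ray G Q \<and> near (ray_verts Q) (ray_verts (R 0)) \<and>
       near (ray_verts (R 0)) (ray_verts Q) \<and> ray_arcs Q \<subseteq> image_arcs \<phi>E P"
    by (rule quarter_grid_immersion, rule that, assumption+)
  have "rays_in_end quarter_grid G \<phi>E \<omega>" unfolding rays_in_end_def
  proof (intro allI impI)
    fix P assume "is_ray quarter_grid P"
    from \<phi>(2)[OF this] obtain Q where Q: "is_ray G Q" "near (ray_verts Q) (ray_verts (R 0))"
       "near (ray_verts (R 0)) (ray_verts Q)" "ray_arcs Q \<subseteq> image_arcs \<phi>E P" by blast
    have "near (ray_verts Q) (ray_verts S)" using near_trans[OF Q(2) RS(1) R0] .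
    moreover have "near (ray_verts S) (ray_verts Q)" using near_trans[OF RS(2) Q(3) R0] .
    ultimately have "Q \<in> \<omega>" unfolding S(2) ray_equiv_def ray_le_near using Q(1) by (simp add: is_ray_or_antiray_def)
    then show "\<exists>Q. is_ray G Q \<and> Q \<in> \<omega> \<and> ray_arcs Q \<subseteq> image_arcs \<phi>E P" using Q by blast
  qed
  then show ?thesis using \<phi>(1) by blast
qed

section \<open>Reversal\<close>

lemma reverse_simps: "verts (reverse_digraph G) = verts G" "arcs (reverse_digraph G) = arcs G"
  "tail (reverse_digraph G) = head G" "head (reverse_digraph G) = tail G"
  unfolding reverse_digraph_def by simp_all

lemma wf_reverse: "wf_digraph G \<Longrightarrow> wf_digraph (reverse_digraph G)"
  unfolding wf_digraph_def reverse_simps by simp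

lemma reverse_reverse: "reverse_digraph (reverse_digraph G) = G"
  unfolding reverse_digraph_def by simp

lemma awalk_reverse:
  assumes "wf_digraph G" "pre_digraph.awalk G u p v"
  shows "pre_digraph.awalk (reverse_digraph G) v (rev p) u"
    "pre_digraph.awalk_verts (reverse_digraph G) v (rev p) = rev (pre_digraph.awalk_verts G u p)"
proof -
  interpret wf_digraph G by (rule assms)
  interpret r: wf_digraph "reverse_digraph G" by (rule wf_reverse) (rule assms)
  have "r.awalk v (rev p) u \<and> r.awalk_verts v (rev p) = rev (awalk_verts u p)"
    using assms(2)
  proof (induction p arbitrary: u)
    case Nil
    then show ?case by (auto simp: awalk_Nil_iff r.awalk_Nil_iff reverse_simps)
  next
    case (Cons e p)
    then have e: "e \<in> arcs G" "u = tail G e" "awalk (head G e) p v" by (simp_all add: awalk_Cons_iff)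
    have IH: "r.awalk v (rev p) (head G e)" "r.awalk_verts v (rev p) = rev (awalk_verts (head G e) p)"
      using Cons.IH[OF e(3)] by simp_all
    have s: "r.awalk (head G e) [e] (tail G e)" using e(1) by (simp add: r.awalk_simps reverse_simps)
    have w: "r.awalk v (rev p @ [e]) (tail G e)" using r.awalk_appendI[OF IH(1) s] .
    moreover have "r.awalk_verts v (rev p @ [e]) = r.awalk_verts v (rev p) @ [tail G e]"
      using r.awalk_verts_append[OF w] by (simp add: reverse_simps)
    ultimately show ?case using IH(2) e(2) by simp
  qed
  then show "r.awalk v (rev p) u" "r.awalk_verts v (rev p) = rev (awalk_verts u p)" by simp_all
qed

lemma apath_reverse:
  assumes "wf_digraph G" "pre_digraph.apath G u p v"
  shows "pre_digraph.apath (reverse_digraph G) v (rev p) u"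
  using awalk_reverse[OF assms(1), of u p v] assms(2) unfolding pre_digraph.apath_def by simp

lemma is_ray_reverse: "is_ray (reverse_digraph G) R \<longleftrightarrow> is_antiray G R"
  "is_antiray (reverse_digraph G) R \<longleftrightarrow> is_ray G R"
  unfolding is_ray_def is_antiray_def reverse_simps by simp_all

lemma ray_le_reverse:
  assumes "wf_digraph G" "ray_le G Q R"
  shows "ray_le (reverse_digraph G) R Q"
proof -
  define r where "r P = (snd (snd P), rev (fst (snd P)), fst P)" for P :: "('a, 'b) dipath"
  obtain P :: "nat \<Rightarrow> _" where P: "\<forall>i. is_AB_dipath G (ray_verts Q) (ray_verts R) (P i)"
    "\<forall>i j. i \<noteq> j \<longrightarrow> dipath_verts G (P i) \<inter> dipath_verts G (P j) = {}"
    using assms(2) unfolding ray_le_def by (elim exE conjE)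
  have ap: "pre_digraph.apath G (fst (P i)) (fst (snd (P i))) (snd (snd (P i)))" for i
    using P(1) unfolding is_AB_dipath_def by simp
  have v: "dipath_verts (reverse_digraph G) (r (P i)) = dipath_verts G (P i)" for i
    using awalk_reverse(2)[OF assms(1), of "fst (P i)" "fst (snd (P i))" "snd (snd (P i))"] ap[of i]
    unfolding pre_digraph.apath_def dipath_verts_def r_def by simp
  have "is_AB_dipath (reverse_digraph G) (ray_verts R) (ray_verts Q) (r (P i))" for i
    unfolding is_AB_dipath_def v
    using P(1) apath_reverse[OF assms(1) ap[of i]] unfolding is_AB_dipath_def r_def by simp
  then show ?thesis unfolding ray_le_def using P(2) v by (intro exI[of _ "\<lambda>i. r (P i)"]) simp
qed

text \<open>Reversal exchanges the two sides of \<open>ray_le\<close>, and \<open>ray_equiv\<close>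
  is symmetric in them; therefore an end remains the same set.\<close>

lemma ray_equiv_reverse:
  assumes "wf_digraph G"
  shows "ray_equiv (reverse_digraph G) Q R \<longleftrightarrow> ray_equiv G Q R"
  using ray_le_reverse[OF assms] ray_le_reverse[OF wf_reverse[OF assms]]
  unfolding ray_equiv_def reverse_reverse by blast

lemma is_end_reverse:
  assumes "wf_digraph G" "is_end G \<omega>"
  shows "is_end (reverse_digraph G) \<omega>"
proof -
  have "is_ray_or_antiray (reverse_digraph G) Q \<longleftrightarrow> is_ray_or_antiray G Q" for Q
    unfolding is_ray_or_antiray_def is_ray_reverse by blast
  then show ?thesis using assms(2) unfolding is_end_def ray_equiv_reverse[OF assms(1)] by simp
qed

theorem theorem6p1:
  fixes D :: "('a, 'b) pre_digraph" and \<omega> :: "('a, 'b) iray set"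
  assumes "wf_digraph D" and "is_end D \<omega>"
  shows "((\<exists>R :: nat \<Rightarrow> ('a, 'b) iray.
             (\<forall>i. is_ray D (R i) \<and> R i \<in> \<omega>) \<and>
             (\<forall>i j. i \<noteq> j \<longrightarrow> ray_arcs (R i) \<inter> ray_arcs (R j) = {}))
          \<longrightarrow> (\<exists>\<phi>V \<phi>E. weak_immersion quarter_grid D \<phi>V \<phi>E \<and>
                        rays_in_end quarter_grid D \<phi>E \<omega>))
       \<and> ((\<exists>R :: nat \<Rightarrow> ('a, 'b) iray.
             (\<forall>i. is_antiray D (R i) \<and> R i \<in> \<omega>) \<and>
             (\<forall>i j. i \<noteq> j \<longrightarrow> ray_arcs (R i) \<inter> ray_arcs (R j) = {}))
          \<longrightarrow> (\<exists>\<phi>V \<phi>E. weak_immersion reversed_quarter_grid D \<phi>V \<phi>E \<and>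
                        antirays_in_end reversed_quarter_grid D \<phi>E \<omega>))"
proof (intro conjI impI; elim exE conjE)
  fix R :: "nat \<Rightarrow> ('a, 'b) iray"
  assume "\<forall>i. is_ray D (R i) \<and> R i \<in> \<omega>" "\<forall>i j. i \<noteq> j \<longrightarrow> ray_arcs (R i) \<inter> ray_arcs (R j) = {}"
  then show "\<exists>\<phi>V \<phi>E. weak_immersion quarter_grid D \<phi>V \<phi>E \<and> rays_in_end quarter_grid D \<phi>E \<omega>"
    by (intro wf_digraph.rays_immersion[OF assms, of R]) simp_all
next
  fix R :: "nat \<Rightarrow> ('a, 'b) iray"
  assume R: "\<forall>i. is_antiray D (R i) \<and> R i \<in> \<omega>" "\<forall>i j. i \<noteq> j \<longrightarrow> ray_arcs (R i) \<inter> ray_arcs (R j) = {}"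
  obtain \<phi>V \<phi>E where \<phi>: "weak_immersion quarter_grid (reverse_digraph D) \<phi>V \<phi>E"
    "rays_in_end quarter_grid (reverse_digraph D) \<phi>E \<omega>"
    using wf_digraph.rays_immersion[OF wf_reverse[OF assms(1)] is_end_reverse[OF assms], of R] R
    unfolding is_ray_reverse by blast
  \<comment> \<open>Reversing the arc lists gives paths of \<open>D\<close>; their arc sets, and
    with them disjointness and \<open>image_arcs\<close>, do not change.\<close>
  have "pre_digraph.apath D (\<phi>V (head quarter_grid e)) (rev (\<phi>E e)) (\<phi>V (tail quarter_grid e))"
    if "e \<in> arcs quarter_grid" for e
    using apath_reverse[OF wf_reverse[OF assms(1)]] \<phi>(1) that
    unfolding weak_immersion_def reverse_reverse by blast
  then have "weak_immersion reversed_quarter_grid D \<phi>V (rev \<circ> \<phi>E)"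
    using \<phi>(1) unfolding weak_immersion_def reversed_quarter_grid_def reverse_simps by simp
  moreover have "antirays_in_end reversed_quarter_grid D (rev \<circ> \<phi>E) \<omega>"
    using \<phi>(2) unfolding rays_in_end_def antirays_in_end_def reversed_quarter_grid_def is_ray_reverse
      image_arcs_def by simp
  ultimately show "\<exists>\<phi>V \<phi>E. weak_immersion reversed_quarter_grid D \<phi>V \<phi>E \<and>
      antirays_in_end reversed_quarter_grid D \<phi>E \<omega>" by blast
qed

end
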